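(* Assume the setting, the algorithm and the weights $w_{j,\ell}^i$ described in the context. Suppose the Lipschitz property (constant $L\ge 0$), the three-point property (constants $\gamma_{K,j}\in\mathbb R$, $L_3\ge0$, $p\in[1,2]$, $\theta_A$) and the monotonicity property (constants $\gamma_{G,j},\gamma_{F^*,\ell}\ge0$) hold, with $\gamma_{G,j}+\gamma_{K,j}\ge 0$ for $j=1,\dots,m$, and suppose that for some $\alpha_y>0$ and $\zeta_\ell\ge0$ (with $\zeta_\ell>0$ if $p>1$) the numbers $$\bar\gamma_{F^*,\ell}:=\begin{cases}\gamma_{F^*,\ell}, & Q_\ell P_{NL}=0,\\ \gamma_{F^*,\ell}-(p-1)\zeta_\ell-\alpha_y, & Q_\ell P_{NL}\neq0,\end{cases}$$ satisfy $\bar\gamma_{F^*,\ell}\ge 0$ for $\ell=1,\dots,n$. For each $j$ let either $0\le\tilde\gamma_{G,j}<\pi_j(\gamma_{G,j}+\gamma_{K,j})$ or $\tilde\gamma_{G,j}=\gamma_{G,j}+\gamma_{K,j}=0$. Let the iterates $u^i=(x^i,y^i)$ be generated by the algorithm with $$\sigma_\ell^{i+1}:=\frac{\sigma_\ell^i}{1+2\sigma_\ell^i\bar\gamma_{F^*,\ell}},\qquad \bar\omega^i\equiv1,\qquad \tau_j^{i+1}:=\frac{\tau_j^i}{1+2\tau_j^i\tilde\gamma_{G,j}},$$ where the initial $\tau_j^0,\sigma_\ell^0>0$ satisfy, for some $0<\delta<\kappa<1$, $\rho_x,\rho_\ell\ge0$, and for all $i\in\mathbb N$, $j=1,\dots,m$,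 $\ell=1,\dots,n$, $$1-\kappa\ge\Big\|\sum_{j\in S(i)}\sqrt{\tfrac{w_{j,\ell}^i\sigma_\ell^0\tau_j^0}{\pi_j}}\,Q_\ell\nabla K(x^i)P_j\Big\|^2,\qquad \delta\ge\tau_j^0\bar L+\tau_j^0 c_j,$$ where $$c_j:=\begin{cases}2(1-\pi_j)(\gamma_{G,j}+\gamma_{K,j})\dfrac{\gamma_{G,j}+\gamma_{K,j}-\tilde\gamma_{G,j}}{\pi_j(\gamma_{G,j}+\gamma_{K,j})-\tilde\gamma_{G,j}}, & \gamma_{G,j}+\gamma_{K,j}>0,\\ 0,&\gamma_{G,j}+\gamma_{K,j}=0,\end{cases}$$ $$\bar L:=L_3+L\Big(\max_{j=1,\dots,m}\Big(\frac1{\pi_j}+1\Big)^2\sum_{\ell=1}^n\rho_\ell+\frac{nL}{2\alpha_y}\rho_x^2\Big).$$ Assume moreover for all $i\in\mathbb N$, with $A:=\sum_{j\in S(i)}\pi_j^{-1}P_j$, that $$\mathbb E[\theta_A\mid\mathcal O_{i-1}]\ge p^{-p}\sum_{\ell=1}^n\zeta_\ell^{1-p}\rho_\ell^{2-p},$$ $$\mathbb P\big[\|x^{i+1}-\hat x\|\le\rho_x,\ \|Q_\ell(y^{i+1}-\hat y)\|_{P_{NL}}\le\rho_\ell\ (\ell=1,\dots,n)\,\big|\,\mathcal O_{i-1}\big]=1 .$$ Then $\mathbb E[\|P_j(x^N-\hat x)\|^2]\to0$ at the rate $O(1/N)$ for all $j$ with $\tilde\gamma_{G,j}>0$, and $\mathbb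 E[\|Q_\ell(y^N-\hat y)\|^2]\to0$ at the rate $O(1/N)$ for all $\ell$ with $\bar\gamma_{F^*,\ell}>0$.
   Context: Setting. $X,Y$ are real Hilbert spaces and $K\in C^1(X;Y)$ has derivative $\nabla K(x)$ (a bounded linear operator $X\to Y$) with adjoint $\nabla K(x)^*$. $P_1,\dots,P_m$ on $X$ and $Q_1,\dots,Q_n$ on $Y$ are families of mutually orthogonal orthogonal projections, each family summing to the identity; $x_j:=P_jx$, $y_\ell:=Q_\ell y$. $G_j:X\to(-\infty,\infty]$ and $F_\ell:Y\to(-\infty,\infty]$ are convex, proper, lower semicontinuous, $F_\ell^*$ is the Fenchel conjugate, $G(x):=\sum_jG_j(P_jx)$, $F^*(y):=\sum_\ell F_\ell^*(Q_\ell y)$. $\hat u=(\hat x,\hat y)$ is a critical point: $-\nabla K(\hat x)^*\hat y\in\partial G(\hat x)$ and $K(\hat x)\in\partial F^*(\hat y)$. $Y_L:=\{y\in Y: x\mapsto\langle y,K(x)\rangle\text{ is linear}\}$, $P_{NL}$ is the orthogonal projection onto $Y_{NL}:=Y_L^\perp$. For a positive semidefinite operator $T$, $\|z\|_T:=\sqrt{\langle Tz,z\rangle}$; for general self-adjoint $T$, $\|z\|_T^2:=\langle Tz,z\rangle$; $\langle z,z'\rangle_T:=\langle Tz,z'\rangle$. Convention $0^0=1$. Properties. Lipschitz property: there is a neighbourhood $\mathcal X_K$ of $\hat x$ with $\|\nabla K(x)-\nabla K(x')\|\le L\|x-x'\|$ for $x,x'\in\mathcal X_K$. Three-point property: for a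 neighbourhood $\mathcal X_K$ of $\hat x$, with $\Gamma_K:=\sum_j\gamma_{K,j}P_j$, for every $A=\sum_ja_jP_j$ with $a_j\ge0$ there is $\theta_A\ge0$ such that for all $x,x'\in\mathcal X_K$: $\langle[\nabla K(x)-\nabla K(\hat x)]^*\hat y,x'-\hat x\rangle_A\ge\|x'-\hat x\|^2_{A\Gamma_K}+\theta_A\|K(\hat x)-K(x)-\nabla K(x)(\hat x-x)\|^p-\frac{L_3}{2}\|x'-x\|_A^2$. Monotonicity property: there are neighbourhoods $\mathcal X_G$ of $\hat x$ and $\mathcal Y_{F^*}$ of $\hat y$ such that for every $\hat q\in\partial G(\hat x)$, $x\in\mathcal X_G$, $q\in\partial G(x)$: $\langle q-\hat q,x-\hat x\rangle\ge\sum_j\gamma_{G,j}\|P_j(x-\hat x)\|^2$; and for every $\hat r\in\partial F^*(\hat y)$, $y\in\mathcal Y_{F^*}$, $r\in\partial F^*(y)$: $\langle r-\hat r,y-\hat y\rangle\ge\sum_\ell\gamma_{F^*,\ell}\|Q_\ell(y-\hat y)\|^2$. Probability. $(\Omega,\mathcal O,\mathbb P)$ is a probability space with increasing sub-$\sigma$-algebras $\mathcal O_{-1}\subseteq\mathcal O_0\subseteq\mathcal O_1\subseteq\cdots\subseteq\mathcal O$. $S(i)\subseteq\{1,\dots,m\}$ is an $\mathcal O_i$-measurable random set with $\mathbb P[j\in S(i)\mid\mathcal O_{i-1}]=\pi_j>0$ independent of $i$. Conditions involving random quantities are meant almost surely. Algorithm (full dual updates). Given an initial iterate $(x^0,y^0)\in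 X\times Y$ and step length parameters $\tau_j^i,\sigma_\ell^{i+1},\bar\omega^i>0$, for $i=0,1,2,\dots$ put, for all $j$ and $\ell$, $x_j^{i+1}:=(I+\tau_j^iP_j\partial G_jP_j)^{-1}(x_j^i-\tau_j^iP_j\nabla K(x^i)^*y^i)$ if $j\in S(i)$ and $x_j^{i+1}:=x_j^i$ if $j\notin S(i)$; $\bar x_j^{i+1}:=x_j^{i+1}+\bar\omega^i(x_j^{i+1}-x_j^i)/\pi_j$ if $j\in S(i)$ and $\bar x_j^{i+1}:=x_j^i$ if $j\notin S(i)$; $y_\ell^{i+1}:=(I+\sigma_\ell^{i+1}Q_\ell\partial F_\ell^*Q_\ell)^{-1}(y_\ell^i+\sigma_\ell^{i+1}Q_\ell K(\bar x^{i+1}))$. Here $(I+\tau P_j\partial G_jP_j)^{-1}(v)$ for $v\in P_jX$ is the proximal point, i.e. the minimiser over $z\in P_jX$ of $G_j(z)+\|z-v\|^2/(2\tau)$; similarly for $F_\ell^*$ on $Q_\ell Y$. Weights. $w_{j,\ell,k}=1/w_{j,k,\ell}>0$ ($j\le m$; $\ell,k\le n$) are some fixed numbers, $\bar{\mathcal V}_j^i(\ell):=\{k: Q_\ell\nabla K(x^i)P_j\nabla K(x^i)^*Q_k\ne0,\ j\in S(i)\}$, and $w_{j,\ell}^i:=\sum_{k\in\bar{\mathcal V}_j^i(\ell)}w_{j,\ell,k}$ if $Q_\ell\nabla K(x^i)P_j\ne0$, $w_{j,\ell}^i:=0$ otherwise.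
   Formalization: Added, as the claim fails otherwise: almost surely for all i, the segment from x^i to x̄^{i+1} lies in X_K, y^{i+1} lies in Y_{F*}, and x̂+P_j(x^{i+1}−x̂) lies in X_G for each updated block j∈S(i). *)

theory Defs
  imports "HOL-Probability.Probability" "HOL-Library.Landau_Symbols"
begin

text \<open>Real Hilbert spaces are types of sort {real_inner, complete_space}; bounded linear
  operators are elements of the library's blinfun type, so that norms of operators are operator
  norms. Blocks are indexed by {1..m} (primal) and {1..n} (dual).\<close>

definition orth_projector :: "('a::real_inner \<Rightarrow>\<^sub>L 'a) \<Rightarrow> bool" where
  "orth_projector P \<longleftrightarrow> P o\<^sub>L P = P \<and> (\<forall>u v. P u \<bullet> v = u \<bullet> P v)"

definition block_decomposition :: "nat \<Rightarrow> (nat \<Rightarrow> 'a::real_inner \<Rightarrow>\<^sub>L 'a) \<Rightarrow> bool" where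
  "block_decomposition m P \<longleftrightarrow>
     (\<forall>j\<in>{1..m}. orth_projector (P j)) \<and>
     (\<forall>i\<in>{1..m}. \<forall>j\<in>{1..m}. i \<noteq> j \<longrightarrow> P i o\<^sub>L P j = 0) \<and>
     (\<Sum>j=1..m. P j) = id_blinfun"

definition proper_convex_lsc :: "('a::real_inner \<Rightarrow> ereal) \<Rightarrow> bool" where
  "proper_convex_lsc f \<longleftrightarrow>
     (\<forall>x. f x \<noteq> -\<infinity>) \<and> (\<exists>x. f x \<noteq> \<infinity>) \<and>
     (\<forall>x y t. 0 < t \<and> t < 1 \<longrightarrow>
        f ((1 - t) *\<^sub>R x + t *\<^sub>R y) \<le> ereal (1 - t) * f x + ereal t * f y) \<and>
     (\<forall>x. f x \<le> Liminf (at x) f)"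

definition fenchel_conj :: "('a::real_inner \<Rightarrow> ereal) \<Rightarrow> 'a \<Rightarrow> ereal" where
  "fenchel_conj f y = (SUP x. ereal (y \<bullet> x) - f x)"

definition block_sum ::
    "nat \<Rightarrow> (nat \<Rightarrow> 'a::real_inner \<Rightarrow>\<^sub>L 'a) \<Rightarrow> (nat \<Rightarrow> 'a \<Rightarrow> ereal) \<Rightarrow> 'a \<Rightarrow> ereal" where
  "block_sum m P g x = (\<Sum>j=1..m. g j (P j x))"

text \<open>Convex subdifferential; it is empty outside the effective domain.\<close>

definition subdiff :: "('a::real_inner \<Rightarrow> ereal) \<Rightarrow> 'a \<Rightarrow> 'a set" where
  "subdiff f x = {q. \<bar>f x\<bar> \<noteq> \<infinity> \<and> (\<forall>x'. f x + ereal (q \<bullet> (x' - x)) \<le> f x')}"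

text \<open>The proximal point of v for f on the subspace V with step length t; on closed V it is the
  unique minimiser whenever f is convex and lower semicontinuous, and proper on V.\<close>

definition prox :: "'a::real_inner set \<Rightarrow> ('a \<Rightarrow> ereal) \<Rightarrow> real \<Rightarrow> 'a \<Rightarrow> 'a" where
  "prox V f t v = arg_min_on (\<lambda>z. f z + ereal ((norm (z - v))\<^sup>2 / (2 * t))) V"

definition lin_dual :: "('a::real_inner \<Rightarrow> 'b::real_inner) \<Rightarrow> 'b set" where
  "lin_dual K = {y. linear (\<lambda>x. y \<bullet> K x)}"

definition orth_proj_onto :: "'a::real_inner set \<Rightarrow> 'a \<Rightarrow> 'a" where
  "orth_proj_onto V y = (THE v. v \<in> V \<and> y - v \<in> V\<^sup>\<bottom>)"

definition P_NL :: "('a::real_inner \<Rightarrow> 'b::real_inner) \<Rightarrow> 'b \<Rightarrow> 'b" where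
  "P_NL K = orth_proj_onto ((lin_dual K)\<^sup>\<bottom>)"

definition psd_norm :: "('a::real_inner \<Rightarrow> 'a) \<Rightarrow> 'a \<Rightarrow> real" where
  "psd_norm T z = sqrt (T z \<bullet> z)"

text \<open>Real power with the convention that 0 to the power 0 is 1; the library's powr
  gives 0 there.\<close>

definition rpow :: "real \<Rightarrow> real \<Rightarrow> real" where
  "rpow b a = (if a = 0 then 1 else b powr a)"

definition lipschitz_property ::
    "('a::real_inner \<Rightarrow> 'a \<Rightarrow>\<^sub>L 'b::real_inner) \<Rightarrow> 'a set \<Rightarrow> real \<Rightarrow> bool" where
  "lipschitz_property dK XK L \<longleftrightarrow>
     (\<forall>x\<in>XK. \<forall>x'\<in>XK. norm (dK x - dK x') \<le> L * norm (x - x'))"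

text \<open>The constants theta_A are collected in a function of the operator A.\<close>

definition three_point_property ::
    "nat \<Rightarrow> (nat \<Rightarrow> 'a::real_inner \<Rightarrow>\<^sub>L 'a) \<Rightarrow> ('a \<Rightarrow> 'b::real_inner) \<Rightarrow> ('a \<Rightarrow> 'a \<Rightarrow>\<^sub>L 'b) \<Rightarrow>
     'a \<Rightarrow> 'b \<Rightarrow> 'a set \<Rightarrow> (nat \<Rightarrow> real) \<Rightarrow> (('a \<Rightarrow>\<^sub>L 'a) \<Rightarrow> real) \<Rightarrow> real \<Rightarrow> real \<Rightarrow> bool" where
  "three_point_property m P K dK xh yh XK gamK \<theta> p L3 \<longleftrightarrow>
     (\<forall>a. (\<forall>j\<in>{1..m}. 0 \<le> a j) \<longrightarrow>
        (let A = (\<Sum>j=1..m. a j *\<^sub>R P j); \<Gamma> = (\<Sum>j=1..m. gamK j *\<^sub>R P j) in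
           0 \<le> \<theta> A \<and>
           (\<forall>x\<in>XK. \<forall>x'\<in>XK.
              A (adjoint (dK x - dK xh) yh) \<bullet> (x' - xh)
              \<ge> (A o\<^sub>L \<Gamma>) (x' - xh) \<bullet> (x' - xh)
                + \<theta> A * norm (K xh - K x - dK x (xh - x)) powr p
                - L3 / 2 * (A (x' - x) \<bullet> (x' - x)))))"

definition monotonicity_property ::
    "nat \<Rightarrow> (nat \<Rightarrow> 'a::real_inner \<Rightarrow>\<^sub>L 'a) \<Rightarrow> ('a \<Rightarrow> ereal) \<Rightarrow> 'a \<Rightarrow> 'a set \<Rightarrow>
     (nat \<Rightarrow> real) \<Rightarrow> bool" where
  "monotonicity_property m P g xh U gam \<longleftrightarrow>
     (\<forall>qh\<in>subdiff g xh. \<forall>x\<in>U. \<forall>q\<in>subdiff g x.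
        (q - qh) \<bullet> (x - xh) \<ge> (\<Sum>j=1..m. gam j * (norm (P j (x - xh)))\<^sup>2))"

text \<open>One realisation of the method. The blocks of an iterate determine it, as the projections
  sum to the identity.\<close>

definition block_pdps ::
    "nat \<Rightarrow> nat \<Rightarrow> (nat \<Rightarrow> 'a::real_inner \<Rightarrow>\<^sub>L 'a) \<Rightarrow> (nat \<Rightarrow> 'b::real_inner \<Rightarrow>\<^sub>L 'b) \<Rightarrow>
     (nat \<Rightarrow> 'a \<Rightarrow> ereal) \<Rightarrow> (nat \<Rightarrow> 'b \<Rightarrow> ereal) \<Rightarrow> ('a \<Rightarrow> 'b) \<Rightarrow> ('a \<Rightarrow> 'a \<Rightarrow>\<^sub>L 'b) \<Rightarrow>
     (nat \<Rightarrow> real) \<Rightarrow> (nat \<Rightarrow> nat \<Rightarrow> real) \<Rightarrow> (nat \<Rightarrow> nat \<Rightarrow> real) \<Rightarrow> (nat \<Rightarrow> real) \<Rightarrow>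
     'a \<Rightarrow> 'b \<Rightarrow> (nat \<Rightarrow> nat set) \<Rightarrow> (nat \<Rightarrow> 'a) \<Rightarrow> (nat \<Rightarrow> 'a) \<Rightarrow> (nat \<Rightarrow> 'b) \<Rightarrow> bool" where
  "block_pdps m n P Q G F K dK pr \<tau> \<sigma> om x0 y0 S x xbar y \<longleftrightarrow>
     x 0 = x0 \<and> y 0 = y0 \<and>
     (\<forall>i. \<forall>j\<in>{1..m}.
        P j (x (Suc i)) =
          (if j \<in> S i
           then prox (range (P j)) (G j) (\<tau> i j)
                  (P j (x i) - \<tau> i j *\<^sub>R P j (adjoint (dK (x i)) (y i)))
           else P j (x i)) \<and>
        P j (xbar (Suc i)) =
          (if j \<in> S i
           then P j (x (Suc i)) + (om i / pr j) *\<^sub>R (P j (x (Suc i)) - P j (x i))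
           else P j (x i))) \<and>
     (\<forall>i. \<forall>l\<in>{1..n}.
        Q l (y (Suc i)) =
          prox (range (Q l)) (fenchel_conj (F l)) (\<sigma> (Suc i) l)
            (Q l (y i) + \<sigma> (Suc i) l *\<^sub>R Q l (K (xbar (Suc i)))))"

text \<open>Locality of the iterates. The neighbourhoods XK, XG and YF are those on which the Lipschitz,
  three-point and monotonicity properties hold. Besides the iterates, two auxiliary kinds of points
  have to lie in them: the segment on which K is linearised around the current iterate, and, since
  only the randomly selected blocks are updated, the points that differ from the critical point in
  one updated block only. If XK is convex, and XG is a ball around the critical point, this merely
  says that the iterates and the extrapolated points stay in the neighbourhoods.\<close>

definition iterates_local ::
    "(nat \<Rightarrow> 'a::real_inner \<Rightarrow>\<^sub>L 'a) \<Rightarrow> 'a \<Rightarrow> 'a set \<Rightarrow> 'a set \<Rightarrow> 'b set \<Rightarrow>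
     nat set \<Rightarrow> 'a \<Rightarrow> 'a \<Rightarrow> 'a \<Rightarrow> 'b \<Rightarrow> bool" where
  "iterates_local P xh XK XG YF S x xbar_next x_next y_next \<longleftrightarrow>
     closed_segment x xbar_next \<subseteq> XK \<and>
     (\<forall>j\<in>S. xh + P j (x_next - xh) \<in> XG) \<and>
     y_next \<in> YF"

text \<open>The weights; dKx is the derivative of K at the current iterate, S the current set of
  selected blocks, and w the fixed family of positive numbers.\<close>

definition conn_set ::
    "nat \<Rightarrow> (nat \<Rightarrow> 'a::real_inner \<Rightarrow>\<^sub>L 'a) \<Rightarrow> (nat \<Rightarrow> 'b::real_inner \<Rightarrow>\<^sub>L 'b) \<Rightarrow>
     ('a \<Rightarrow>\<^sub>L 'b) \<Rightarrow> nat set \<Rightarrow> nat \<Rightarrow> nat \<Rightarrow> nat set" where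
  "conn_set n P Q dKx S j l =
     {k\<in>{1..n}. (\<exists>v. Q l (dKx (P j (adjoint dKx (Q k v)))) \<noteq> 0) \<and> j \<in> S}"

definition block_weight ::
    "nat \<Rightarrow> (nat \<Rightarrow> 'a::real_inner \<Rightarrow>\<^sub>L 'a) \<Rightarrow> (nat \<Rightarrow> 'b::real_inner \<Rightarrow>\<^sub>L 'b) \<Rightarrow>
     (nat \<Rightarrow> nat \<Rightarrow> nat \<Rightarrow> real) \<Rightarrow> ('a \<Rightarrow>\<^sub>L 'b) \<Rightarrow> nat set \<Rightarrow> nat \<Rightarrow> nat \<Rightarrow> real" where
  "block_weight n P Q w dKx S j l =
     (if Q l o\<^sub>L dKx o\<^sub>L P j \<noteq> 0 then (\<Sum>k\<in>conn_set n P Q dKx S j l. w j l k) else 0)"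

end

theory Submission
  imports Defs
begin

text \<open>The proof rests on the potential

  sum_j |P_j (x - xh)|^2 / (2 pi_j tau_j) + sum_l |Q_l (y - yh)|^2 / (2 sigma_l) - <dK(x)(x - xh), y - yh>,

with sigma taken one step ahead. Testing the proximal updates with the weights 1 / pi_j, and writing
K(xbar) - K(xh) as a linear part plus two linearisation errors, gives a pathwise inequality between
consecutive potentials. The errors and the change of dK between consecutive iterates are orthogonal
to the dual directions in which K is linear, so only the components of y - yh controlled by rho
enter; they are absorbed by the increments of x through the step length condition, by the
three-point property through Young's inequality, and by the strong convexity of the conjugates.
What is left over either has conditional mean zero, since block j is updated with conditional
probability pi_j, or turns under the expectation into the coupling term of the potential. Hence the
expected potential does not increase. The norm condition, which sees only the updated blocks, also
bounds the expected coupling term by a fraction sqrt (1 - kappa) of the quadratic part, and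
the weights 1 / tau_j and 1 / sigma_l grow linearly when the acceleration factors are positive.\<close>

section \<open>Proximal points and projections in Hilbert spaces\<close>

text \<open>\<open>prox\<close>, \<open>adjoint\<close> and \<open>orth_proj_onto\<close> are given
  by choice or by a definite description, so nothing is known of them before existence is settled. A
  single argument does this: a convex lower semicontinuous function with a minorant of linear
  growth, plus a squared distance, attains its minimum on a closed subspace. The Riesz vector is the
  proximal point of a negative linear functional, which yields adjoints, and the orthogonal
  projection is the proximal point of the zero function.

  In the descent estimate the squared primal increments are split. A share 1 - \<delta>, together
  with the squared dual increments, pays for the product of primal and dual increments; this is
  where \<delta> < \<kappa> enters. The share \<delta> pays for nonlinearity and for blocks left
  alone. The linearisation error seen from the critical point cannot be charged to the increments,
  as it does not shrink with them. The constants \<theta> have to cover it, and they do so only in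
  the conditional mean, which is why the pathwise inequality keeps a term of unknown sign.\<close>

lemma proper_convex_lscD:
  assumes "proper_convex_lsc f"
  shows "f x \<noteq> -\<infinity>"
    and "0 < t \<Longrightarrow> t < 1 \<Longrightarrow> f ((1 - t) *\<^sub>R x + t *\<^sub>R y) \<le> ereal (1 - t) * f x + ereal t * f y"
    and "f x \<le> Liminf (at x) f"
  using assms unfolding proper_convex_lsc_def by auto

lemma proper_convex_lsc_real:
  assumes "proper_convex_lsc f" "f x \<noteq> \<infinity>"
  shows "f x = ereal (real_of_ereal (f x))"
  using assms proper_convex_lscD(1)[OF assms(1), of x] by (cases "f x") auto

lemma proper_convex_lsc_segment:
  assumes f: "proper_convex_lsc f" and x: "f x = ereal a" and y: "f y = ereal b"
    and t: "0 < t" "t < 1"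
  shows "f ((1 - t) *\<^sub>R x + t *\<^sub>R y) = ereal (real_of_ereal (f ((1 - t) *\<^sub>R x + t *\<^sub>R y)))"
    and "real_of_ereal (f ((1 - t) *\<^sub>R x + t *\<^sub>R y)) \<le> (1 - t) * a + t * b"
proof -
  have le: "f ((1 - t) *\<^sub>R x + t *\<^sub>R y) \<le> ereal ((1 - t) * a + t * b)"
    using proper_convex_lscD(2)[OF f t, of x y] x y by simp
  then show *: "f ((1 - t) *\<^sub>R x + t *\<^sub>R y) = ereal (real_of_ereal (f ((1 - t) *\<^sub>R x + t *\<^sub>R y)))"
    by (intro proper_convex_lsc_real[OF f]) auto
  show "real_of_ereal (f ((1 - t) *\<^sub>R x + t *\<^sub>R y)) \<le> (1 - t) * a + t * b"
    using le by (subst (asm) *) simp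
qed

lemma proper_convex_lsc_eventually:
  assumes f: "proper_convex_lsc f" and C: "C < f x" and lim: "z \<longlonglongrightarrow> x"
  shows "eventually (\<lambda>n. C < f (z n)) sequentially"
proof -
  have "C < Liminf (at x) f" using C proper_convex_lscD(3)[OF f, of x] by (rule less_le_trans)
  then have "eventually (\<lambda>y. C < f y) (at x)" by (rule less_LiminfD)
  \<comment> \<open>\<open>at x\<close> leaves out \<open>x\<close> itself, but the sequence may hit
    its limit; the assumption \<open>C < f x\<close> fills this gap.\<close>
  then have "eventually (\<lambda>y. C < f y) (nhds x)"
    using C unfolding eventually_at_filter by (auto elim!: eventually_mono)
  then show ?thesis using lim by (rule eventually_compose_filterlim)
qed

text \<open>With s = \<open>norm (z - v)\<close>, the function s^2 / (2 t) - b s is smallest at s =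
  t b. Hence a proximal objective is bounded below as soon as \<open>f\<close> has a minorant of
  linear growth.\<close>

lemma quadratic_lower_bound:
  fixes z v :: "'a::real_inner"
  assumes t: "0 < t" and b: "0 \<le> b"
  shows "- b * norm v - t * b\<^sup>2 / 2 \<le> - b * norm z + (norm (z - v))\<^sup>2 / (2 * t)"
proof -
  have "0 \<le> (norm (z - v) - t * b)\<^sup>2 / (2 * t)" using t by simp
  also have "\<dots> = (norm (z - v))\<^sup>2 / (2 * t) - b * norm (z - v) + t * b\<^sup>2 / 2"
    using t by (simp add: field_simps power2_eq_square)
  finally have "b * norm (z - v) - t * b\<^sup>2 / 2 \<le> (norm (z - v))\<^sup>2 / (2 * t)" by simp
  moreover have "b * norm z \<le> b * (norm v + norm (z - v))"
    using b norm_triangle_sub[of z v] by (intro mult_left_mono) auto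
  ultimately show ?thesis by (simp add: algebra_simps)
qed

text \<open>The subtracted term is the exact gain over plain convexity; it makes minimising
  sequences Cauchy.\<close>

lemma quadratic_segment:
  fixes x y v :: "'a::real_inner"
  shows "(norm ((1 - s) *\<^sub>R x + s *\<^sub>R y - v))\<^sup>2
    = (1 - s) * (norm (x - v))\<^sup>2 + s * (norm (y - v))\<^sup>2 - s * (1 - s) * (norm (x - y))\<^sup>2"
  unfolding power2_norm_eq_inner
  by (simp add: inner_simps algebra_simps inner_commute power2_eq_square)

text \<open>By strong convexity a minimising sequence is Cauchy.\<close>

lemma prox_minimiser_exists:
  fixes f :: "'a::{real_inner, complete_space} \<Rightarrow> ereal"
  assumes f: "proper_convex_lsc f" and V: "closed V" "subspace V"
    and z0: "z0 \<in> V" "f z0 \<noteq> \<infinity>" and t: "0 < t"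
    and minorant: "0 \<le> b" "\<And>z. z \<in> V \<Longrightarrow> ereal (a - b * norm z) \<le> f z"
  obtains z where "z \<in> V"
    "\<And>z'. z' \<in> V \<Longrightarrow> f z + ereal ((norm (z - v))\<^sup>2 / (2 * t)) \<le> f z' + ereal ((norm (z' - v))\<^sup>2 / (2 * t))"
proof -
  define g where "g z = real_of_ereal (f z)" for z
  define D where "D = {z\<in>V. f z \<noteq> \<infinity>}"
  define H where "H z = g z + (norm (z - v))\<^sup>2 / (2 * t)" for z
  have fg: "f z = ereal (g z)" if "z \<in> D" for z
    using that proper_convex_lsc_real[OF f] by (auto simp: D_def g_def)
  have lb: "a - b * norm v - t * b\<^sup>2 / 2 \<le> H z" if "z \<in> D" for z
  proof -
    have "a - b * norm z \<le> g z" using minorant(2)[of z] that fg[OF that] by (auto simp: D_def)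
    then show ?thesis using quadratic_lower_bound[OF t minorant(1), of v z] by (simp add: H_def)
  qed
  have bdd: "bdd_below (H ` D)" using lb by (auto intro!: bdd_belowI2)
  have ne: "D \<noteq> {}" using z0 by (auto simp: D_def)
  define I where "I = (INF z\<in>D. H z)"
  have I_le: "I \<le> H z" if "z \<in> D" for z unfolding I_def by (rule cINF_lower[OF bdd that])
  have "\<exists>z\<in>D. H z < I + inverse (real (Suc k))" for k
    using cINF_less_iff[OF ne bdd, of "I + inverse (real (Suc k))"] by (auto simp: I_def)
  then obtain z where zD: "\<And>k. z k \<in> D" and zI: "\<And>k. H (z k) < I + inverse (real (Suc k))"
    by metis
  \<comment> \<open>At the midpoint, \<open>H\<close> lies at least |z k - z l|^2 / (8 t) below the
    average of the end values, yet not below the infimum \<open>I\<close>; so the excesses of the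
    two end values over \<open>I\<close> bound the distance.\<close>
  have close: "(norm (z k - z l))\<^sup>2 \<le> 4 * t * (inverse (real (Suc k)) + inverse (real (Suc l)))" for k l
  proof -
    let ?m = "(1 - 1/2) *\<^sub>R z k + (1/2) *\<^sub>R z l"
    have m: "f ?m = ereal (g ?m)" "g ?m \<le> (1 - 1/2) * g (z k) + (1/2) * g (z l)"
      using proper_convex_lsc_segment[OF f fg[OF zD[of k]] fg[OF zD[of l]], of "1/2"]
      unfolding g_def[symmetric] by simp_all
    have "?m \<in> V" using zD V(2) by (auto simp: D_def intro!: subspace_add subspace_scale)
    then have "?m \<in> D" using m(1) by (simp add: D_def)
    then have "I \<le> H ?m" by (rule I_le)
    also have "\<dots> \<le> (1/2) * H (z k) + (1/2) * H (z l) - (norm (z k - z l))\<^sup>2 / (8 * t)"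
    proof -
      have "(norm (?m - v))\<^sup>2 / (2 * t) = (1/2) * ((norm (z k - v))\<^sup>2 / (2 * t))
          + (1/2) * ((norm (z l - v))\<^sup>2 / (2 * t)) - (norm (z k - z l))\<^sup>2 / (8 * t)"
        using t unfolding quadratic_segment by (simp add: field_simps)
      moreover have "g' + c \<le> (1/2) * (a + A) + (1/2) * (b + B) - d"
        if "c = (1/2) * A + (1/2) * B - d" "g' \<le> (1 - 1/2) * a + (1/2) * b" for g' a A b B c d :: real
        using that by (simp add: field_simps)
      ultimately show ?thesis using m(2) unfolding H_def by blast
    qed
    finally have "I \<le> (1/2) * H (z k) + (1/2) * H (z l) - (norm (z k - z l))\<^sup>2 / (8 * t)" .
    moreover have "d \<le> (1/2) * (e + e')"
      if "I \<le> (1/2) * A + (1/2) * B - d" "A < I + e" "B < I + e'" for d e e' A B :: real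
      using that by simp
    ultimately have "(norm (z k - z l))\<^sup>2 / (8 * t) \<le> (1/2) * (inverse (real (Suc k)) + inverse (real (Suc l)))"
      using zI[of k] zI[of l] by blast
    moreover have "d \<le> 4 * t * e" if "d / (8 * t) \<le> (1/2) * e" for d e
      using that t by (simp add: field_simps)
    ultimately show ?thesis by blast
  qed
  have "Cauchy z"
  proof (rule metric_CauchyI)
    fix e :: real assume e: "0 < e"
    then have "0 < e\<^sup>2 / (8 * t)" using t by simp
    then obtain n where n: "inverse (real (Suc n)) < e\<^sup>2 / (8 * t)" using reals_Archimedean by blast
    show "\<exists>N. \<forall>k\<ge>N. \<forall>l\<ge>N. dist (z k) (z l) < e"
    proof (intro exI allI impI)
      fix k l assume "n \<le> k" "n \<le> l"
      then have "inverse (real (Suc k)) \<le> inverse (real (Suc n))" "inverse (real (Suc l)) \<le> inverse (real (Suc n))"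
        by (auto intro!: le_imp_inverse_le)
      then have "inverse (real (Suc k)) + inverse (real (Suc l)) < 2 * (e\<^sup>2 / (8 * t))" using n by linarith
      then have "4 * t * (inverse (real (Suc k)) + inverse (real (Suc l))) < 4 * t * (2 * (e\<^sup>2 / (8 * t)))"
        using t by (intro mult_strict_left_mono) auto
      also have "\<dots> = e\<^sup>2" using t by simp
      finally have "(norm (z k - z l))\<^sup>2 < e\<^sup>2" using close[of k l] by linarith
      then show "dist (z k) (z l) < e" using e by (simp add: dist_norm power_less_imp_less_base)
    qed
  qed
  then obtain zz where zz: "z \<longlonglongrightarrow> zz" using Cauchy_convergent convergent_def by blast
  have zzV: "zz \<in> V" using closed_sequentially[OF V(1) _ zz] zD by (auto simp: D_def)
  have lim: "(\<lambda>k. I + inverse (real (Suc k)) - (norm (z k - v))\<^sup>2 / (2 * t)) \<longlonglongrightarrow> I + 0 - (norm (zz - v))\<^sup>2 / (2 * t)"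
    using t zz by (intro tendsto_intros LIMSEQ_inverse_real_of_nat) auto
  \<comment> \<open>Semicontinuity matters for \<open>f\<close> only, as the squared distance
    converges along \<open>z\<close>: a real \<open>C\<close> strictly between the two sides would
    eventually stay below \<open>f (z k)\<close>, hence below the limit of the upper bounds.\<close>
  have key: "f zz \<le> ereal (I - (norm (zz - v))\<^sup>2 / (2 * t))"
  proof (rule ccontr)
    assume "\<not> ?thesis"
    then obtain C where C: "ereal (I - (norm (zz - v))\<^sup>2 / (2 * t)) < ereal C" "ereal C < f zz"
      using ereal_dense2[of "ereal (I - (norm (zz - v))\<^sup>2 / (2 * t))" "f zz"] by (auto simp: not_le)
    have "eventually (\<lambda>k. ereal C < f (z k)) sequentially"
      by (rule proper_convex_lsc_eventually[OF f C(2) zz])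
    then have "eventually (\<lambda>k. C \<le> I + inverse (real (Suc k)) - (norm (z k - v))\<^sup>2 / (2 * t)) sequentially"
    proof eventually_elim
      case (elim k)
      then show ?case using fg[OF zD[of k]] zI[of k] by (simp add: H_def)
    qed
    then have "C \<le> I + 0 - (norm (zz - v))\<^sup>2 / (2 * t)"
      using tendsto_lowerbound[OF lim] by auto
    then show False using C(1) by simp
  qed
  show ?thesis
  proof (rule that[OF zzV])
    fix z' assume z': "z' \<in> V"
    show "f zz + ereal ((norm (zz - v))\<^sup>2 / (2 * t)) \<le> f z' + ereal ((norm (z' - v))\<^sup>2 / (2 * t))"
    proof (cases "f z' = \<infinity>")
      case False
      then have "z' \<in> D" using z' by (simp add: D_def)
      then have "f z' + ereal ((norm (z' - v))\<^sup>2 / (2 * t)) = ereal (H z')" by (simp add: fg H_def)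
      moreover have "f zz + ereal ((norm (zz - v))\<^sup>2 / (2 * t)) \<le> ereal I"
        using add_right_mono[OF key, of "ereal ((norm (zz - v))\<^sup>2 / (2 * t))"] by simp
      ultimately show ?thesis using I_le[OF \<open>z' \<in> D\<close>] by (metis ereal_less_eq(3) order_trans)
    qed simp
  qed
qed

text \<open>Fermat's rule in variational form: compare \<open>z\<close> with the point (1 - s) z + s
  z' of the segment, divide by s and let s tend to 0.\<close>

lemma prox_minimiser_optimality:
  fixes f :: "'a::real_inner \<Rightarrow> ereal"
  assumes f: "proper_convex_lsc f" and V: "subspace V" and t: "0 < t" and zV: "z \<in> V"
    and z0: "z0 \<in> V" "f z0 \<noteq> \<infinity>"
    and min: "\<And>z'. z' \<in> V \<Longrightarrow> f z + ereal ((norm (z - v))\<^sup>2 / (2 * t)) \<le> f z' + ereal ((norm (z' - v))\<^sup>2 / (2 * t))"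
  shows "f z \<noteq> \<infinity>"
    and "\<And>z'. z' \<in> V \<Longrightarrow> f z + ereal (((1 / t) *\<^sub>R (v - z)) \<bullet> (z' - z)) \<le> f z'"
proof -
  show fin: "f z \<noteq> \<infinity>"
    using min[OF z0(1)] z0(2) by (cases "f z0") auto
  fix z' assume z': "z' \<in> V"
  show "f z + ereal (((1 / t) *\<^sub>R (v - z)) \<bullet> (z' - z)) \<le> f z'"
  proof (cases "f z' = \<infinity>")
    case False
    define a b where "a = real_of_ereal (f z)" and "b = real_of_ereal (f z')"
    have a: "f z = ereal a" using proper_convex_lsc_real[OF f fin] by (simp add: a_def)
    have b: "f z' = ereal b" using proper_convex_lsc_real[OF f False] by (simp add: b_def)
    have ineq: "a - b + (norm (z - v))\<^sup>2 / (2 * t) \<le> (norm (z' - v))\<^sup>2 / (2 * t) - (1 - s) * (norm (z - z'))\<^sup>2 / (2 * t)"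
      if s: "0 < s" "s < 1" for s
    proof -
      let ?w = "(1 - s) *\<^sub>R z + s *\<^sub>R z'"
      note w = proper_convex_lsc_segment[OF f a b s]
      have wV: "?w \<in> V" using zV z' V by (auto intro!: subspace_add subspace_scale)
      have "a + (norm (z - v))\<^sup>2 / (2 * t) \<le> real_of_ereal (f ?w) + (norm (?w - v))\<^sup>2 / (2 * t)"
        using min[OF wV] unfolding a by (subst (asm) w(1)) simp
      also have "\<dots> \<le> (1 - s) * a + s * b + ((1 - s) * (norm (z - v))\<^sup>2 + s * (norm (z' - v))\<^sup>2 - s * (1 - s) * (norm (z - z'))\<^sup>2) / (2 * t)"
        using w(2) unfolding quadratic_segment by simp
      finally have le: "a + (norm (z - v))\<^sup>2 / (2 * t) \<le> (1 - s) * a + s * b + ((1 - s) * (norm (z - v))\<^sup>2 + s * (norm (z' - v))\<^sup>2 - s * (1 - s) * (norm (z - z'))\<^sup>2) / (2 * t)" .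
      have "(1 - s) * a + s * b + ((1 - s) * (norm (z - v))\<^sup>2 + s * (norm (z' - v))\<^sup>2 - s * (1 - s) * (norm (z - z'))\<^sup>2) / (2 * t) - (a + (norm (z - v))\<^sup>2 / (2 * t))
        = s * (b - a + (- (norm (z - v))\<^sup>2 + (norm (z' - v))\<^sup>2 - (1 - s) * (norm (z - z'))\<^sup>2) / (2 * t))"
        using t by (simp add: field_simps)
      then have "0 \<le> s * (b - a + (- (norm (z - v))\<^sup>2 + (norm (z' - v))\<^sup>2 - (1 - s) * (norm (z - z'))\<^sup>2) / (2 * t))"
        using le by simp
      then have "0 \<le> b - a + (- (norm (z - v))\<^sup>2 + (norm (z' - v))\<^sup>2 - (1 - s) * (norm (z - z'))\<^sup>2) / (2 * t)"
        using s by (simp add: zero_le_mult_iff)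
      then show ?thesis by (simp add: diff_divide_distrib add_divide_distrib)
    qed
    have "((\<lambda>s. (norm (z' - v))\<^sup>2 / (2 * t) - (1 - s) * (norm (z - z'))\<^sup>2 / (2 * t)) \<longlongrightarrow>
        (norm (z' - v))\<^sup>2 / (2 * t) - (1 - 0) * (norm (z - z'))\<^sup>2 / (2 * t)) (at_right 0)"
      using t by (intro tendsto_intros) auto
    moreover have "eventually (\<lambda>s. a - b + (norm (z - v))\<^sup>2 / (2 * t)
        \<le> (norm (z' - v))\<^sup>2 / (2 * t) - (1 - s) * (norm (z - z'))\<^sup>2 / (2 * t)) (at_right (0::real))"
      using eventually_at_right_less[of 0] eventually_at_right_real[of 0 1] ineq
      by (auto elim!: eventually_mono)
    ultimately have lim: "a - b + (norm (z - v))\<^sup>2 / (2 * t) \<le> (norm (z' - v))\<^sup>2 / (2 * t) - (1 - 0) * (norm (z - z'))\<^sup>2 / (2 * t)"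
      by (intro tendsto_lowerbound) auto
    have "(norm (z' - v))\<^sup>2 - (norm (z - z'))\<^sup>2 - (norm (z - v))\<^sup>2 = - 2 * ((v - z) \<bullet> (z' - z))"
      unfolding power2_norm_eq_inner by (simp add: inner_simps inner_commute)
    then have "((norm (z' - v))\<^sup>2 - (norm (z - z'))\<^sup>2 - (norm (z - v))\<^sup>2) / (2 * t) = - ((v - z) \<bullet> (z' - z)) / t"
      using t by simp
    then have "(norm (z' - v))\<^sup>2 / (2 * t) - (1 - 0) * (norm (z - z'))\<^sup>2 / (2 * t) - (norm (z - v))\<^sup>2 / (2 * t)
      = - ((v - z) \<bullet> (z' - z)) / t"
      by (simp add: diff_divide_distrib)
    then have "a + ((v - z) \<bullet> (z' - z)) / t \<le> b" using lim by simp
    then show ?thesis by (simp add: a b)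
  qed simp
qed

text \<open>\<open>prox\<close> selects some minimiser, so existence is what gives the selection a
  meaning. The minorant comes from boundedness in the case of linear functionals, and from a
  subgradient at the critical point in the case of the algorithm.\<close>

lemma prox_subgradient:
  fixes f :: "'a::{real_inner, complete_space} \<Rightarrow> ereal"
  assumes f: "proper_convex_lsc f" and V: "closed V" "subspace V"
    and z0: "z0 \<in> V" "f z0 \<noteq> \<infinity>" and t: "0 < t"
    and minorant: "0 \<le> b" "\<And>z. z \<in> V \<Longrightarrow> ereal (a - b * norm z) \<le> f z"
  shows "prox V f t v \<in> V" "f (prox V f t v) \<noteq> \<infinity>"
    "\<And>z'. z' \<in> V \<Longrightarrow>
      f (prox V f t v) + ereal (((1 / t) *\<^sub>R (v - prox V f t v)) \<bullet> (z' - prox V f t v)) \<le> f z'"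
proof -
  let ?g = "\<lambda>z. f z + ereal ((norm (z - v))\<^sup>2 / (2 * t))"
  obtain z where "z \<in> V" "\<And>z'. z' \<in> V \<Longrightarrow> ?g z \<le> ?g z'"
    by (rule prox_minimiser_exists[OF f V z0 t minorant]) auto
  then have "is_arg_min ?g (\<lambda>x. x \<in> V) z" by (auto simp: is_arg_min_def not_less)
  then have "is_arg_min ?g (\<lambda>x. x \<in> V) (prox V f t v)"
    unfolding prox_def arg_min_on_def arg_min_def by (rule someI)
  then have p: "prox V f t v \<in> V" and p': "\<And>z'. z' \<in> V \<Longrightarrow> ?g (prox V f t v) \<le> ?g z'"
    by (auto simp: is_arg_min_def not_less)
  show "prox V f t v \<in> V" by fact
  show "f (prox V f t v) \<noteq> \<infinity>"
    "\<And>z'. z' \<in> V \<Longrightarrow>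
      f (prox V f t v) + ereal (((1 / t) *\<^sub>R (v - prox V f t v)) \<bullet> (z' - prox V f t v)) \<le> f z'"
    by (rule prox_minimiser_optimality[OF f V(2) t p z0 p']; assumption)+
qed

section \<open>Riesz representation, adjoints and orthogonal projections\<close>

lemma proper_convex_lsc_linear:
  fixes g :: "'a::real_inner \<Rightarrow>\<^sub>L real"
  shows "proper_convex_lsc (\<lambda>x. ereal (g x))"
  unfolding proper_convex_lsc_def
proof (intro conjI allI impI)
  fix x
  have "((\<lambda>x. ereal (g x)) \<longlongrightarrow> ereal (g x)) (at x)" by (intro tendsto_intros)
  then show "ereal (g x) \<le> Liminf (at x) (\<lambda>x. ereal (g x))"
    using lim_imp_Liminf[of "at x" "\<lambda>x. ereal (g x)" "ereal (g x)"] by (cases "at x = bot") simp_all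
qed (auto simp: blinfun.bilinear_simps)


text \<open>The minimiser \<open>q\<close> of |z|^2 / 2 - g z represents \<open>g\<close>:
  optimality gives \<open>g h \<le> q \<bullet> h\<close>, and the same for \<open>- h\<close> turns
  this into an equality.\<close>

lemma riesz_representation:
  fixes g :: "'a::{real_inner, complete_space} \<Rightarrow>\<^sub>L real"
  shows "\<exists>q. \<forall>x. g x = q \<bullet> x"
proof -
  have "ereal (0 - norm g * norm x) \<le> ereal ((- g) x)" for x
    using norm_blinfun[of g x] by (simp add: uminus_blinfun.rep_eq)
  note sub = prox_subgradient(3)[where v = 0, OF proper_convex_lsc_linear[of "- g"] closed_UNIV subspace_UNIV
      UNIV_I[of 0] _ zero_less_one norm_ge_zero[of g] this]
  define q where "q = prox UNIV (\<lambda>x. ereal ((- g) x)) 1 0"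
  have le: "g h \<le> q \<bullet> h" for h
    using sub[of "q + h", simplified] unfolding q_def[symmetric]
    by (simp add: uminus_blinfun.rep_eq blinfun.bilinear_simps)
  have "g h = q \<bullet> h" for h
    using le[of h] le[of "- h"] by (simp add: blinfun.bilinear_simps)
  then show ?thesis by blast
qed

text \<open>\<open>adjoint\<close> is a Hilbert choice; the Riesz vectors of the functionals
  obtained by fixing \<open>y\<close> form the function that shows the choice to be
  non-vacuous.\<close>

lemma adjoint_blinfun:
  fixes T :: "'a::{real_inner, complete_space} \<Rightarrow>\<^sub>L 'b::real_inner"
  shows "T x \<bullet> y = x \<bullet> adjoint T y"
proof -
  have "\<exists>q. \<forall>x. T x \<bullet> y = x \<bullet> q" for y
  proof -
    have "blinfun_apply (blinfun_inner_left y o\<^sub>L T) x = T x \<bullet> y" for x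
      by (simp add: inner_commute)
    then show ?thesis using riesz_representation[of "blinfun_inner_left y o\<^sub>L T"]
      by (auto simp: inner_commute)
  qed
  then have "\<exists>f'. \<forall>x y. T x \<bullet> y = x \<bullet> f' y" by metis
  then have "\<forall>x y. T x \<bullet> y = x \<bullet> adjoint T y" unfolding adjoint_def by (rule someI_ex)
  then show ?thesis by blast
qed

lemma closed_orthogonal_comp: "closed (W\<^sup>\<bottom>)"
proof -
  have "W\<^sup>\<bottom> = (\<Inter>y\<in>W. {x. y \<bullet> x = 0})" by (auto simp: orthogonal_comp_def orthogonal_def)
  then show ?thesis by (auto intro!: closed_INT closed_Collect_eq continuous_intros)
qed

text \<open>The proximal point of the zero function is the nearest point of \<open>V\<close>. On a
  subspace its variational inequality may be tested with \<open>h\<close> and \<open>- h\<close>,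
  hence is orthogonality; uniqueness is what the definite description asks for.\<close>

lemma orth_proj_onto_decomposition:
  fixes V :: "'a::{real_inner, complete_space} set"
  assumes V: "closed V" "subspace V"
  shows "orth_proj_onto V y \<in> V" "y - orth_proj_onto V y \<in> V\<^sup>\<bottom>"
proof -
  have zero: "proper_convex_lsc (\<lambda>_::'a. ereal 0)"
    using proper_convex_lsc_linear[of "0 :: 'a \<Rightarrow>\<^sub>L real"] by simp
  note sub = prox_subgradient[where v = y and a = 0, OF zero V subspace_0[OF V(2)] _ zero_less_one order.refl, simplified]
  define z where "z = prox V (\<lambda>_. 0) 1 y"
  have zV: "z \<in> V" using sub(1) by (simp add: z_def zero_ereal_def[symmetric])
  have "z + h \<in> V" if "h \<in> V" for h using that zV V(2) by (simp add: subspace_add)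
  then have le: "(y - z) \<bullet> h \<le> 0" if "h \<in> V" for h
    using sub(3)[of "z + h"] that by (simp add: z_def zero_ereal_def[symmetric])
  have orth: "(y - z) \<bullet> h = 0" if "h \<in> V" for h
    using le[of h] le[of "- h"] that subspace_neg[OF V(2)] by force
  have ex: "z \<in> V \<and> y - z \<in> V\<^sup>\<bottom>"
    using zV orth by (auto simp: orthogonal_comp_def orthogonal_def inner_commute)
  have "v = z" if v: "v \<in> V" "y - v \<in> V\<^sup>\<bottom>" for v
  proof -
    have d: "z - v \<in> V" using v zV V(2) by (simp add: subspace_diff)
    then have "(z - v) \<bullet> (y - v) = 0" using v(2) by (auto simp: orthogonal_comp_def orthogonal_def)
    then have "(z - v) \<bullet> (z - v) = 0" using orth[OF d] by (simp add: inner_simps inner_commute)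
    then show ?thesis by simp
  qed
  then have "\<exists>!v. v \<in> V \<and> y - v \<in> V\<^sup>\<bottom>" using ex by blast
  from theI'[OF this] show "orth_proj_onto V y \<in> V" "y - orth_proj_onto V y \<in> V\<^sup>\<bottom>"
    unfolding orth_proj_onto_def by blast+
qed

section \<open>Block decompositions and conjugates\<close>

lemma block_decompositionD:
  assumes "block_decomposition m P"
  shows "j \<in> {1..m} \<Longrightarrow> P j (P j u) = P j u"
    and "i \<in> {1..m} \<Longrightarrow> j \<in> {1..m} \<Longrightarrow> i \<noteq> j \<Longrightarrow> P i (P j u) = 0"
    and "j \<in> {1..m} \<Longrightarrow> P j u \<bullet> v = u \<bullet> P j v"
    and "(\<Sum>j=1..m. P j u) = u"
proof -
  show "P j (P j u) = P j u" if "j \<in> {1..m}"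
    using assms that unfolding block_decomposition_def orth_projector_def
    by (metis blinfun_apply_blinfun_compose)
  show "P i (P j u) = 0" if "i \<in> {1..m}" "j \<in> {1..m}" "i \<noteq> j"
    using assms that unfolding block_decomposition_def
    by (metis blinfun_apply_blinfun_compose zero_blinfun.rep_eq)
  show "P j u \<bullet> v = u \<bullet> P j v" if "j \<in> {1..m}"
    using assms that unfolding block_decomposition_def orth_projector_def by blast
  have "(\<Sum>j=1..m. P j) = id_blinfun" using assms unfolding block_decomposition_def by blast
  then have "blinfun_apply (\<Sum>j=1..m. P j) u = u" by simp
  then show "(\<Sum>j=1..m. P j u) = u" by (simp add: blinfun.sum_left)
qed

lemma block_apply_sum:
  assumes P: "block_decomposition m P" and J: "J \<subseteq> {1..m}" and k: "k \<in> {1..m}"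
  shows "P k (\<Sum>j\<in>J. a j *\<^sub>R P j (v j)) = (if k \<in> J then a k *\<^sub>R P k (v k) else 0)"
proof -
  have "P k (\<Sum>j\<in>J. a j *\<^sub>R P j (v j)) = (\<Sum>j\<in>J. if j = k then a k *\<^sub>R P k (v k) else 0)"
    unfolding blinfun.sum_right
    by (rule sum.cong) (use J k block_decompositionD(1,2)[OF P] in \<open>auto simp: blinfun.scaleR_right\<close>)
  then show ?thesis using finite_subset[OF J] by simp
qed

lemma block_inner:
  assumes P: "block_decomposition m P"
  shows "u \<bullet> v = (\<Sum>j=1..m. P j u \<bullet> P j v)"
proof -
  have "u \<bullet> v = (\<Sum>j=1..m. P j u \<bullet> v)"
    using block_decompositionD(4)[OF P, of u] by (simp flip: inner_sum_left)
  also have "\<dots> = (\<Sum>j=1..m. P j u \<bullet> P j v)"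
    by (rule sum.cong) (simp_all add: block_decompositionD(3)[OF P, symmetric] block_decompositionD(1)[OF P])
  finally show ?thesis .
qed

lemma block_norm:
  assumes "block_decomposition m P"
  shows "(norm u)\<^sup>2 = (\<Sum>j=1..m. (norm (P j u))\<^sup>2)"
  unfolding power2_norm_eq_inner by (rule block_inner[OF assms])

lemma block_inner_block:
  assumes P: "block_decomposition m P" and j: "j \<in> {1..m}"
  shows "P j u \<bullet> P j v = P j u \<bullet> v"
  using block_decompositionD(1,3)[OF P j] by metis

lemma block_eqI:
  assumes P: "block_decomposition m P" and "\<And>j. j \<in> {1..m} \<Longrightarrow> P j u = P j v"
  shows "u = v"
proof -
  have "(\<Sum>j=1..m. P j u) = (\<Sum>j=1..m. P j v)" by (rule sum.cong) (use assms in auto)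
  then show ?thesis using block_decompositionD(4)[OF P] by simp
qed

lemma block_norm_sum:
  assumes P: "block_decomposition m P" and J: "J \<subseteq> {1..m}"
  shows "(norm (\<Sum>j\<in>J. a j *\<^sub>R P j (v j)))\<^sup>2 = (\<Sum>j\<in>J. (a j)\<^sup>2 * (norm (P j (v j)))\<^sup>2)"
proof -
  have "(norm (\<Sum>j\<in>J. a j *\<^sub>R P j (v j)))\<^sup>2 = (\<Sum>k=1..m. if k \<in> J then (norm (a k *\<^sub>R P k (v k)))\<^sup>2 else 0)"
    unfolding block_norm[OF P, of "\<Sum>j\<in>J. a j *\<^sub>R P j (v j)"]
    by (rule sum.cong) (simp_all add: block_apply_sum[OF P J])
  also have "\<dots> = (\<Sum>k\<in>J. (norm (a k *\<^sub>R P k (v k)))\<^sup>2)"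
    using J by (simp add: sum.inter_restrict[symmetric] Int_absorb1)
  finally show ?thesis by (simp add: power_mult_distrib)
qed

lemma subspace_range_blinfun: "subspace (range (blinfun_apply T))"
  using subspace_UNIV by (rule linear_subspace_image[OF blinfun.bounded_linear_right[THEN bounded_linear.linear]])

lemma range_block:
  assumes P: "block_decomposition m P" and j: "j \<in> {1..m}"
  shows "range (P j) = {u. P j u = u}"
  using block_decompositionD(1)[OF P j] by (auto, metis rangeI)

lemma closed_range_block:
  assumes "block_decomposition m P" "j \<in> {1..m}"
  shows "closed (range (P j))"
  unfolding range_block[OF assms] by (intro closed_Collect_eq continuous_intros)

text \<open>A conjugate is a supremum of continuous affine functions of \<open>y\<close>, so
  convexity and lower semicontinuity are inherited term by term. Finiteness at one point has to be
  given; the critical point will provide it.\<close>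

lemma fenchel_conj_proper_convex_lsc:
  assumes F: "proper_convex_lsc F" and fin: "fenchel_conj F y0 \<noteq> \<infinity>"
  shows "proper_convex_lsc (fenchel_conj F)"
proof -
  obtain x0 where "F x0 \<noteq> \<infinity>" using F unfolding proper_convex_lsc_def by blast
  then obtain a0 where a0: "F x0 = ereal a0" using proper_convex_lsc_real[OF F] by blast
  have lower: "ereal (y \<bullet> x - a) \<le> fenchel_conj F y" if "F x = ereal a" for x y a
    unfolding fenchel_conj_def by (rule SUP_upper2[of x]) (simp_all add: that)
  have leI: "fenchel_conj F y \<le> C" if "\<And>x a. F x = ereal a \<Longrightarrow> ereal (y \<bullet> x - a) \<le> C" for y C
    unfolding fenchel_conj_def
  proof (rule SUP_least)
    fix x show "ereal (y \<bullet> x) - F x \<le> C"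
      using that[of x] proper_convex_lscD(1)[OF F, of x] by (cases "F x") auto
  qed
  show ?thesis unfolding proper_convex_lsc_def
  proof (intro conjI allI impI)
    show "\<exists>y. fenchel_conj F y \<noteq> \<infinity>" using fin by blast
    fix y y' show "fenchel_conj F y \<noteq> -\<infinity>" using lower[OF a0, of y] by auto
    show "fenchel_conj F ((1 - t) *\<^sub>R y + t *\<^sub>R y') \<le> ereal (1 - t) * fenchel_conj F y + ereal t * fenchel_conj F y'"
      if t: "0 < t \<and> t < 1" for t
    proof (rule leI)
      fix x a assume a: "F x = ereal a"
      have "ereal (((1 - t) *\<^sub>R y + t *\<^sub>R y') \<bullet> x - a) = ereal (1 - t) * ereal (y \<bullet> x - a) + ereal t * ereal (y' \<bullet> x - a)"
        by (simp add: inner_simps algebra_simps)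
      also have "\<dots> \<le> ereal (1 - t) * fenchel_conj F y + ereal t * fenchel_conj F y'"
        using t by (intro add_mono ereal_mult_left_mono lower[OF a]) auto
      finally show "ereal (((1 - t) *\<^sub>R y + t *\<^sub>R y') \<bullet> x - a) \<le> \<dots>" .
    qed
    show "fenchel_conj F y \<le> Liminf (at y) (fenchel_conj F)"
    proof (rule leI)
      fix x a assume a: "F x = ereal a"
      have "((\<lambda>y. ereal (y \<bullet> x - a)) \<longlongrightarrow> ereal (y \<bullet> x - a)) (at y)" by (intro tendsto_intros)
      then have "ereal (y \<bullet> x - a) \<le> Liminf (at y) (\<lambda>y. ereal (y \<bullet> x - a))"
        using lim_imp_Liminf[of "at y" "\<lambda>y. ereal (y \<bullet> x - a)" "ereal (y \<bullet> x - a)"]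
        by (cases "at y = bot") simp_all
      also have "\<dots> \<le> Liminf (at y) (fenchel_conj F)"
        by (rule Liminf_mono) (simp add: lower[OF a])
      finally show "ereal (y \<bullet> x - a) \<le> Liminf (at y) (fenchel_conj F)" .
    qed
  qed
qed

text \<open>Available before any finite value is known: a value -\<infinity> would itself be a point
  where the conjugate differs from \<infinity>, and then the preceding lemma excludes it.\<close>

lemma fenchel_conj_not_MInf:
  assumes F: "proper_convex_lsc F"
  shows "fenchel_conj F y \<noteq> -\<infinity>"
  using fenchel_conj_proper_convex_lsc[OF F, of y] proper_convex_lscD(1) by force

section \<open>Subdifferentials of block sums and proximal steps in one block\<close>

definition block_subgradient :: "('a::real_inner \<Rightarrow>\<^sub>L 'a) \<Rightarrow> ('a \<Rightarrow> ereal) \<Rightarrow> 'a \<Rightarrow> 'a \<Rightarrow> bool" where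
  "block_subgradient P g q u \<longleftrightarrow>
     g (P u) \<noteq> \<infinity> \<and> (\<forall>z\<in>range P. g (P u) + ereal (P q \<bullet> (z - P u)) \<le> g z)"

lemma ereal_sum_real:
  assumes "\<And>k. k \<in> I \<Longrightarrow> \<bar>f k\<bar> \<noteq> (\<infinity>::ereal)"
  shows "sum f I = ereal (\<Sum>k\<in>I. real_of_ereal (f k))"
  using assms by (subst sum_ereal[symmetric]) (auto intro!: sum.cong simp: ereal_real)

text \<open>Separability: changing one block of \<open>u\<close> isolates one function, because the
  other summands are finite and cancel; conversely the block inequalities add up. The test points of
  a block range over \<open>range (P j)\<close> only, the set on which the proximal map
  minimises.\<close>

lemma subdiff_block_sum_iff:
  assumes P: "block_decomposition m P"
    and g: "\<And>j z. j \<in> {1..m} \<Longrightarrow> g j z \<noteq> -\<infinity>"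
  shows "q \<in> subdiff (block_sum m P g) u \<longleftrightarrow> (\<forall>j\<in>{1..m}. block_subgradient (P j) (g j) q u)"
proof
  assume q: "q \<in> subdiff (block_sum m P g) u"
  have fin: "\<bar>g j (P j u)\<bar> \<noteq> \<infinity>" if "j \<in> {1..m}" for j
  proof -
    have "block_sum m P g u \<noteq> \<infinity>" using q unfolding subdiff_def by auto
    then show ?thesis unfolding block_sum_def sum_Pinfty using that g[OF that, of "P j u"] by auto
  qed
  show "\<forall>j\<in>{1..m}. block_subgradient (P j) (g j) q u"
  proof
    fix j assume j: "j \<in> {1..m}"
    show "block_subgradient (P j) (g j) q u" unfolding block_subgradient_def
    proof (intro conjI ballI)
      show "g j (P j u) \<noteq> \<infinity>" using fin[OF j] by auto
      fix z assume "z \<in> range (P j)"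
      then have z: "P j z = z" by (simp add: range_block[OF P j])
      let ?u' = "u + (z - P j u)"
      define R where "R = (\<Sum>k\<in>{1..m}-{j}. real_of_ereal (g k (P k u)))"
      have others: "P k ?u' = P k u" if "k \<in> {1..m} - {j}" for k
      proof -
        have "P k z = 0" using block_decompositionD(2)[OF P, of k j z] that j z by simp
        moreover have "P k (P j u) = 0" using block_decompositionD(2)[OF P, of k j u] that j by simp
        ultimately show ?thesis by (simp add: blinfun.bilinear_simps)
      qed
      have own: "P j ?u' = z" by (simp add: blinfun.bilinear_simps z block_decompositionD(1)[OF P j])
      have rest: "(\<Sum>k\<in>{1..m}-{j}. g k (P k u)) = ereal R"
        unfolding R_def by (rule ereal_sum_real) (use fin in auto)
      have "(\<Sum>k\<in>{1..m}-{j}. g k (P k ?u')) = ereal R"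
        using rest others by simp
      then have "block_sum m P g ?u' = g j z + ereal R"
        using sum.remove[of "{1..m}" j "\<lambda>k. g k (P k ?u')"] j own unfolding block_sum_def by simp
      moreover have "block_sum m P g u = g j (P j u) + ereal R"
        using sum.remove[of "{1..m}" j "\<lambda>k. g k (P k u)"] j rest unfolding block_sum_def by simp
      moreover have "block_sum m P g u + ereal (q \<bullet> (?u' - u)) \<le> block_sum m P g ?u'"
        using q unfolding subdiff_def by blast
      ultimately have le: "g j (P j u) + ereal R + ereal (q \<bullet> (z - P j u)) \<le> g j z + ereal R" by simp
      have "q \<bullet> (z - P j u) = P j q \<bullet> (z - P j u)"
        using block_decompositionD(3)[OF P j, of q "z - P j u"] block_decompositionD(1)[OF P j] z
        by (simp add: blinfun.bilinear_simps)
      then show "g j (P j u) + ereal (P j q \<bullet> (z - P j u)) \<le> g j z"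
        using le fin[OF j] g[OF j, of z] by (cases "g j (P j u)"; cases "g j z") auto
    qed
  qed
next
  assume q: "\<forall>j\<in>{1..m}. block_subgradient (P j) (g j) q u"
  have fin: "\<bar>g j (P j u)\<bar> \<noteq> \<infinity>" if "j \<in> {1..m}" for j
    using q that g[OF that, of "P j u"] unfolding block_subgradient_def by auto
  show "q \<in> subdiff (block_sum m P g) u" unfolding subdiff_def
  proof (intro CollectI conjI allI)
    show "\<bar>block_sum m P g u\<bar> \<noteq> \<infinity>"
      unfolding block_sum_def by (subst ereal_sum_real) (use fin in auto)
    fix u'
    have "block_sum m P g u + ereal (q \<bullet> (u' - u)) = (\<Sum>j=1..m. g j (P j u) + ereal (P j q \<bullet> (P j u' - P j u)))"
      unfolding block_sum_def block_inner[OF P, of q] sum.distrib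
      by (simp add: blinfun.bilinear_simps)
    also have "\<dots> \<le> (\<Sum>j=1..m. g j (P j u'))"
      by (rule sum_mono) (use q in \<open>auto simp: block_subgradient_def\<close>)
    finally show "block_sum m P g u + ereal (q \<bullet> (u' - u)) \<le> block_sum m P g u'"
      by (simp add: block_sum_def)
  qed
qed

lemma prox_block_subgradient:
  fixes g :: "'a::{real_inner, complete_space} \<Rightarrow> ereal"
  assumes P: "block_decomposition m P" and j: "j \<in> {1..m}" and g: "proper_convex_lsc g"
    and sub: "block_subgradient (P j) g q u" and t: "0 < t"
    and step: "P j u' = prox (range (P j)) g t (P j v)"
  shows "block_subgradient (P j) g ((1 / t) *\<^sub>R (v - u')) u'"
proof -
  note range = closed_range_block[OF P j] subspace_range_blinfun[of "P j"]
  have fin: "g (P j u) \<noteq> \<infinity>" using sub unfolding block_subgradient_def by blast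
  obtain b where b: "g (P j u) = ereal b" using proper_convex_lsc_real[OF g fin] by blast
  \<comment> \<open>The subgradient at the reference point \<open>u\<close> provides an affine
    minorant; Cauchy-Schwarz brings it into the form required for the existence of the proximal
    point.\<close>
  have minorant: "ereal ((b - P j q \<bullet> P j u) - norm (P j q) * norm z) \<le> g z" if "z \<in> range (P j)" for z
  proof -
    have "- (norm (P j q) * norm z) \<le> P j q \<bullet> z"
      using Cauchy_Schwarz_ineq2[of "P j q" z] by linarith
    then have "ereal ((b - P j q \<bullet> P j u) - norm (P j q) * norm z) \<le> g (P j u) + ereal (P j q \<bullet> (z - P j u))"
      by (simp add: b inner_diff_right)
    also have "\<dots> \<le> g z" using sub that unfolding block_subgradient_def by blast
    finally show ?thesis .
  qed
  note prox = prox_subgradient[where v = "P j v", OF g range rangeI fin t norm_ge_zero minorant, folded step]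
  have "P j ((1 / t) *\<^sub>R (v - u')) = (1 / t) *\<^sub>R (P j v - P j u')"
    by (simp add: blinfun.bilinear_simps)
  then show ?thesis unfolding block_subgradient_def using prox(2,3) by simp
qed

section \<open>Scalar and operator estimates\<close>

lemma weight_pair_bound:
  fixes a b :: "'a::real_inner" and w w' :: real
  assumes "0 < w" "w = 1 / w'"
  shows "a \<bullet> b \<le> (w * (norm a)\<^sup>2 + w' * (norm b)\<^sup>2) / 2"
proof -
  have w': "w * w' = 1" "0 < w'" using assms by (auto simp: zero_less_divide_iff)
  have "0 \<le> w' * (norm (w *\<^sub>R a - b))\<^sup>2" using w' by simp
  also have "\<dots> = w' * w * w * (norm a)\<^sup>2 - 2 * (w * w') * (a \<bullet> b) + w' * (norm b)\<^sup>2"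
    unfolding power2_norm_eq_inner by (simp add: inner_simps inner_commute algebra_simps power2_eq_square)
  finally show ?thesis using w' by (simp add: mult.commute)
qed

text \<open>Expanding the square leaves only pairs related by \<open>E\<close>. Young's inequality
  with reciprocal weights charges each mixed product with \<open>w l k\<close> to \<open>l\<close>
  and with \<open>w k l\<close> to \<open>k\<close>. Symmetry of \<open>E\<close> ensures that both
  charges are counted, and exchanging the order of summation shows that their totals agree.\<close>

lemma weighted_norm_sum_bound:
  fixes g :: "nat \<Rightarrow> 'a::real_inner"
  assumes I: "finite I" and sym: "\<And>l k. l \<in> I \<Longrightarrow> k \<in> I \<Longrightarrow> E l k \<Longrightarrow> E k l"
    and orth: "\<And>l k. l \<in> I \<Longrightarrow> k \<in> I \<Longrightarrow> \<not> E l k \<Longrightarrow> g l \<bullet> g k = 0"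
    and w: "\<And>l k. l \<in> I \<Longrightarrow> k \<in> I \<Longrightarrow> 0 < w l k \<and> w l k = 1 / w k l"
  shows "(norm (\<Sum>l\<in>I. g l))\<^sup>2 \<le> (\<Sum>l\<in>I. (\<Sum>k\<in>{k\<in>I. E l k}. w l k) * (norm (g l))\<^sup>2)"
proof -
  define f where "f l k = (if E l k then w l k * (norm (g l))\<^sup>2 else 0)" for l k
  have "(norm (\<Sum>l\<in>I. g l))\<^sup>2 = (\<Sum>l\<in>I. \<Sum>k\<in>I. g l \<bullet> g k)"
    unfolding power2_norm_eq_inner by (simp add: inner_sum_left inner_sum_right inner_commute)
  also have "\<dots> \<le> (\<Sum>l\<in>I. \<Sum>k\<in>I. (f l k + f k l) / 2)"
  proof (intro sum_mono)
    fix l k assume lk: "l \<in> I" "k \<in> I"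
    show "g l \<bullet> g k \<le> (f l k + f k l) / 2"
    proof (cases "E l k")
      case True
      then show ?thesis using sym[OF lk True] weight_pair_bound[OF conjunct1[OF w[OF lk]] conjunct2[OF w[OF lk]], of "g l" "g k"]
        by (simp add: f_def)
    next
      case False
      then show ?thesis using sym[of k l] orth[OF lk False] lk by (auto simp: f_def)
    qed
  qed
  also have "\<dots> = (\<Sum>l\<in>I. \<Sum>k\<in>I. f l k)"
    using sum.swap[of "\<lambda>l k. f k l" I I] by (simp add: sum.distrib add_divide_distrib sum_divide_distrib[symmetric])
  also have "\<dots> = (\<Sum>l\<in>I. (\<Sum>k\<in>{k\<in>I. E l k}. w l k) * (norm (g l))\<^sup>2)"
    using I by (intro sum.cong) (auto simp: f_def sum_distrib_right sum.inter_filter intro!: sum.cong)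
  finally show ?thesis .
qed

section \<open>Norm condition and the coupling of primal and dual blocks\<close>

lemma block_weight_nonneg:
  assumes "\<And>k. k \<in> {1..n} \<Longrightarrow> 0 < w j l k"
  shows "0 \<le> block_weight n P Q w T S j l"
  unfolding block_weight_def by (auto intro!: sum_nonneg less_imp_le[OF assms] simp: conn_set_def)

text \<open>The weights split the coupling of the dual blocks, so that the norm bounds for the
  individual dual blocks control the whole operator.\<close>

lemma dual_coupling_bound:
  fixes T :: "'x::{real_inner, complete_space} \<Rightarrow>\<^sub>L 'y::{real_inner, complete_space}"
  assumes P: "block_decomposition m P" and Q: "block_decomposition n Q"
    and S: "S \<subseteq> {1..m}"
    and w: "\<And>j l k. j \<in> {1..m} \<Longrightarrow> l \<in> {1..n} \<Longrightarrow> k \<in> {1..n} \<Longrightarrow> 0 < w j l k \<and> w j l k = 1 / w j k l"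
    and pr: "\<And>j. j \<in> {1..m} \<Longrightarrow> 0 < pr j"
    and \<tau>: "\<And>j. j \<in> {1..m} \<Longrightarrow> 0 < \<tau> j" and \<sigma>: "\<And>l. l \<in> {1..n} \<Longrightarrow> 0 < \<sigma> l"
    and bound: "\<And>l. l \<in> {1..n} \<Longrightarrow>
      (norm (\<Sum>j\<in>S. sqrt (block_weight n P Q w T S j l * \<sigma> l * \<tau> j / pr j) *\<^sub>R (Q l o\<^sub>L T o\<^sub>L P j)))\<^sup>2 \<le> C"
  shows "(\<Sum>j\<in>S. \<tau> j / pr j * (norm (P j (adjoint T v)))\<^sup>2) \<le> C * (\<Sum>l=1..n. (norm (Q l v))\<^sup>2 / \<sigma> l)"
proof -
  define g where "g j l = P j (adjoint T (Q l v))" for j l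
  define W where "W j l = block_weight n P Q w T S j l" for j l
  have adj: "T u \<bullet> z = u \<bullet> adjoint T z" for u z by (rule adjoint_blinfun)
  have adj_sum: "P j (adjoint T v) = (\<Sum>l=1..n. g j l)" if "j \<in> {1..m}" for j
  proof -
    have "P j (adjoint T v) \<bullet> u = (\<Sum>l=1..n. g j l) \<bullet> u" for u
    proof -
      have "P j (adjoint T v) \<bullet> u = v \<bullet> T (P j u)"
        using block_decompositionD(3)[OF P that] by (metis adj inner_commute)
      also have "\<dots> = (\<Sum>l=1..n. Q l v) \<bullet> T (P j u)" by (simp only: block_decompositionD(4)[OF Q])
      also have "\<dots> = (\<Sum>l=1..n. g j l \<bullet> u)" unfolding inner_sum_left g_def
        using block_decompositionD(3)[OF P that] by (intro sum.cong refl) (metis adj inner_commute)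
      finally show ?thesis by (simp add: inner_sum_left)
    qed
    then show ?thesis using inner_eq_zero_iff[of "P j (adjoint T v) - (\<Sum>l=1..n. g j l)"]
      by (simp add: inner_diff_left)
  qed
  have W0: "0 \<le> W j l" if "j \<in> {1..m}" "l \<in> {1..n}" for j l
    unfolding W_def by (rule block_weight_nonneg) (use w that in blast)
  have Q_g: "g j l \<bullet> u = Q l v \<bullet> (Q l o\<^sub>L T o\<^sub>L P j) u" if "j \<in> {1..m}" "l \<in> {1..n}" for j l u
  proof -
    have "g j l \<bullet> u = Q l v \<bullet> T (P j u)"
      unfolding g_def using block_decompositionD(3)[OF P that(1)] by (metis adj inner_commute)
    also have "\<dots> = Q l v \<bullet> Q l (T (P j u))"
      using block_inner_block[OF Q that(2)] by simp
    finally show ?thesis by simp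
  qed
  have split: "(norm (P j (adjoint T v)))\<^sup>2 \<le> (\<Sum>l=1..n. W j l * (norm (g j l))\<^sup>2)" if jS: "j \<in> S" for j
  proof -
    have j: "j \<in> {1..m}" using jS S by blast
    \<comment> \<open>\<open>E l k\<close> says that the dual blocks \<open>l\<close> and
      \<open>k\<close> interact through the primal block \<open>j\<close>. Rewritten below as
      non-orthogonality of vectors from two ranges, the relation is visibly symmetric.\<close>
    define E where "E l k \<longleftrightarrow> (\<exists>z. Q l (T (P j (adjoint T (Q k z)))) \<noteq> 0)" for l k
    have E_iff: "E l k \<longleftrightarrow> (\<exists>z z'. P j (adjoint T (Q k z)) \<bullet> P j (adjoint T (Q l z')) \<noteq> 0)"
      if l: "l \<in> {1..n}" for l k
    proof -
      have "P j (adjoint T (Q k z)) \<bullet> P j (adjoint T (Q l z')) = Q l (T (P j (adjoint T (Q k z)))) \<bullet> z'" for z z'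
        using block_decompositionD(3)[OF Q l] block_inner_block[OF P j] by (metis adj)
      then show ?thesis unfolding E_def by (metis inner_eq_zero_iff inner_zero_left)
    qed
    have W_eq: "W j l * (norm (g j l))\<^sup>2 = (\<Sum>k\<in>{k\<in>{1..n}. E l k}. w j l k) * (norm (g j l))\<^sup>2"
      if l: "l \<in> {1..n}" for l
    \<comment> \<open>The weight is set to zero when \<open>Q l\<close> does not see block
      \<open>j\<close>; then \<open>g j l\<close> vanishes as well, so nothing is lost.\<close>
    proof (cases "Q l o\<^sub>L T o\<^sub>L P j = 0")
      case True
      then have "g j l \<bullet> g j l = 0" by (simp add: Q_g[OF j l])
      then show ?thesis by simp
    next
      case False
      then show ?thesis using jS by (simp add: W_def block_weight_def conn_set_def E_def)
    qed
    have "(norm (\<Sum>l=1..n. g j l))\<^sup>2 \<le> (\<Sum>l\<in>{1..n}. (\<Sum>k\<in>{k\<in>{1..n}. E l k}. w j l k) * (norm (g j l))\<^sup>2)"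
    proof (rule weighted_norm_sum_bound)
      fix l k assume lk: "l \<in> {1..n}" "k \<in> {1..n}"
      show "E l k \<Longrightarrow> E k l" using E_iff lk by (metis inner_commute)
      show "\<not> E l k \<Longrightarrow> g j l \<bullet> g j k = 0" using E_iff[OF lk(1)] unfolding g_def by (metis inner_commute)
      show "0 < w j l k \<and> w j l k = 1 / w j k l" using w[OF j lk] .
    qed simp
    also have "\<dots> = (\<Sum>l=1..n. W j l * (norm (g j l))\<^sup>2)" by (rule sum.cong[OF refl W_eq[symmetric]])
    finally show ?thesis unfolding adj_sum[OF j] .
  qed
  have block: "(\<Sum>j\<in>S. W j l * \<tau> j / pr j * (norm (g j l))\<^sup>2) \<le> C * ((norm (Q l v))\<^sup>2 / \<sigma> l)"
    if l: "l \<in> {1..n}" for l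
  proof -
    define a where "a j = sqrt (W j l * \<sigma> l * \<tau> j / pr j)" for j
    have a2: "(a j)\<^sup>2 = W j l * \<sigma> l * \<tau> j / pr j" if "j \<in> S" for j
      unfolding a_def using that S W0[of j l] l pr[of j] \<tau>[of j] \<sigma>[OF l] by (subst real_sqrt_pow2) auto
    define R where "R = (\<Sum>j\<in>S. a j *\<^sub>R (Q l o\<^sub>L T o\<^sub>L P j))"
    \<comment> \<open>\<open>u\<close> is the adjoint of \<open>R\<close> applied to
      \<open>Q l v\<close>. Testing it with itself bounds its norm by
      \<open>norm R * norm (Q l v)\<close>, and \<open>norm R\<close> is the quantity that the
      hypothesis controls.\<close>
    define u where "u = (\<Sum>j\<in>S. a j *\<^sub>R g j l)"
    have u2: "(norm u)\<^sup>2 = (\<Sum>j\<in>S. (a j)\<^sup>2 * (norm (g j l))\<^sup>2)"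
      using block_norm_sum[OF P S, of a "\<lambda>_. adjoint T (Q l v)"] by (simp add: u_def g_def)
    have "(norm u)\<^sup>2 = Q l v \<bullet> R u"
    proof -
      have "(norm u)\<^sup>2 = (\<Sum>j\<in>S. a j * (g j l \<bullet> u))"
        unfolding power2_norm_eq_inner by (subst (1) u_def) (simp add: inner_sum_left)
      also have "\<dots> = (\<Sum>j\<in>S. a j * (Q l v \<bullet> (Q l o\<^sub>L T o\<^sub>L P j) u))"
        by (rule sum.cong) (use Q_g l S in auto)
      also have "\<dots> = Q l v \<bullet> R u"
        unfolding R_def by (simp add: blinfun.sum_left inner_sum_right blinfun.scaleR_left)
      finally show ?thesis .
    qed
    also have "\<dots> \<le> norm (Q l v) * (norm R * norm u)"
      by (meson Cauchy_Schwarz_ineq2 abs_ge_self mult_left_mono norm_blinfun norm_ge_zero order_trans)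
    finally have "norm u * norm u \<le> (norm (Q l v) * norm R) * norm u" by (simp add: power2_eq_square mult.assoc)
    then have "norm u \<le> norm (Q l v) * norm R" by (cases "u = 0") auto
    then have "(norm u)\<^sup>2 \<le> (norm R)\<^sup>2 * (norm (Q l v))\<^sup>2"
      using power_mono[of "norm u" "norm (Q l v) * norm R" 2] by (simp add: power_mult_distrib mult.commute)
    also have "\<dots> \<le> C * (norm (Q l v))\<^sup>2"
      using bound[OF l] unfolding R_def a_def W_def by (intro mult_right_mono) auto
    finally have "(\<Sum>j\<in>S. (a j)\<^sup>2 * (norm (g j l))\<^sup>2) / \<sigma> l \<le> C * (norm (Q l v))\<^sup>2 / \<sigma> l"
      unfolding u2 using \<sigma>[OF l] by (simp add: divide_right_mono)
    moreover have "(\<Sum>j\<in>S. (a j)\<^sup>2 * (norm (g j l))\<^sup>2) / \<sigma> l = (\<Sum>j\<in>S. W j l * \<tau> j / pr j * (norm (g j l))\<^sup>2)"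
      unfolding sum_divide_distrib by (rule sum.cong) (use a2 \<sigma>[OF l] in auto)
    ultimately show ?thesis by simp
  qed
  have "(\<Sum>j\<in>S. \<tau> j / pr j * (norm (P j (adjoint T v)))\<^sup>2) \<le> (\<Sum>j\<in>S. \<tau> j / pr j * (\<Sum>l=1..n. W j l * (norm (g j l))\<^sup>2))"
    using split S pr \<tau> by (intro sum_mono mult_left_mono) (auto intro!: divide_nonneg_pos less_imp_le simp: subset_eq)
  also have "\<dots> = (\<Sum>j\<in>S. \<Sum>l=1..n. W j l * \<tau> j / pr j * (norm (g j l))\<^sup>2)"
    unfolding sum_distrib_left by (intro sum.cong refl) simp
  also have "\<dots> = (\<Sum>l=1..n. \<Sum>j\<in>S. W j l * \<tau> j / pr j * (norm (g j l))\<^sup>2)"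
    by (rule sum.swap)
  also have "\<dots> \<le> (\<Sum>l=1..n. C * ((norm (Q l v))\<^sup>2 / \<sigma> l))"
    by (intro sum_mono block)
  finally show ?thesis by (simp add: sum_distrib_left)
qed

lemma scaled_Cauchy_Schwarz:
  fixes a b :: "'a::real_inner"
  assumes "0 < r"
  shows "a \<bullet> b \<le> r * (norm a)\<^sup>2 / 2 + (norm b)\<^sup>2 / (2 * r)"
  using weight_pair_bound[of r "1 / r" a b] assms by (simp add: add_divide_distrib)

text \<open>Applied twice: with \<open>s = 1 - \<delta>\<close> to the increments of one step, and
  with \<open>s = sqrt (1 - \<kappa>)\<close> to the distance from the critical point. The norm
  condition concerns the initial step lengths; later ones are no larger, so it carries over to
  them.\<close>

lemma coupling_bound:
  fixes T :: "'x::{real_inner, complete_space} \<Rightarrow>\<^sub>L 'y::{real_inner, complete_space}"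
  assumes P: "block_decomposition m P" and S: "S \<subseteq> {1..m}" and s: "0 < s" and C: "0 \<le> C"
    and pr: "\<And>j. j \<in> {1..m} \<Longrightarrow> 0 < pr j"
    and \<tau>: "\<And>j. j \<in> {1..m} \<Longrightarrow> 0 < \<tau> j \<and> \<tau> j \<le> \<tau>0 j"
    and \<sigma>: "\<And>l. l \<in> {1..n} \<Longrightarrow> 0 < \<sigma> l \<and> \<sigma> l \<le> \<sigma>0 l"
    and bound: "(\<Sum>j\<in>S. \<tau>0 j / pr j * (norm (P j (adjoint T v)))\<^sup>2) \<le> C * (\<Sum>l=1..n. (norm (Q l v))\<^sup>2 / \<sigma>0 l)"
  shows "(\<Sum>j\<in>S. 1 / pr j * (T (P j u) \<bullet> v))
    \<le> s / 2 * (\<Sum>j\<in>S. (norm (P j u))\<^sup>2 / (pr j * \<tau> j)) + C / (2 * s) * (\<Sum>l=1..n. (norm (Q l v))\<^sup>2 / \<sigma> l)"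
proof -
  have "(\<Sum>j\<in>S. 1 / pr j * (T (P j u) \<bullet> v))
    \<le> (\<Sum>j\<in>S. s / 2 * ((norm (P j u))\<^sup>2 / (pr j * \<tau> j)) + 1 / (2 * s) * (\<tau>0 j / pr j * (norm (P j (adjoint T v)))\<^sup>2))"
  proof (rule sum_mono)
    fix j assume "j \<in> S"
    then have j: "j \<in> {1..m}" using S by blast
    note pos = pr[OF j] \<tau>[OF j] s
    have "T (P j u) \<bullet> v = P j u \<bullet> P j (adjoint T v)"
      by (metis adjoint_blinfun block_inner_block[OF P j])
    also have "\<dots> \<le> (s / \<tau> j) * (norm (P j u))\<^sup>2 / 2 + (norm (P j (adjoint T v)))\<^sup>2 / (2 * (s / \<tau> j))"
      using pos by (intro scaled_Cauchy_Schwarz) simp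
    also have "(norm (P j (adjoint T v)))\<^sup>2 / (2 * (s / \<tau> j)) = \<tau> j * (norm (P j (adjoint T v)))\<^sup>2 / (2 * s)" by simp
    also have "\<dots> \<le> \<tau>0 j * (norm (P j (adjoint T v)))\<^sup>2 / (2 * s)"
      using pos by (intro divide_right_mono mult_right_mono) auto
    finally have "1 / pr j * (T (P j u) \<bullet> v) \<le> 1 / pr j * ((s / \<tau> j) * (norm (P j u))\<^sup>2 / 2 + \<tau>0 j * (norm (P j (adjoint T v)))\<^sup>2 / (2 * s))"
      using pos by (intro mult_left_mono) auto
    also have "\<dots> = s / 2 * ((norm (P j u))\<^sup>2 / (pr j * \<tau> j)) + 1 / (2 * s) * (\<tau>0 j / pr j * (norm (P j (adjoint T v)))\<^sup>2)"
      using pos by (simp add: field_simps)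
    finally show "1 / pr j * (T (P j u) \<bullet> v) \<le> \<dots>" .
  qed
  also have "\<dots> = s / 2 * (\<Sum>j\<in>S. (norm (P j u))\<^sup>2 / (pr j * \<tau> j))
      + 1 / (2 * s) * (\<Sum>j\<in>S. \<tau>0 j / pr j * (norm (P j (adjoint T v)))\<^sup>2)"
    by (simp add: sum.distrib sum_distrib_left)
  also have "(\<Sum>j\<in>S. \<tau>0 j / pr j * (norm (P j (adjoint T v)))\<^sup>2) \<le> C * (\<Sum>l=1..n. (norm (Q l v))\<^sup>2 / \<sigma> l)"
  proof (rule order_trans[OF bound mult_left_mono[OF sum_mono C]])
    fix l assume "l \<in> {1..n}"
    then show "(norm (Q l v))\<^sup>2 / \<sigma>0 l \<le> (norm (Q l v))\<^sup>2 / \<sigma> l"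
      using \<sigma>[of l] by (intro divide_left_mono) auto
  qed
  finally show ?thesis using s by (simp add: mult_left_mono divide_right_mono)
qed

text \<open>Weighted arithmetic-geometric mean with weights 1 / p and (p - 1) / p. It produces
  \<open>t powr (2 - p)\<close>, a nonnegative power because p \<le> 2, which is then enlarged by t
  \<le> r. For p = 1 the claim is just t \<le> r, the convention for 0^0 making the factor in
  \<open>z\<close> equal to 1.\<close>

lemma rpow_young:
  assumes p: "1 \<le> p" and t: "0 \<le> t" "t \<le> r" and e: "0 \<le> e"
    and z: "1 < p \<Longrightarrow> 0 < z" and p2: "p \<le> 2"
  shows "e * t \<le> (p - 1) * z * t\<^sup>2 + p powr (- p) * (rpow z (1 - p) * rpow r (2 - p)) * e powr p"
proof (cases "p = 1")
  case True
  have "e * t \<le> e * r" using t e by (intro mult_left_mono)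
  then show ?thesis using True t e by (simp add: rpow_def mult.commute)
next
  case False
  then have p1: "1 < p" using p by simp
  note z = z[OF p1]
  have rz: "rpow z (1 - p) = z powr (1 - p)" using p1 by (simp add: rpow_def)
  have nonneg: "0 \<le> (p - 1) * z * t\<^sup>2" using p1 z by simp
  have rnonneg: "0 \<le> rpow r (2 - p)" by (simp add: rpow_def)
  show ?thesis
  proof (cases "t = 0 \<or> e = 0")
    case True
    then show ?thesis using nonneg rnonneg by (auto simp: rz)
  next
    case False
    then have te: "0 < t" "0 < e" using t e by auto
    have mono: "t powr (2 - p) \<le> rpow r (2 - p)"
      using te t p2 by (auto simp: rpow_def intro!: powr_mono2)
    \<comment> \<open>Chosen so that the weighted arithmetic mean is the right-hand side with
      \<open>t\<close> in place of \<open>r\<close>, while the weighted geometric mean is exactly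
      \<open>e * t\<close>: the powers of \<open>p\<close> and \<open>z\<close> cancel.\<close>
    let ?a = "p * (p powr (- p) * (z powr (1 - p) * t powr (2 - p)) * e powr p)" and ?b = "p * (z * t\<^sup>2)"
    have pos: "0 < ?a" "0 < ?b" using p1 z te by auto
    have ln_a: "ln ?a = ln p - p * ln p + (1 - p) * ln z + (2 - p) * ln t + p * ln e"
      using p1 z te by (simp add: ln_mult ln_powr)
    have ln_b: "ln ?b = ln p + ln z + 2 * ln t"
      using p1 z te by (simp add: ln_mult ln_realpow)
    have ln_weighted: "ln (a powr r * b powr q) = r * ln a + q * ln b" if "0 < a" "0 < b" for a b r q :: real
      using that by (simp add: ln_mult ln_powr)
    have "ln (?a powr (1 / p) * ?b powr ((p - 1) / p)) = (1 / p) * ln ?a + ((p - 1) / p) * ln ?b"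
      by (rule ln_weighted) (fact pos)+
    also have "\<dots> = ln e + ln t" unfolding ln_a ln_b using p1 by (simp add: field_simps)
    also have "\<dots> = ln (e * t)" using te by (simp add: ln_mult)
    finally have "?a powr (1 / p) * ?b powr ((p - 1) / p) = e * t"
      using pos te by (metis ln_inj_iff mult_pos_pos powr_gt_zero order_less_irrefl)
    moreover have "?a powr (1 / p) * ?b powr ((p - 1) / p) \<le> (1 / p) * ?a + ((p - 1) / p) * ?b"
      using pos p1 by (intro Youngs_inequality_0) (auto simp: field_simps)
    ultimately have "e * t \<le> p powr (- p) * (z powr (1 - p) * t powr (2 - p)) * e powr p + (p - 1) * z * t\<^sup>2"
      using p1 by simp
    also have "p powr (- p) * (z powr (1 - p) * t powr (2 - p)) * e powr p \<le> p powr (- p) * (z powr (1 - p) * rpow r (2 - p)) * e powr p"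
      using mono by (intro mult_left_mono mult_right_mono) auto
    finally show ?thesis by (simp add: rz)
  qed
qed

text \<open>Only updated blocks contract, so part of their strong convexity has to pay for the blocks that
  are left alone: after taking expectations, the term with the old iterate on the left compensates
  for them. Completing the square gives c with gt in place of its factor g, hence this weaker c.\<close>

lemma acceleration_bound:
  fixes u u' :: "'a::real_inner"
  assumes pr: "0 < pr" "pr \<le> 1"
    and gt: "(0 \<le> gt \<and> gt < pr * g) \<or> (gt = g \<and> g = 0)"
    and c: "c = (if 0 < g then 2 * (1 - pr) * g * ((g - gt) / (pr * g - gt)) else 0)"
  shows "gt / pr * (norm u')\<^sup>2 + (1 - pr) * gt / pr\<^sup>2 * (norm u)\<^sup>2
    \<le> g / pr * (norm u')\<^sup>2 + c / (2 * pr) * (norm (u' - u))\<^sup>2"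
proof (cases "g = 0")
  case True
  then show ?thesis using gt pr c by auto
next
  case False
  then have gt: "0 \<le> gt" "gt < pr * g" using gt by auto
  then have g: "0 < g" using pr by (metis less_le_trans not_less zero_less_mult_pos le_less_trans)
  have gtg: "gt < g" using gt pr g by (meson less_le_trans mult_left_le_one_le less_imp_le)
  \<comment> \<open>\<open>b / pr\<close> is the coefficient of the old iterate on the left. The
    strict inequality \<open>gt < pr * g\<close> says exactly that \<open>g - gt - b\<close> is
    positive, so that the square in \<open>norm u'\<close> and \<open>norm (u' - u)\<close> can be
    completed.\<close>
  define b where "b = (1 - pr) * gt / pr"
  have b0: "0 \<le> b" using pr gt by (simp add: b_def)
  have qb: "g - gt - b = (pr * g - gt) / pr" using pr by (simp add: b_def field_simps)
  then have qb0: "0 < g - gt - b" using gt pr by simp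
  have tri: "norm u \<le> norm u' + norm (u' - u)" by (metis norm_minus_commute norm_triangle_sub)
  have "b * (norm u)\<^sup>2 \<le> b * (norm u' + norm (u' - u))\<^sup>2"
    using b0 tri by (intro mult_left_mono power_mono) auto
  also have "\<dots> \<le> (g - gt) * (norm u')\<^sup>2 + b * (g - gt) / (g - gt - b) * (norm (u' - u))\<^sup>2"
  proof -
    have "0 \<le> (g - gt - b) * (A - b * B / (g - gt - b))\<^sup>2" for A B :: real using qb0 by simp
    moreover have "(g - gt - b) * (A - b * B / (g - gt - b))\<^sup>2
      = (g - gt) * A\<^sup>2 + b * (g - gt) / (g - gt - b) * B\<^sup>2 - b * (A + B)\<^sup>2" for A B :: real
    proof -
      have "q * (A - b * B / q)\<^sup>2 = (q + b) * A\<^sup>2 + b * (q + b) / q * B\<^sup>2 - b * (A + B)\<^sup>2" if "0 < q" for q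
        using that by (simp add: field_simps power2_eq_square)
      from this[OF qb0] show ?thesis by simp
    qed
    ultimately show ?thesis by (metis diff_ge_0_iff_ge)
  qed
  also have "b * (g - gt) / (g - gt - b) = (1 - pr) * gt * ((g - gt) / (pr * g - gt))"
    unfolding qb using pr gt by (simp add: b_def)
  also have "(g - gt) * (norm u')\<^sup>2 + (1 - pr) * gt * ((g - gt) / (pr * g - gt)) * (norm (u' - u))\<^sup>2
    \<le> (g - gt) * (norm u')\<^sup>2 + (1 - pr) * g * ((g - gt) / (pr * g - gt)) * (norm (u' - u))\<^sup>2"
    using gt gtg pr by (intro add_left_mono mult_right_mono mult_left_mono) auto
  also have "(1 - pr) * g * ((g - gt) / (pr * g - gt)) = c / 2"
  proof -
    have "c = 2 * ((1 - pr) * g * ((g - gt) / (pr * g - gt)))" using c g by simp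
    then show ?thesis by (metis nonzero_mult_div_cancel_left zero_neq_numeral)
  qed
  finally have "b * (norm u)\<^sup>2 / pr \<le> ((g - gt) * (norm u')\<^sup>2 + c / 2 * (norm (u' - u))\<^sup>2) / pr"
    using pr by (intro divide_right_mono) auto
  moreover have "b * (norm u)\<^sup>2 / pr = (1 - pr) * gt / pr\<^sup>2 * (norm u)\<^sup>2"
    by (simp add: b_def power2_eq_square)
  ultimately show ?thesis by (simp add: diff_divide_distrib add_divide_distrib left_diff_distrib)
qed

section \<open>Nonlinear part of the operator\<close>

text \<open>Along the line through \<open>b\<close> in direction \<open>h\<close>, the function z
  \<bullet> K is affine. Its slope is read off once from linearity and once from the chain rule, and
  derivatives are unique.\<close>

lemma lin_dual_derivative:
  assumes K: "\<And>v. (K has_derivative blinfun_apply (dK v)) (at v)" and z: "z \<in> lin_dual K"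
  shows "z \<bullet> dK b h = z \<bullet> K h"
proof -
  interpret l: linear "\<lambda>x. z \<bullet> K x" using z by (simp add: lin_dual_def)
  have "(K has_derivative blinfun_apply (dK b)) (at (b + 0 *\<^sub>R h))" using K[of b] by simp
  moreover have "((\<lambda>s::real. b + s *\<^sub>R h) has_derivative (\<lambda>s. s *\<^sub>R h)) (at 0)"
    by (auto intro!: derivative_eq_intros)
  ultimately have "((\<lambda>s::real. K (b + s *\<^sub>R h)) has_derivative (\<lambda>s. dK b (s *\<^sub>R h))) (at 0)"
    using has_derivative_compose[of "\<lambda>s. b + s *\<^sub>R h" "\<lambda>s. s *\<^sub>R h" 0 UNIV K "dK b"] by simp
  then have 1: "((\<lambda>s::real. z \<bullet> K (b + s *\<^sub>R h)) has_derivative (\<lambda>s. z \<bullet> dK b (s *\<^sub>R h))) (at 0)"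
    by (rule has_derivative_inner_right)
  have 2: "((\<lambda>s::real. z \<bullet> K (b + s *\<^sub>R h)) has_derivative (\<lambda>s. s *\<^sub>R (z \<bullet> K h))) (at 0)"
    by (auto simp: l.add l.scale intro!: derivative_eq_intros)
  from fun_cong[OF has_derivative_unique[OF 1 2], of 1] show ?thesis by simp
qed

lemma lin_dual_remainder:
  assumes K: "\<And>v. (K has_derivative blinfun_apply (dK v)) (at v)"
  shows "K a - K b - dK b (a - b) \<in> (lin_dual K)\<^sup>\<bottom>"
    and "(dK a - dK b) h \<in> (lin_dual K)\<^sup>\<bottom>"
proof -
  have "z \<bullet> (K a - K b - dK b (a - b)) = 0 \<and> z \<bullet> (dK a - dK b) h = 0" if z: "z \<in> lin_dual K" for z
  proof -
    interpret l: linear "\<lambda>x. z \<bullet> K x" using z by (simp add: lin_dual_def)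
    show ?thesis
      by (simp add: inner_diff_right blinfun.diff_left lin_dual_derivative[of K dK, OF K z] l.diff)
  qed
  then show "K a - K b - dK b (a - b) \<in> (lin_dual K)\<^sup>\<bottom>" "(dK a - dK b) h \<in> (lin_dual K)\<^sup>\<bottom>"
    by (auto simp: orthogonal_comp_def orthogonal_def)
qed

text \<open>The projection goes onto an orthogonal complement, which is closed whatever
  \<open>lin_dual K\<close> is. The residual lies in the double complement, hence is orthogonal to
  every \<open>r\<close> in the first one.\<close>

lemma P_NL_decomposition:
  fixes K :: "'a::real_inner \<Rightarrow> 'b::{real_inner, complete_space}"
  shows "P_NL K z \<in> (lin_dual K)\<^sup>\<bottom>" and "r \<in> (lin_dual K)\<^sup>\<bottom> \<Longrightarrow> r \<bullet> z = r \<bullet> P_NL K z"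
proof -
  note proj = orth_proj_onto_decomposition[OF closed_orthogonal_comp[of "lin_dual K"] subspace_orthogonal_comp,
      of z, folded P_NL_def]
  show "P_NL K z \<in> (lin_dual K)\<^sup>\<bottom>" by (rule proj(1))
  show "r \<bullet> z = r \<bullet> P_NL K z" if "r \<in> (lin_dual K)\<^sup>\<bottom>"
    using proj(2) that unfolding orthogonal_comp_def[of "(lin_dual K)\<^sup>\<bottom>"]
    by (auto simp: orthogonal_def inner_diff_right)
qed

lemma psd_norm_P_NL:
  fixes K :: "'a::real_inner \<Rightarrow> 'b::{real_inner, complete_space}"
  shows "psd_norm (P_NL K) z = norm (P_NL K z)"
  using P_NL_decomposition(2)[OF P_NL_decomposition(1), of K z z]
  by (simp add: psd_norm_def norm_eq_sqrt_inner)

lemma norm_P_NL_le: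
  fixes K :: "'a::real_inner \<Rightarrow> 'b::{real_inner, complete_space}"
  shows "norm (P_NL K z) \<le> norm z"
proof -
  have "norm (P_NL K z) * norm (P_NL K z) \<le> norm (P_NL K z) * norm z"
    using P_NL_decomposition(2)[OF P_NL_decomposition(1), of K z z]
      Cauchy_Schwarz_ineq2[of "P_NL K z" z] by (simp add: norm_eq_sqrt_inner[of "P_NL K z"])
  then show ?thesis by (cases "P_NL K z = 0") auto
qed

text \<open>By self-adjointness of both projections. The case distinction in \<open>gamFb\<close>
  applies \<open>Q l\<close> after \<open>P_NL K\<close>, whereas the error terms contain the
  product in the reverse order.\<close>

lemma P_NL_block_zero:
  fixes K :: "'a::real_inner \<Rightarrow> 'b::{real_inner, complete_space}"
  assumes Q: "block_decomposition n Q" "l \<in> {1..n}" and zero: "\<And>v. Q l (P_NL K v) = 0"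
  shows "P_NL K (Q l z) = 0"
proof -
  have "P_NL K (Q l z) \<bullet> P_NL K (Q l z) = P_NL K (Q l z) \<bullet> Q l z"
    using P_NL_decomposition(2)[OF P_NL_decomposition(1), of K "Q l z" "Q l z"] by simp
  also have "\<dots> = 0" using block_decompositionD(3)[OF Q, of "P_NL K (Q l z)" z] zero by simp
  finally show ?thesis by simp
qed

text \<open>\<open>P_NL K\<close> need not commute with the blocks, so \<open>z\<close> is split
  into blocks first and each block is then replaced by its nonlinear component.\<close>

lemma nonlinear_inner_le:
  fixes K :: "'a::real_inner \<Rightarrow> 'b::{real_inner, complete_space}"
  assumes Q: "block_decomposition n Q" and r: "r \<in> (lin_dual K)\<^sup>\<bottom>"
  shows "\<bar>r \<bullet> z\<bar> \<le> (\<Sum>l=1..n. norm r * norm (P_NL K (Q l z)))"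
proof -
  have "r \<bullet> z = (\<Sum>l=1..n. r \<bullet> Q l z)"
    using block_decompositionD(4)[OF Q, of z] by (simp flip: inner_sum_right)
  also have "\<dots> = (\<Sum>l=1..n. r \<bullet> P_NL K (Q l z))"
    by (rule sum.cong[OF refl P_NL_decomposition(2)[OF r]])
  finally show ?thesis
    by (auto intro!: order_trans[OF sum_abs] sum_mono Cauchy_Schwarz_ineq2)
qed

text \<open>Testing with the remainder \<open>r\<close> itself reduces the vector estimate to a real
  function on [0, 1]; the quadratic subtracted in \<open>\<phi>\<close> is what the Lipschitz bound
  on the derivative integrates to.\<close>

lemma linearisation_remainder_bound:
  assumes K: "\<And>v. (K has_derivative blinfun_apply (dK v)) (at v)"
    and lip: "lipschitz_property dK XK L" and seg: "closed_segment b a \<subseteq> XK"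
  shows "norm (K a - K b - dK b (a - b)) \<le> L / 2 * (norm (a - b))\<^sup>2"
proof -
  define h where "h = a - b"
  define r where "r = K a - K b - dK b h"
  define \<phi> where "\<phi> s = r \<bullet> (K (b + s *\<^sub>R h) - s *\<^sub>R dK b h) - L * s\<^sup>2 / 2 * (norm h)\<^sup>2 * norm r" for s
  have "\<phi> 1 \<le> \<phi> 0"
  proof (rule DERIV_nonpos_imp_nonincreasing[of 0 1])
    fix s :: real assume s: "0 \<le> s" "s \<le> 1"
    let ?d = "r \<bullet> (dK (b + s *\<^sub>R h) h - dK b h) - L * s * (norm h)\<^sup>2 * norm r"
    have "((\<lambda>s. b + s *\<^sub>R h) has_derivative (\<lambda>t. t *\<^sub>R h)) (at s)"
      by (auto intro!: derivative_eq_intros)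
    then have "((\<lambda>s. K (b + s *\<^sub>R h)) has_derivative (\<lambda>t. dK (b + s *\<^sub>R h) (t *\<^sub>R h))) (at s)"
      using has_derivative_compose[of "\<lambda>s. b + s *\<^sub>R h" "\<lambda>t. t *\<^sub>R h" s UNIV K] K by blast
    then have "((\<lambda>s. K (b + s *\<^sub>R h)) has_vector_derivative dK (b + s *\<^sub>R h) h) (at s)"
      by (simp add: has_vector_derivative_def blinfun.scaleR_right)
    then have "((\<lambda>s. K (b + s *\<^sub>R h) - s *\<^sub>R dK b h) has_vector_derivative (dK (b + s *\<^sub>R h) h - dK b h)) (at s)"
      by (auto intro!: derivative_eq_intros)
    from bounded_linear.has_vector_derivative[OF bounded_linear_inner_right this, of r]
    have "((\<lambda>s. r \<bullet> (K (b + s *\<^sub>R h) - s *\<^sub>R dK b h)) has_real_derivative r \<bullet> (dK (b + s *\<^sub>R h) h - dK b h)) (at s)"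
      by (simp add: has_real_derivative_iff_has_vector_derivative)
    then have "(\<phi> has_real_derivative ?d) (at s)"
      unfolding \<phi>_def by (auto intro!: derivative_eq_intros)
    moreover have "?d \<le> 0"
    proof -
      have "b + s *\<^sub>R h = (1 - s) *\<^sub>R b + s *\<^sub>R a" by (simp add: h_def algebra_simps)
      then have "b + s *\<^sub>R h \<in> closed_segment b a" using s by (auto simp: closed_segment_def)
      then have "norm (dK (b + s *\<^sub>R h) - dK b) \<le> L * norm (b + s *\<^sub>R h - b)"
        using lip seg ends_in_segment(1)[of b a] unfolding lipschitz_property_def by blast
      then have le: "norm (dK (b + s *\<^sub>R h) - dK b) \<le> L * s * norm h" using s by simp
      have "r \<bullet> (dK (b + s *\<^sub>R h) h - dK b h) \<le> norm r * norm ((dK (b + s *\<^sub>R h) - dK b) h)"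
        unfolding blinfun.diff_left[symmetric] using Cauchy_Schwarz_ineq2 abs_ge_self order_trans by blast
      also have "\<dots> \<le> norm r * (L * s * norm h * norm h)"
        by (intro mult_left_mono order_trans[OF norm_blinfun] mult_right_mono le) auto
      finally show ?thesis by (simp add: power2_eq_square algebra_simps)
    qed
    ultimately show "\<exists>y. (\<phi> has_real_derivative y) (at s) \<and> y \<le> 0" by blast
  qed simp
  then have "r \<bullet> (K (b + h) - dK b h - K b) \<le> L / 2 * (norm h)\<^sup>2 * norm r"
    by (simp add: \<phi>_def inner_diff_right)
  moreover have "K (b + h) - dK b h - K b = r" by (simp add: r_def h_def)
  ultimately have "norm r * norm r \<le> L / 2 * (norm h)\<^sup>2 * norm r"
    by (simp add: power2_norm_eq_inner[symmetric] power2_eq_square)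
  \<comment> \<open>Division by \<open>norm r\<close> fails for \<open>r = 0\<close>. There the sign
    of \<open>L\<close> is taken from the Lipschitz bound between the end points, unless these
    coincide.\<close>
  moreover have "0 \<le> L / 2 * (norm h)\<^sup>2" if "r = 0"
  proof (cases "a = b")
    case False
    have "norm (dK a - dK b) \<le> L * norm (a - b)"
      using lip seg ends_in_segment[of b a] unfolding lipschitz_property_def by blast
    then have "0 \<le> L * norm (a - b)" using norm_ge_zero order_trans by blast
    then show ?thesis using False by (simp add: zero_le_mult_iff)
  qed (simp add: h_def)
  ultimately have "norm r \<le> L / 2 * (norm h)\<^sup>2" by (cases "r = 0") auto
  then show ?thesis by (simp add: r_def h_def)
qed

section \<open>Pathwise descent\<close>

lemma three_point_identity:
  fixes a b e :: "'a::real_inner"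
  shows "(b - a) \<bullet> (a - e) = ((norm (b - e))\<^sup>2 - (norm (a - e))\<^sup>2 - (norm (a - b))\<^sup>2) / 2"
  unfolding power2_norm_eq_inner by (simp add: inner_simps inner_commute)

lemma block_three_point_identity:
  assumes R: "block_decomposition k R" and j: "j \<in> {1..k}"
  shows "(b - a) \<bullet> R j (a - e)
    = ((norm (R j (b - e)))\<^sup>2 - (norm (R j (a - e)))\<^sup>2 - (norm (R j (a - b)))\<^sup>2) / 2"
proof -
  have "(b - a) \<bullet> R j (a - e) = (R j b - R j a) \<bullet> (R j a - R j e)"
    using block_inner_block[OF R j, of "a - e" "b - a"] by (simp add: inner_commute blinfun.diff_right)
  then show ?thesis by (simp add: three_point_identity blinfun.diff_right)
qed

text \<open>One step of the method along a fixed realisation. The assumptions primal and dual are the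
  proximal updates tested with the new iterate and combined with the monotonicity property, and
  sigma is the dual step length of the current update, which carries the index i + 1 in the algorithm.\<close>

locale pdps_step =
  fixes m n :: nat
    and P :: "nat \<Rightarrow> 'x::{real_inner, complete_space} \<Rightarrow>\<^sub>L 'x"
    and Q :: "nat \<Rightarrow> 'y::{real_inner, complete_space} \<Rightarrow>\<^sub>L 'y"
    and K :: "'x \<Rightarrow> 'y" and dK :: "'x \<Rightarrow> 'x \<Rightarrow>\<^sub>L 'y" and XK :: "'x set"
    and S :: "nat set" and xh x xn xb :: 'x and yh y yn :: 'y
    and pr \<tau>0 \<tau> gamG gamK gamGt c :: "nat \<Rightarrow> real"
    and \<sigma>0 \<sigma> gamF gamFb \<zeta> \<rho> :: "nat \<Rightarrow> real"
    and L L3 Lbar p \<alpha> \<delta> \<kappa> \<rho>x \<theta> :: real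
  assumes P: "block_decomposition m P" and Q: "block_decomposition n Q"
    and K: "\<And>v. (K has_derivative blinfun_apply (dK v)) (at v)"
    and L: "0 \<le> L" "lipschitz_property dK XK L"
    and S: "S \<subseteq> {1..m}"
    and pr: "\<And>j. j \<in> {1..m} \<Longrightarrow> 0 < pr j" "\<And>j. j \<in> {1..m} \<Longrightarrow> pr j \<le> 1"
    and \<tau>: "\<And>j. j \<in> {1..m} \<Longrightarrow> 0 < \<tau> j \<and> \<tau> j \<le> \<tau>0 j"
    and \<sigma>: "\<And>l. l \<in> {1..n} \<Longrightarrow> 0 < \<sigma> l \<and> \<sigma> l \<le> \<sigma>0 l"
    and primal: "\<And>j. j \<in> S \<Longrightarrow> gamG j * (norm (P j (xn - xh)))\<^sup>2
      \<le> 1 / \<tau> j * ((x - xn) \<bullet> P j (xn - xh)) - (adjoint (dK x) y - adjoint (dK xh) yh) \<bullet> P j (xn - xh)"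
    and fixed: "\<And>j. j \<in> {1..m} \<Longrightarrow> j \<notin> S \<Longrightarrow> P j xn = P j x"
    and dual: "(\<Sum>l=1..n. gamF l * (norm (Q l (yn - yh)))\<^sup>2)
      \<le> (\<Sum>l=1..n. 1 / \<sigma> l * ((y - yn) \<bullet> Q l (yn - yh))) + (K xb - K xh) \<bullet> (yn - yh)"
    and three: "(\<Sum>j\<in>S. gamK j / pr j * (norm (P j (xn - xh)))\<^sup>2)
        + \<theta> * norm (K xh - K x - dK x (xh - x)) powr p
        - L3 / 2 * (\<Sum>j\<in>S. 1 / pr j * (norm (P j (xn - x)))\<^sup>2)
      \<le> (\<Sum>j\<in>S. 1 / pr j * (adjoint (dK x - dK xh) yh \<bullet> P j (xn - xh)))"
    and xb: "xb = xn + (\<Sum>j\<in>S. (1 / pr j) *\<^sub>R P j (xn - x))"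
    and XK: "closed_segment x xb \<subseteq> XK" "xn \<in> XK"
    and near: "norm (xn - xh) \<le> \<rho>x" "\<And>l. l \<in> {1..n} \<Longrightarrow> norm (P_NL K (Q l (yn - yh))) \<le> \<rho> l"
    and \<alpha>: "0 < \<alpha>" and p: "1 \<le> p" "p \<le> 2" and \<zeta>0: "\<And>l. l \<in> {1..n} \<Longrightarrow> 0 \<le> \<zeta> l"
    and \<zeta>: "\<And>l. l \<in> {1..n} \<Longrightarrow> 1 < p \<Longrightarrow> 0 < \<zeta> l"
    and gamFb: "\<And>l. l \<in> {1..n} \<Longrightarrow>
      gamFb l = (if (\<forall>v. Q l (P_NL K v) = 0) then gamF l else gamF l - (p - 1) * \<zeta> l - \<alpha>)"
    and gamGt: "\<And>j. j \<in> {1..m} \<Longrightarrow>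
      (0 \<le> gamGt j \<and> gamGt j < pr j * (gamG j + gamK j)) \<or> (gamGt j = gamG j + gamK j \<and> gamG j + gamK j = 0)"
    and c: "\<And>j. j \<in> {1..m} \<Longrightarrow>
      c j = (if gamG j + gamK j > 0
             then 2 * (1 - pr j) * (gamG j + gamK j)
               * ((gamG j + gamK j - gamGt j) / (pr j * (gamG j + gamK j) - gamGt j))
             else 0)"
    and constants: "0 < \<delta>" "\<delta> < \<kappa>" "\<kappa> < 1"
    and Lbar: "Lbar = L3 + L * ((MAX j\<in>{1..m}. (1 / pr j + 1)\<^sup>2) * (\<Sum>l=1..n. \<rho> l)
                               + real n * L / (2 * \<alpha>) * \<rho>x\<^sup>2)"
    and steps_\<delta>: "\<And>j. j \<in> {1..m} \<Longrightarrow> \<delta> \<ge> \<tau>0 j * Lbar + \<tau>0 j * c j"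
    and coupling: "\<And>v. (\<Sum>j\<in>S. \<tau>0 j / pr j * (norm (P j (adjoint (dK x) v)))\<^sup>2)
      \<le> (1 - \<kappa>) * (\<Sum>l=1..n. (norm (Q l v))\<^sup>2 / \<sigma>0 l)"
begin

text \<open>\<open>rem\<close> is quadratic in the extrapolated step, so the increments can pay for
  it; \<open>err\<close> is measured against the critical point and is left to the three-point
  property. \<open>t l\<close> is the part of the dual error in block \<open>l\<close> that the
  nonlinearity can see.\<close>

abbreviation "err \<equiv> K xh - K x - dK x (xh - x)"
abbreviation "rem \<equiv> K xb - K x - dK x (xb - x)"
abbreviation "extra \<equiv> \<Sum>j\<in>S. (1 / pr j) *\<^sub>R P j (xn - x)"
abbreviation "t l \<equiv> norm (P_NL K (Q l (yn - yh)))"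
abbreviation "incr \<equiv> \<Sum>j\<in>S. (norm (P j (xn - x)))\<^sup>2 / pr j"

section \<open>Energy balance of one step and its individual error terms\<close>

lemma S_m: "j \<in> S \<Longrightarrow> j \<in> {1..m}" using S by blast

lemma norm_incr_le: "(norm (xn - x))\<^sup>2 \<le> incr"
proof -
  have zero: "P j (xn - x) = 0" if "j \<in> {1..m}" "j \<notin> S" for j
    using fixed[OF that] by (simp add: blinfun.diff_right)
  have "(norm (xn - x))\<^sup>2 = (\<Sum>j\<in>S. (norm (P j (xn - x)))\<^sup>2)"
    unfolding block_norm[OF P, of "xn - x"] using S zero by (intro sum.mono_neutral_right) auto
  also have "\<dots> \<le> incr"
  proof (rule sum_mono)
    fix j assume "j \<in> S"
    then have "j \<in> {1..m}" by (rule S_m)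
    then show "(norm (P j (xn - x)))\<^sup>2 \<le> (norm (P j (xn - x)))\<^sup>2 / pr j"
      using pr[of j] by (simp add: pos_le_divide_eq mult_left_le)
  qed
  finally show ?thesis .
qed

text \<open>The difference of the primal gradients is split into
  \<open>adjoint (dK x - dK xh) yh\<close>, which the three-point property bounds, and
  \<open>adjoint (dK x) (y - yh)\<close>, which becomes coupling. The step differences turn into
  differences of squares by the three-point identity.\<close>

lemma energy_inequality:
  "(\<Sum>j\<in>S. 1 / (2 * pr j * \<tau> j) * ((norm (P j (xn - xh)))\<^sup>2 - (norm (P j (x - xh)))\<^sup>2 + (norm (P j (xn - x)))\<^sup>2))
   + (\<Sum>j\<in>S. (gamG j + gamK j) / pr j * (norm (P j (xn - xh)))\<^sup>2)
   + (\<Sum>l=1..n. 1 / (2 * \<sigma> l) * ((norm (Q l (yn - yh)))\<^sup>2 - (norm (Q l (y - yh)))\<^sup>2 + (norm (Q l (yn - y)))\<^sup>2))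
   + (\<Sum>l=1..n. gamF l * (norm (Q l (yn - yh)))\<^sup>2)
   + \<theta> * norm err powr p - L3 / 2 * incr
   + (\<Sum>j\<in>S. 1 / pr j * (dK x (P j (xn - xh)) \<bullet> (y - yh))) - (K xb - K xh) \<bullet> (yn - yh) \<le> 0"
proof -
  let ?a = "\<lambda>j. 1 / (2 * pr j * \<tau> j) * ((norm (P j (xn - xh)))\<^sup>2 - (norm (P j (x - xh)))\<^sup>2 + (norm (P j (xn - x)))\<^sup>2)"
  let ?b = "\<lambda>j. gamG j / pr j * (norm (P j (xn - xh)))\<^sup>2"
  let ?d = "\<lambda>j. 1 / pr j * (adjoint (dK x - dK xh) yh \<bullet> P j (xn - xh))"
  let ?e = "\<lambda>j. 1 / pr j * (dK x (P j (xn - xh)) \<bullet> (y - yh))"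
  have "?a j + ?b j + ?d j + ?e j \<le> 0" if jS: "j \<in> S" for j
  proof -
    note j = S_m[OF jS]
    have "(adjoint (dK x) y - adjoint (dK xh) yh) \<bullet> P j (xn - xh)
      = adjoint (dK x - dK xh) yh \<bullet> P j (xn - xh) + dK x (P j (xn - xh)) \<bullet> (y - yh)"
      by (simp add: inner_diff_left inner_commute[of "adjoint _ _"] adjoint_blinfun[symmetric]
          blinfun.diff_left inner_diff_right)
    then have "gamG j * (norm (P j (xn - xh)))\<^sup>2
      \<le> 1 / \<tau> j * (((norm (P j (x - xh)))\<^sup>2 - (norm (P j (xn - xh)))\<^sup>2 - (norm (P j (xn - x)))\<^sup>2) / 2)
        - (adjoint (dK x - dK xh) yh \<bullet> P j (xn - xh) + dK x (P j (xn - xh)) \<bullet> (y - yh))"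
      using primal[OF jS] unfolding block_three_point_identity[OF P j] by simp
    then have "1 / pr j * (gamG j * (norm (P j (xn - xh)))\<^sup>2)
      \<le> 1 / pr j * (1 / \<tau> j * (((norm (P j (x - xh)))\<^sup>2 - (norm (P j (xn - xh)))\<^sup>2 - (norm (P j (xn - x)))\<^sup>2) / 2)
        - (adjoint (dK x - dK xh) yh \<bullet> P j (xn - xh) + dK x (P j (xn - xh)) \<bullet> (y - yh)))"
      using pr[OF j] by (intro mult_left_mono) auto
    also have "\<dots> = - ?a j - ?d j - ?e j" by (simp add: algebra_simps diff_divide_distrib add_divide_distrib)
    finally show ?thesis by simp
  qed
  then have "(\<Sum>j\<in>S. ?a j + ?b j + ?d j + ?e j) \<le> 0" by (rule sum_nonpos)
  then have 1: "(\<Sum>j\<in>S. ?a j) + (\<Sum>j\<in>S. ?b j) + (\<Sum>j\<in>S. ?d j) + (\<Sum>j\<in>S. ?e j) \<le> 0"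
    by (simp only: sum.distrib)
  have "(\<Sum>l=1..n. 1 / \<sigma> l * ((y - yn) \<bullet> Q l (yn - yh)))
    = (\<Sum>l=1..n. - (1 / (2 * \<sigma> l) * ((norm (Q l (yn - yh)))\<^sup>2 - (norm (Q l (y - yh)))\<^sup>2 + (norm (Q l (yn - y)))\<^sup>2)))"
    by (rule sum.cong[OF refl], subst block_three_point_identity[OF Q], assumption)
      (simp add: algebra_simps diff_divide_distrib add_divide_distrib)
  then have 2: "(\<Sum>l=1..n. 1 / \<sigma> l * ((y - yn) \<bullet> Q l (yn - yh)))
    = - (\<Sum>l=1..n. 1 / (2 * \<sigma> l) * ((norm (Q l (yn - yh)))\<^sup>2 - (norm (Q l (y - yh)))\<^sup>2 + (norm (Q l (yn - y)))\<^sup>2))"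
    by (simp only: sum_negf)
  have 3: "(\<Sum>j\<in>S. (gamG j + gamK j) / pr j * (norm (P j (xn - xh)))\<^sup>2)
    = (\<Sum>j\<in>S. ?b j) + (\<Sum>j\<in>S. gamK j / pr j * (norm (P j (xn - xh)))\<^sup>2)"
    by (simp add: add_divide_distrib distrib_right sum.distrib)
  have 4: "(\<Sum>j\<in>S. 1 / pr j * (norm (P j (xn - x)))\<^sup>2) = incr" by simp
  show ?thesis using 1 dual three unfolding 2 3 4 by linarith
qed

text \<open>The reason for the extrapolation: \<open>dK x extra\<close> combines with the weighted
  primal term so that the linear contribution of the increments is a product of primal and dual
  increments. Replacing \<open>dK x\<close> by \<open>dK xn\<close> in what remains gives the
  coupling of the next potential, at the cost of a Lipschitz term.\<close>

lemma coupling_identity: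
  "(\<Sum>j\<in>S. 1 / pr j * (dK x (P j (xn - xh)) \<bullet> (y - yh))) - (K xb - K xh) \<bullet> (yn - yh)
   = (\<Sum>j\<in>S. 1 / pr j * (dK x (P j (x - xh)) \<bullet> (y - yh))) - (\<Sum>j\<in>S. 1 / pr j * (dK x (P j (xn - x)) \<bullet> (yn - y)))
     - dK xn (xn - xh) \<bullet> (yn - yh) + (dK xn - dK x) (xn - xh) \<bullet> (yn - yh)
     + err \<bullet> (yn - yh) - rem \<bullet> (yn - yh)"
proof -
  have ext: "dK x extra \<bullet> v = (\<Sum>j\<in>S. 1 / pr j * (dK x (P j (xn - x)) \<bullet> v))" for v
    by (simp add: blinfun.sum_right blinfun.scaleR_right inner_sum_left)
  have split: "(\<Sum>j\<in>S. 1 / pr j * (dK x (P j (xn - xh)) \<bullet> (y - yh)))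
    = (\<Sum>j\<in>S. 1 / pr j * (dK x (P j (x - xh)) \<bullet> (y - yh))) + (\<Sum>j\<in>S. 1 / pr j * (dK x (P j (xn - x)) \<bullet> (y - yh)))"
    by (simp add: sum.distrib[symmetric] blinfun.diff_right inner_diff_left algebra_simps diff_divide_distrib)
  have "K xb - K xh = rem - err + dK x (xn - xh) + dK x extra"
    unfolding xb by (simp add: blinfun.diff_right blinfun.add_right)
  then have "(K xb - K xh) \<bullet> (yn - yh)
    = rem \<bullet> (yn - yh) - err \<bullet> (yn - yh) + dK x (xn - xh) \<bullet> (yn - yh) + dK x extra \<bullet> (yn - yh)"
    by (simp only: inner_add_left inner_diff_left)
  moreover have "dK x extra \<bullet> (yn - y) = dK x extra \<bullet> (yn - yh) - dK x extra \<bullet> (y - yh)"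
    by (simp add: inner_diff_right)
  moreover have "(dK xn - dK x) (xn - xh) \<bullet> (yn - yh)
    = dK xn (xn - xh) \<bullet> (yn - yh) - dK x (xn - xh) \<bullet> (yn - yh)"
    by (simp only: inner_diff_left blinfun.diff_left)
  ultimately show ?thesis unfolding split ext[symmetric] by linarith
qed

text \<open>Young's inequality with weight 2 \<alpha> in each dual block: its dual half is the
  \<alpha> deducted in \<open>gamFb\<close>, and its primal half, summed over the \<open>n\<close>
  blocks, is the last term of \<open>Lbar\<close>.\<close>

lemma lipschitz_term_bound:
  "- (\<Sum>l=1..n. \<alpha> * (t l)\<^sup>2) - L / 2 * (real n * L / (2 * \<alpha>) * \<rho>x\<^sup>2) * incr
   \<le> (dK xn - dK x) (xn - xh) \<bullet> (yn - yh)"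
proof -
  define r where "r = (dK xn - dK x) (xn - xh)"
  have xXK: "x \<in> XK" using XK(1) by auto
  have "norm (dK xn - dK x) \<le> L * norm (xn - x)"
    using L(2) XK(2) xXK unfolding lipschitz_property_def by blast
  then have r: "norm r \<le> L * norm (xn - x) * \<rho>x"
    unfolding r_def using near(1) L(1)
    by (intro order_trans[OF norm_blinfun] mult_mono) auto
  have each: "norm r * t l \<le> \<alpha> * (t l)\<^sup>2 + L\<^sup>2 * \<rho>x\<^sup>2 / (4 * \<alpha>) * incr" for l
  proof -
    have "norm r * t l \<le> (L * norm (xn - x) * \<rho>x) * t l" using r by (intro mult_right_mono) auto
    also have "\<dots> \<le> \<alpha> * (t l)\<^sup>2 + (L * norm (xn - x) * \<rho>x)\<^sup>2 / (4 * \<alpha>)"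
      using scaled_Cauchy_Schwarz[of "2 * \<alpha>" "t l" "L * norm (xn - x) * \<rho>x"] \<alpha> by (simp add: mult.commute)
    also have "(L * norm (xn - x) * \<rho>x)\<^sup>2 / (4 * \<alpha>) = L\<^sup>2 * \<rho>x\<^sup>2 / (4 * \<alpha>) * (norm (xn - x))\<^sup>2"
      by (simp add: power_mult_distrib)
    also have "\<dots> \<le> L\<^sup>2 * \<rho>x\<^sup>2 / (4 * \<alpha>) * incr"
      using norm_incr_le \<alpha> by (intro mult_left_mono) auto
    finally show ?thesis by simp
  qed
  have "\<bar>r \<bullet> (yn - yh)\<bar> \<le> (\<Sum>l=1..n. norm r * t l)"
    unfolding r_def by (rule nonlinear_inner_le[OF Q lin_dual_remainder(2)[of K dK, OF K]])
  also have "\<dots> \<le> (\<Sum>l=1..n. \<alpha> * (t l)\<^sup>2 + L\<^sup>2 * \<rho>x\<^sup>2 / (4 * \<alpha>) * incr)"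
    by (rule sum_mono[OF each])
  also have "\<dots> = (\<Sum>l=1..n. \<alpha> * (t l)\<^sup>2) + real n * (L\<^sup>2 * \<rho>x\<^sup>2 / (4 * \<alpha>) * incr)"
    unfolding sum.distrib by simp
  also have "real n * (L\<^sup>2 * \<rho>x\<^sup>2 / (4 * \<alpha>) * incr) = L / 2 * (real n * L / (2 * \<alpha>) * \<rho>x\<^sup>2) * incr"
    by (simp add: power2_eq_square)
  finally show ?thesis unfolding r_def by linarith
qed

text \<open>The remainder is already quadratic in the increment, so for the dual factor the bound
  \<open>\<rho>\<close> suffices. Including the extrapolation, a selected block moves from
  \<open>x\<close> to \<open>xb\<close> by 1 / \<open>pr j\<close> + 1 times its increment, whence
  the maximum in \<open>Lbar\<close>.\<close>

lemma remainder_term_bound: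
  "rem \<bullet> (yn - yh) \<le> L / 2 * ((MAX j\<in>{1..m}. (1 / pr j + 1)\<^sup>2) * (\<Sum>l=1..n. \<rho> l)) * incr"
proof -
  define M where "M = (MAX j\<in>{1..m}. (1 / pr j + 1)\<^sup>2)"
  have ext: "xb - x = (\<Sum>j\<in>S. (1 / pr j + 1) *\<^sub>R P j (xn - x))"
  proof (rule block_eqI[OF P])
    fix j assume j: "j \<in> {1..m}"
    have "P j (xb - x) = P j (xn - x) + P j extra"
      by (simp only: xb blinfun.bilinear_simps) simp
    then have "P j (xb - x) = P j (xn - x) + (if j \<in> S then (1 / pr j) *\<^sub>R P j (xn - x) else 0)"
      unfolding block_apply_sum[OF P S j, of "\<lambda>j. 1 / pr j" "\<lambda>_. xn - x"] .
    then show "P j (xb - x) = P j (\<Sum>j\<in>S. (1 / pr j + 1) *\<^sub>R P j (xn - x))"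
      unfolding block_apply_sum[OF P S j, of "\<lambda>j. 1 / pr j + 1" "\<lambda>_. xn - x"]
      using fixed[OF j] by (simp add: scaleR_add_left blinfun.diff_right)
  qed
  have "(norm (xb - x))\<^sup>2 = (\<Sum>j\<in>S. (1 / pr j + 1)\<^sup>2 * (norm (P j (xn - x)))\<^sup>2)"
    unfolding ext by (rule block_norm_sum[OF P S])
  also have "\<dots> \<le> (\<Sum>j\<in>S. M * ((norm (P j (xn - x)))\<^sup>2 / pr j))"
  proof (rule sum_mono)
    fix j assume "j \<in> S"
    then have j: "j \<in> {1..m}" by (rule S_m)
    have "(1 / pr j + 1)\<^sup>2 \<le> M" unfolding M_def by (rule Max_ge) (use j in auto)
    moreover have "(norm (P j (xn - x)))\<^sup>2 \<le> (norm (P j (xn - x)))\<^sup>2 / pr j"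
      using pr[OF j] by (simp add: pos_le_divide_eq mult_left_le)
    ultimately show "(1 / pr j + 1)\<^sup>2 * (norm (P j (xn - x)))\<^sup>2 \<le> M * ((norm (P j (xn - x)))\<^sup>2 / pr j)"
      by (intro mult_mono) (auto intro: order_trans[OF zero_le_power2])
  qed
  also have "\<dots> = M * incr" by (simp only: sum_distrib_left)
  finally have nb: "(norm (xb - x))\<^sup>2 \<le> M * incr" .
  have "norm rem \<le> L / 2 * (norm (xb - x))\<^sup>2"
    by (rule linearisation_remainder_bound[OF K L(2) XK(1)])
  also have "\<dots> \<le> L / 2 * (M * incr)" using nb L(1) by (intro mult_left_mono) auto
  finally have rem: "norm rem \<le> L / 2 * (M * incr)" .
  have "0 \<le> L / 2 * (M * incr)" by (rule order_trans[OF norm_ge_zero rem])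
  moreover have "rem \<bullet> (yn - yh) \<le> (\<Sum>l=1..n. norm rem * t l)"
    using nonlinear_inner_le[OF Q lin_dual_remainder(1)[of K dK, OF K, where a=xb and b=x], of "yn - yh"]
    by linarith
  moreover have "(\<Sum>l=1..n. norm rem * t l) \<le> (\<Sum>l=1..n. L / 2 * (M * incr) * \<rho> l)"
    using rem near(2) calculation(1) by (intro sum_mono mult_mono) auto
  moreover have "(\<Sum>l=1..n. L / 2 * (M * incr) * \<rho> l) = L / 2 * (M * (\<Sum>l=1..n. \<rho> l)) * incr" 
  proof -
    have pull: "(\<Sum>l=1..n. a * \<rho> l) = a * (\<Sum>l=1..n. \<rho> l)" for a by (simp add: sum_distrib_left)
    have comm: "a * (b * d) * e = a * (b * e) * d" for a b d e :: real by simp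
    show ?thesis unfolding pull by (rule comm)
  qed
  ultimately show ?thesis unfolding M_def by linarith
qed

text \<open>The threshold that the hypotheses impose on the conditional mean of \<theta>.\<close>

definition young_const :: real where
  "young_const = p powr (- p) * (\<Sum>l=1..n. rpow (\<zeta> l) (1 - p) * rpow (\<rho> l) (2 - p))"

text \<open>Young's inequality with exponent \<open>p\<close> on the error: the dual half is the
  \<open>\<zeta>\<close> part deducted in \<open>gamFb\<close>, the other half a multiple of the
  quantity that the three-point property provides with factor \<theta>.\<close>

lemma error_term_bound:
  "- (\<Sum>l=1..n. (p - 1) * \<zeta> l * (t l)\<^sup>2) - young_const * norm err powr p \<le> err \<bullet> (yn - yh)"
proof -
  have "\<bar>err \<bullet> (yn - yh)\<bar> \<le> (\<Sum>l=1..n. norm err * t l)"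
    by (rule nonlinear_inner_le[OF Q lin_dual_remainder(1)[of K dK, OF K]])
  also have "\<dots> \<le> (\<Sum>l=1..n. (p - 1) * \<zeta> l * (t l)\<^sup>2
      + p powr (- p) * (rpow (\<zeta> l) (1 - p) * rpow (\<rho> l) (2 - p)) * norm err powr p)"
    using p near(2) \<zeta> by (intro sum_mono rpow_young) auto
  also have "\<dots> = (\<Sum>l=1..n. (p - 1) * \<zeta> l * (t l)\<^sup>2) + young_const * norm err powr p"
    unfolding sum.distrib young_const_def by (simp add: sum_distrib_left sum_distrib_right)
  finally show ?thesis by linarith
qed

text \<open>The deduction in \<open>gamFb\<close> is made for the blocks that meet the nonlinear
  part, where it covers the Young terms because \<open>P_NL K\<close> does not increase norms; on
  all other blocks \<open>t l\<close> vanishes.\<close>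

lemma dual_monotonicity_bound:
  "(\<Sum>l=1..n. gamFb l * (norm (Q l (yn - yh)))\<^sup>2)
   \<le> (\<Sum>l=1..n. gamF l * (norm (Q l (yn - yh)))\<^sup>2) - (\<Sum>l=1..n. \<alpha> * (t l)\<^sup>2) - (\<Sum>l=1..n. (p - 1) * \<zeta> l * (t l)\<^sup>2)"
proof -
  have "gamFb l * (norm (Q l (yn - yh)))\<^sup>2
    \<le> gamF l * (norm (Q l (yn - yh)))\<^sup>2 - \<alpha> * (t l)\<^sup>2 - (p - 1) * \<zeta> l * (t l)\<^sup>2" if l: "l \<in> {1..n}" for l
  proof (cases "\<forall>v. Q l (P_NL K v) = 0")
    case True
    then have "t l = 0" using P_NL_block_zero[OF Q l, of K] by simp
    then show ?thesis using gamFb[OF l] True by simp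
  next
    case False
    have "((p - 1) * \<zeta> l + \<alpha>) * (t l)\<^sup>2 \<le> ((p - 1) * \<zeta> l + \<alpha>) * (norm (Q l (yn - yh)))\<^sup>2"
      using \<alpha> p \<zeta>0[OF l] norm_P_NL_le by (intro mult_left_mono power_mono) auto
    moreover have gF: "gamF l = gamFb l + ((p - 1) * \<zeta> l + \<alpha>)" using gamFb[OF l] False by simp
    ultimately show ?thesis unfolding gF by (simp add: distrib_right)
  qed
  then have "(\<Sum>l=1..n. gamFb l * (norm (Q l (yn - yh)))\<^sup>2)
    \<le> (\<Sum>l=1..n. gamF l * (norm (Q l (yn - yh)))\<^sup>2 - \<alpha> * (t l)\<^sup>2 - (p - 1) * \<zeta> l * (t l)\<^sup>2)"
    by (rule sum_mono)
  then show ?thesis by (simp only: sum_subtractf)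
qed

text \<open>With \<open>s = 1 - \<delta>\<close> in the coupling bound, the dual factor is (1 -
  \<kappa>) / (1 - \<delta>), at most 1 by \<delta> < \<kappa>, so the squared dual increments of
  the energy inequality are enough.\<close>

lemma increment_coupling_bound:
  "(\<Sum>j\<in>S. 1 / pr j * (dK x (P j (xn - x)) \<bullet> (yn - y)))
   \<le> (1 - \<delta>) / 2 * (\<Sum>j\<in>S. (norm (P j (xn - x)))\<^sup>2 / (pr j * \<tau> j))
     + (\<Sum>l=1..n. 1 / (2 * \<sigma> l) * (norm (Q l (yn - y)))\<^sup>2)"
proof -
  have d: "0 < 1 - \<delta>" "0 \<le> 1 - \<kappa>" using constants by auto
  have s: "0 \<le> (\<Sum>l=1..n. (norm (Q l (yn - y)))\<^sup>2 / \<sigma> l)"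
    using \<sigma> by (intro sum_nonneg divide_nonneg_pos) auto
  have "(\<Sum>j\<in>S. 1 / pr j * (dK x (P j (xn - x)) \<bullet> (yn - y)))
    \<le> (1 - \<delta>) / 2 * (\<Sum>j\<in>S. (norm (P j (xn - x)))\<^sup>2 / (pr j * \<tau> j))
      + (1 - \<kappa>) / (2 * (1 - \<delta>)) * (\<Sum>l=1..n. (norm (Q l (yn - y)))\<^sup>2 / \<sigma> l)"
    by (rule coupling_bound[OF P S d pr(1) \<tau> \<sigma> coupling])
  also have "(1 - \<kappa>) / (2 * (1 - \<delta>)) * (\<Sum>l=1..n. (norm (Q l (yn - y)))\<^sup>2 / \<sigma> l)
    \<le> 1 / 2 * (\<Sum>l=1..n. (norm (Q l (yn - y)))\<^sup>2 / \<sigma> l)"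
    using d constants by (intro mult_right_mono s) (simp add: field_simps)
  also have "\<dots> = (\<Sum>l=1..n. 1 / (2 * \<sigma> l) * (norm (Q l (yn - y)))\<^sup>2)"
    by (simp add: sum_distrib_left)
  finally show ?thesis by simp
qed

lemma increment_absorption:
  "(\<Sum>j\<in>S. c j / (2 * pr j) * (norm (P j (xn - x)))\<^sup>2) + Lbar / 2 * incr
   + (1 - \<delta>) / 2 * (\<Sum>j\<in>S. (norm (P j (xn - x)))\<^sup>2 / (pr j * \<tau> j))
   \<le> (\<Sum>j\<in>S. 1 / (2 * pr j * \<tau> j) * (norm (P j (xn - x)))\<^sup>2)"
proof -
  have "c j / (2 * pr j) * D + Lbar / 2 * (D / pr j) + (1 - \<delta>) / 2 * (D / (pr j * \<tau> j)) \<le> 1 / (2 * pr j * \<tau> j) * D"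
    if jS: "j \<in> S" and D: "0 \<le> D" for j D
  proof -
    note j = S_m[OF jS]
    have pos: "0 < pr j" "0 < \<tau> j" "\<tau> j \<le> \<tau>0 j" using pr[OF j] \<tau>[OF j] by auto
    \<comment> \<open>The condition is stated for \<open>\<tau>0\<close>. It passes to the smaller
      \<open>\<tau>\<close> by monotonicity if \<open>Lbar + c j\<close> is nonnegative, and is
      trivial otherwise.\<close>
    have "\<tau> j * (Lbar + c j) \<le> \<delta>"
    proof (cases "0 \<le> Lbar + c j")
      case True
      then have "\<tau> j * (Lbar + c j) \<le> \<tau>0 j * (Lbar + c j)" using pos by (intro mult_right_mono)
      then show ?thesis using steps_\<delta>[OF j] by (simp add: distrib_left)
    next
      case False
      then have "\<tau> j * (Lbar + c j) \<le> 0" using pos by (intro mult_nonneg_nonpos) auto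
      then show ?thesis using constants by simp
    qed
    then have "D / (2 * pr j * \<tau> j) * (\<tau> j * (Lbar + c j) + (1 - \<delta>)) \<le> D / (2 * pr j * \<tau> j) * 1"
      using D pos by (intro mult_left_mono) auto
    moreover have "D / (2 * pr j * \<tau> j) * (\<tau> j * (Lbar + c j) + (1 - \<delta>))
      = c j / (2 * pr j) * D + Lbar / 2 * (D / pr j) + (1 - \<delta>) / 2 * (D / (pr j * \<tau> j))"
      using pos by (simp add: field_simps)
    ultimately show ?thesis by simp
  qed
  then have "(\<Sum>j\<in>S. c j / (2 * pr j) * (norm (P j (xn - x)))\<^sup>2 + Lbar / 2 * ((norm (P j (xn - x)))\<^sup>2 / pr j)
      + (1 - \<delta>) / 2 * ((norm (P j (xn - x)))\<^sup>2 / (pr j * \<tau> j)))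
    \<le> (\<Sum>j\<in>S. 1 / (2 * pr j * \<tau> j) * (norm (P j (xn - x)))\<^sup>2)"
    by (intro sum_mono) simp
  then show ?thesis by (simp only: sum.distrib sum_distrib_left)
qed

text \<open>The weights 1 / \<open>\<tau>\<close> of all blocks are raised, although unselected
  blocks do not contract. The centred factor \<open>indicator S j - pr j\<close> settles this: for
  an unselected block the two terms on the left cancel, a selected block is the case of
  \<open>acceleration_bound\<close>, and given the past the factor has mean zero.\<close>

lemma acceleration_sum:
  "(\<Sum>j=1..m. gamGt j / pr j * (norm (P j (xn - xh)))\<^sup>2)
   + (\<Sum>j=1..m. gamGt j / (pr j)\<^sup>2 * (indicator S j - pr j) * (norm (P j (x - xh)))\<^sup>2)
   \<le> (\<Sum>j\<in>S. (gamG j + gamK j) / pr j * (norm (P j (xn - xh)))\<^sup>2)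
     + (\<Sum>j\<in>S. c j / (2 * pr j) * (norm (P j (xn - x)))\<^sup>2)"
proof -
  let ?f = "\<lambda>j. gamGt j / pr j * (norm (P j (xn - xh)))\<^sup>2
      + gamGt j / (pr j)\<^sup>2 * (indicator S j - pr j) * (norm (P j (x - xh)))\<^sup>2"
  let ?g = "\<lambda>j. (gamG j + gamK j) / pr j * (norm (P j (xn - xh)))\<^sup>2 + c j / (2 * pr j) * (norm (P j (xn - x)))\<^sup>2"
  have "(\<Sum>j=1..m. ?f j) \<le> (\<Sum>j=1..m. if j \<in> S then ?g j else 0)"
  proof (rule sum_mono)
    fix j assume j: "j \<in> {1..m}"
    show "?f j \<le> (if j \<in> S then ?g j else 0)"
    proof (cases "j \<in> S")
      case True
      have "P j (xn - xh) - P j (x - xh) = P j (xn - x)" by (simp add: blinfun.diff_right)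
      then show ?thesis
        using acceleration_bound[OF pr[OF j] gamGt[OF j] c[OF j], of "P j (xn - xh)" "P j (x - xh)"] True
        by (simp add: mult.commute)
    next
      case False
      then have "P j (xn - xh) = P j (x - xh)" using fixed[OF j] by (simp add: blinfun.diff_right)
      then show ?thesis using False pr[OF j] by (simp add: power2_eq_square)
    qed
  qed
  also have "\<dots> = (\<Sum>j\<in>S. ?g j)"
    using S by (simp only: sum.inter_restrict[symmetric] finite_atLeastAtMost Int_absorb1)
  finally show ?thesis by (simp only: sum.distrib)
qed

lemma descent:
  "(\<Sum>j=1..m. 1 / (2 * pr j) * (1 / \<tau> j + 2 * gamGt j) * (norm (P j (xn - xh)))\<^sup>2)
   + (\<Sum>l=1..n. 1 / 2 * (1 / \<sigma> l + 2 * gamFb l) * (norm (Q l (yn - yh)))\<^sup>2)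
   - dK xn (xn - xh) \<bullet> (yn - yh)
   + (\<theta> - young_const) * norm err powr p
   + (\<Sum>j=1..m. gamGt j / (pr j)\<^sup>2 * (indicator S j - pr j) * (norm (P j (x - xh)))\<^sup>2)
   + (\<Sum>j=1..m. 1 / pr j * (indicator S j * (dK x (P j (x - xh)) \<bullet> (y - yh))))
   \<le> (\<Sum>j=1..m. 1 / (2 * pr j) * (1 / \<tau> j) * (norm (P j (x - xh)))\<^sup>2)
     + (\<Sum>l=1..n. 1 / 2 * (1 / \<sigma> l) * (norm (Q l (y - yh)))\<^sup>2)"
proof -
  let ?D = "\<lambda>j. (norm (P j (xn - x)))\<^sup>2"
  have e1: "(\<Sum>j\<in>S. 1 / (2 * pr j * \<tau> j) * ((norm (P j (xn - xh)))\<^sup>2 - (norm (P j (x - xh)))\<^sup>2 + ?D j))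
    = (\<Sum>j=1..m. 1 / (2 * pr j) * (1 / \<tau> j) * (norm (P j (xn - xh)))\<^sup>2)
      - (\<Sum>j=1..m. 1 / (2 * pr j) * (1 / \<tau> j) * (norm (P j (x - xh)))\<^sup>2)
      + (\<Sum>j\<in>S. 1 / (2 * pr j * \<tau> j) * ?D j)"
  proof -
    have "(\<Sum>j\<in>S. 1 / (2 * pr j * \<tau> j) * ((norm (P j (xn - xh)))\<^sup>2 - (norm (P j (x - xh)))\<^sup>2))
      = (\<Sum>j=1..m. 1 / (2 * pr j * \<tau> j) * ((norm (P j (xn - xh)))\<^sup>2 - (norm (P j (x - xh)))\<^sup>2))"
      using S fixed by (intro sum.mono_neutral_left) (auto simp: blinfun.diff_right)
    then show ?thesis by (simp add: distrib_left right_diff_distrib sum.distrib sum_subtractf)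
  qed
  have e2: "(\<Sum>l=1..n. 1 / (2 * \<sigma> l) * ((norm (Q l (yn - yh)))\<^sup>2 - (norm (Q l (y - yh)))\<^sup>2 + (norm (Q l (yn - y)))\<^sup>2))
    = (\<Sum>l=1..n. 1 / 2 * (1 / \<sigma> l) * (norm (Q l (yn - yh)))\<^sup>2) - (\<Sum>l=1..n. 1 / 2 * (1 / \<sigma> l) * (norm (Q l (y - yh)))\<^sup>2)
      + (\<Sum>l=1..n. 1 / (2 * \<sigma> l) * (norm (Q l (yn - y)))\<^sup>2)"
    by (simp add: distrib_left right_diff_distrib sum.distrib sum_subtractf)
  have e3: "(\<Sum>j=1..m. 1 / (2 * pr j) * (1 / \<tau> j + 2 * gamGt j) * (norm (P j (xn - xh)))\<^sup>2)
    = (\<Sum>j=1..m. 1 / (2 * pr j) * (1 / \<tau> j) * (norm (P j (xn - xh)))\<^sup>2) + (\<Sum>j=1..m. gamGt j / pr j * (norm (P j (xn - xh)))\<^sup>2)"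
    by (simp add: distrib_left distrib_right sum.distrib add_divide_distrib)
  have e4: "(\<Sum>l=1..n. 1 / 2 * (1 / \<sigma> l + 2 * gamFb l) * (norm (Q l (yn - yh)))\<^sup>2)
    = (\<Sum>l=1..n. 1 / 2 * (1 / \<sigma> l) * (norm (Q l (yn - yh)))\<^sup>2) + (\<Sum>l=1..n. gamFb l * (norm (Q l (yn - yh)))\<^sup>2)"
    by (simp add: distrib_left distrib_right sum.distrib add_divide_distrib)
  have e5: "(\<Sum>j=1..m. 1 / pr j * (indicator S j * (dK x (P j (x - xh)) \<bullet> (y - yh))))
    = (\<Sum>j\<in>S. 1 / pr j * (dK x (P j (x - xh)) \<bullet> (y - yh)))"
    using S by (intro sum.mono_neutral_cong_right) (auto simp: indicator_def)
  have e6: "Lbar / 2 * incr = L3 / 2 * incr + L / 2 * ((MAX j\<in>{1..m}. (1 / pr j + 1)\<^sup>2) * (\<Sum>l=1..n. \<rho> l)) * incr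
      + L / 2 * (real n * L / (2 * \<alpha>) * \<rho>x\<^sup>2) * incr"
    unfolding Lbar by (simp only: add_divide_distrib distrib_left distrib_right mult.assoc) (simp add: mult.assoc)
  have e7: "(\<theta> - young_const) * norm err powr p = \<theta> * norm err powr p - young_const * norm err powr p"
    by (rule left_diff_distrib)
  \<comment> \<open>Each variable stands for one of the sums or products above, so the assembly is
    plain linear arithmetic. \<open>D1\<close> is the budget of squared primal increments,
    \<open>V\<close> that of the dual ones.\<close>
  have combine: "(A1 + Gt) + (B1 + Fb) - Bn + (T - Y) + Gi + X \<le> A0 + B0"
    if "(A1 - A0 + D1) + G + (B1 - B0 + V) + Fs + T - L3t + C1 - C2 \<le> 0"
      "C1 - C2 = X - W - Bn + Lt + Et - Rt" "- Sa - Nt \<le> Lt" "Rt \<le> Mt" "- Sz - Y \<le> Et"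
      "Fb \<le> Fs - Sa - Sz" "W \<le> dW + V" "Cs + Lb + dW \<le> D1" "Lb = L3t + Mt + Nt" "Gt + Gi \<le> G + Cs"
    for A0 A1 B0 B1 D1 G Gt Gi Fs Fb T Y V W dW L3t Mt Nt Lb C1 C2 X Bn Lt Et Rt Sa Sz Cs :: real
    using that by linarith
  show ?thesis unfolding e3 e4 e5 e7
    by (rule combine[OF energy_inequality[unfolded e1 e2] coupling_identity lipschitz_term_bound
          remainder_term_bound error_term_bound dual_monotonicity_bound increment_coupling_bound
          increment_absorption e6 acceleration_sum])
qed

end

section \<open>Proximal steps and monotonicity\<close>

text \<open>The auxiliary point takes the blocks in \<open>J\<close> from the new iterate and the
  others from \<open>uh\<close>, where \<open>qh\<close> is kept as subgradient. In this way
  monotonicity at \<open>uh\<close>, stated for the whole sum, can be used on any set of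
  blocks.\<close>

lemma prox_step_subgradient:
  fixes g :: "nat \<Rightarrow> 'a::{real_inner, complete_space} \<Rightarrow> ereal"
  assumes P: "block_decomposition m P" and g: "\<And>j. j \<in> {1..m} \<Longrightarrow> proper_convex_lsc (g j)"
    and qh: "qh \<in> subdiff (block_sum m P g) uh" and J: "J \<subseteq> {1..m}"
    and t: "\<And>j. j \<in> J \<Longrightarrow> 0 < t j"
    and step: "\<And>j. j \<in> J \<Longrightarrow> P j u = prox (range (P j)) (g j) (t j) (P j (v j))"
  shows "qh + (\<Sum>j\<in>J. P j ((1 / t j) *\<^sub>R (v j - u) - qh))
    \<in> subdiff (block_sum m P g) (uh + (\<Sum>j\<in>J. P j (u - uh)))" (is "?q \<in> subdiff _ ?u")
proof -
  have g': "\<And>j z. j \<in> {1..m} \<Longrightarrow> g j z \<noteq> -\<infinity>" using g proper_convex_lscD(1) by blast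
  have iff: "q \<in> subdiff (block_sum m P g) u \<longleftrightarrow> (\<forall>j\<in>{1..m}. block_subgradient (P j) (g j) q u)" for q u
    using P g' by (rule subdiff_block_sum_iff)
  have sub: "block_subgradient (P j) (g j) qh uh" if "j \<in> {1..m}" for j
    using qh that unfolding iff by simp
  have "block_subgradient (P j) (g j) ?q ?u" if j: "j \<in> {1..m}" for j
  proof (cases "j \<in> J")
    case True
    have "block_subgradient (P j) (g j) ((1 / t j) *\<^sub>R (v j - u)) u"
      by (rule prox_block_subgradient[OF P j g[OF j] sub[OF j] t[OF True] step[OF True]])
    moreover have "P j ?q = P j ((1 / t j) *\<^sub>R (v j - u))" "P j ?u = P j u"
      using block_apply_sum[OF P J j, of "\<lambda>_. 1" "\<lambda>j. (1 / t j) *\<^sub>R (v j - u) - qh"]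
        block_apply_sum[OF P J j, of "\<lambda>_. 1" "\<lambda>j. u - uh"] True
      by (simp_all add: blinfun.add_right blinfun.diff_right)
    ultimately show ?thesis by (simp add: block_subgradient_def)
  next
    case False
    have "P j ?q = P j qh" "P j ?u = P j uh"
      using block_apply_sum[OF P J j, of "\<lambda>_. 1" "\<lambda>j. (1 / t j) *\<^sub>R (v j - u) - qh"]
        block_apply_sum[OF P J j, of "\<lambda>_. 1" "\<lambda>j. u - uh"] False
      by (simp_all add: blinfun.add_right)
    then show ?thesis using sub[OF j] by (simp add: block_subgradient_def)
  qed
  then show ?thesis unfolding iff by simp
qed

lemma prox_step_monotone:
  fixes g :: "nat \<Rightarrow> 'a::{real_inner, complete_space} \<Rightarrow> ereal"
  assumes P: "block_decomposition m P" and g: "\<And>j. j \<in> {1..m} \<Longrightarrow> proper_convex_lsc (g j)"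
    and qh: "qh \<in> subdiff (block_sum m P g) uh" and J: "J \<subseteq> {1..m}"
    and t: "\<And>j. j \<in> J \<Longrightarrow> 0 < t j"
    and step: "\<And>j. j \<in> J \<Longrightarrow> P j u = prox (range (P j)) (g j) (t j) (P j (v j))"
    and mono: "monotonicity_property m P (block_sum m P g) uh U gam"
    and U: "uh + (\<Sum>j\<in>J. P j (u - uh)) \<in> U"
  shows "(\<Sum>j\<in>J. gam j * (norm (P j (u - uh)))\<^sup>2)
    \<le> (\<Sum>j\<in>J. ((1 / t j) *\<^sub>R (v j - u) - qh) \<bullet> P j (u - uh))"
proof -
  let ?q = "\<Sum>j\<in>J. P j ((1 / t j) *\<^sub>R (v j - u) - qh)" and ?u = "\<Sum>j\<in>J. P j (u - uh)"
  have "qh + ?q \<in> subdiff (block_sum m P g) (uh + ?u)"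
    by (rule prox_step_subgradient[OF P g qh J t step])
  then have "(\<Sum>j=1..m. gam j * (norm (P j ((uh + ?u) - uh)))\<^sup>2) \<le> ((qh + ?q) - qh) \<bullet> ((uh + ?u) - uh)"
    using mono qh U unfolding monotonicity_property_def by blast
  then have main: "(\<Sum>j=1..m. gam j * (norm (P j ?u))\<^sup>2) \<le> ?q \<bullet> ?u" by simp
  have Pu: "P j ?u = (if j \<in> J then P j (u - uh) else 0)" if "j \<in> {1..m}" for j
    using block_apply_sum[OF P J that, of "\<lambda>_. 1" "\<lambda>_. u - uh"] by simp
  have "(\<Sum>j=1..m. gam j * (norm (P j ?u))\<^sup>2) = (\<Sum>j=1..m. if j \<in> J then gam j * (norm (P j (u - uh)))\<^sup>2 else 0)"
    using Pu by (intro sum.cong refl) simp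
  then have 1: "(\<Sum>j=1..m. gam j * (norm (P j ?u))\<^sup>2) = (\<Sum>j\<in>J. gam j * (norm (P j (u - uh)))\<^sup>2)"
    using J by (simp only: sum.inter_restrict[symmetric] finite_atLeastAtMost Int_absorb1)
  have "?q \<bullet> ?u = (\<Sum>j\<in>J. ((1 / t j) *\<^sub>R (v j - u) - qh) \<bullet> P j (u - uh))"
    unfolding inner_sum_left
  proof (rule sum.cong[OF refl])
    fix j assume jJ: "j \<in> J"
    then have j: "j \<in> {1..m}" using J by blast
    show "P j ((1 / t j) *\<^sub>R (v j - u) - qh) \<bullet> ?u = ((1 / t j) *\<^sub>R (v j - u) - qh) \<bullet> P j (u - uh)"
      unfolding block_decompositionD(3)[OF P j] using Pu[OF j] jJ by simp
  qed
  then show ?thesis using main 1 by simp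
qed

text \<open>The case \<open>J = {j}\<close>: the primal tests carry different weights 1 /
  \<open>pr j\<close>, so the inequality is wanted for each block separately.\<close>

lemma primal_step_monotone:
  fixes g :: "nat \<Rightarrow> 'a::{real_inner, complete_space} \<Rightarrow> ereal"
  assumes P: "block_decomposition m P" and g: "\<And>j. j \<in> {1..m} \<Longrightarrow> proper_convex_lsc (g j)"
    and qh: "- zh \<in> subdiff (block_sum m P g) uh" and j: "j \<in> {1..m}" and t: "0 < t"
    and step: "P j u' = prox (range (P j)) (g j) t (P j u - t *\<^sub>R P j z)"
    and mono: "monotonicity_property m P (block_sum m P g) uh U gam"
    and U: "uh + P j (u' - uh) \<in> U"
  shows "gam j * (norm (P j (u' - uh)))\<^sup>2 \<le> 1 / t * ((u - u') \<bullet> P j (u' - uh)) - (z - zh) \<bullet> P j (u' - uh)"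
proof -
  have "(\<Sum>j\<in>{j}. gam j * (norm (P j (u' - uh)))\<^sup>2)
    \<le> (\<Sum>j\<in>{j}. ((1 / t) *\<^sub>R ((u - t *\<^sub>R z) - u') - (- zh)) \<bullet> P j (u' - uh))"
    by (rule prox_step_monotone[OF P g qh _ _ _ mono])
      (use j t step U in \<open>auto simp: blinfun.diff_right blinfun.scaleR_right\<close>)
  also have "\<dots> = 1 / t * ((u - u') \<bullet> P j (u' - uh)) - (z - zh) \<bullet> P j (u' - uh)"
  proof -
    have "(1 / t) *\<^sub>R ((u - t *\<^sub>R z) - u') - (- zh) = (1 / t) *\<^sub>R (u - u') - (z - zh)"
      using t by (simp add: algebra_simps)
    then show ?thesis by (simp only: sum.insert sum.empty finite.emptyI empty_iff not_False_eq_True inner_diff_left[of "_ *\<^sub>R _"] inner_scaleR_left add_0_right)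
  qed
  finally show ?thesis by simp
qed

text \<open>The case of all blocks, in which the auxiliary point is the new iterate itself.\<close>

lemma dual_step_monotone:
  fixes g :: "nat \<Rightarrow> 'a::{real_inner, complete_space} \<Rightarrow> ereal"
  assumes P: "block_decomposition m P" and g: "\<And>j. j \<in> {1..m} \<Longrightarrow> proper_convex_lsc (g j)"
    and qh: "zh \<in> subdiff (block_sum m P g) uh" and t: "\<And>j. j \<in> {1..m} \<Longrightarrow> 0 < t j"
    and step: "\<And>j. j \<in> {1..m} \<Longrightarrow> P j u' = prox (range (P j)) (g j) (t j) (P j u + t j *\<^sub>R P j z)"
    and mono: "monotonicity_property m P (block_sum m P g) uh U gam"
    and U: "u' \<in> U"
  shows "(\<Sum>j=1..m. gam j * (norm (P j (u' - uh)))\<^sup>2)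
    \<le> (\<Sum>j=1..m. 1 / t j * ((u - u') \<bullet> P j (u' - uh))) + (z - zh) \<bullet> (u' - uh)"
proof -
  have "(\<Sum>j\<in>{1..m}. gam j * (norm (P j (u' - uh)))\<^sup>2)
    \<le> (\<Sum>j\<in>{1..m}. ((1 / t j) *\<^sub>R ((u + t j *\<^sub>R z) - u') - zh) \<bullet> P j (u' - uh))"
  proof (rule prox_step_monotone[OF P g qh order.refl t _ mono])
    show "P j u' = prox (range (P j)) (g j) (t j) (P j (u + t j *\<^sub>R z))" if "j \<in> {1..m}" for j
      using step[OF that] by (simp add: blinfun.add_right blinfun.scaleR_right)
    show "uh + (\<Sum>j\<in>{1..m}. P j (u' - uh)) \<in> U"
      using U by (simp add: block_decompositionD(4)[OF P] del: One_nat_def)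
  qed
  also have "\<dots> = (\<Sum>j=1..m. 1 / t j * ((u - u') \<bullet> P j (u' - uh)) + (z - zh) \<bullet> P j (u' - uh))"
  proof (rule sum.cong[OF refl])
    fix j assume "j \<in> {1..m}"
    then have "(1 / t j) *\<^sub>R ((u + t j *\<^sub>R z) - u') - zh = (1 / t j) *\<^sub>R (u - u') + (z - zh)"
      using t[of j] by (simp add: algebra_simps)
    then show "((1 / t j) *\<^sub>R ((u + t j *\<^sub>R z) - u') - zh) \<bullet> P j (u' - uh)
      = 1 / t j * ((u - u') \<bullet> P j (u' - uh)) + (z - zh) \<bullet> P j (u' - uh)"
      by (simp only: inner_add_left[of "_ *\<^sub>R _"] inner_scaleR_left)
  qed
  also have "\<dots> = (\<Sum>j=1..m. 1 / t j * ((u - u') \<bullet> P j (u' - uh))) + (z - zh) \<bullet> (u' - uh)"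
    unfolding sum.distrib inner_sum_right[symmetric] by (simp only: block_decompositionD(4)[OF P])
  finally show ?thesis .
qed

text \<open>The operator \<open>A\<close> is given the coefficients 1 / \<open>pr j\<close> on the
  selected blocks and 0 elsewhere, to match the weights of the primal tests.\<close>

lemma three_point_blocks:
  assumes P: "block_decomposition m P" and S: "S \<subseteq> {1..m}"
    and pr: "\<And>j. j \<in> {1..m} \<Longrightarrow> 0 < pr j"
    and tp: "three_point_property m P K dK xh yh XK gamK \<theta> p L3"
    and XK: "x \<in> XK" "x' \<in> XK"
  shows "(\<Sum>j\<in>S. gamK j / pr j * (norm (P j (x' - xh)))\<^sup>2)
        + \<theta> (\<Sum>j\<in>S. (1 / pr j) *\<^sub>R P j) * norm (K xh - K x - dK x (xh - x)) powr p
        - L3 / 2 * (\<Sum>j\<in>S. 1 / pr j * (norm (P j (x' - x)))\<^sup>2)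
      \<le> (\<Sum>j\<in>S. 1 / pr j * (adjoint (dK x - dK xh) yh \<bullet> P j (x' - xh)))"
proof -
  define a where "a j = (if j \<in> S then 1 / pr j else 0)" for j
  define A where "A = (\<Sum>j\<in>S. (1 / pr j) *\<^sub>R P j)"
  define \<Gamma> where "\<Gamma> = (\<Sum>j=1..m. gamK j *\<^sub>R P j)"
  have A: "(\<Sum>j=1..m. a j *\<^sub>R P j) = A"
    unfolding A_def a_def using S by (intro sum.mono_neutral_cong_right) auto
  have a: "\<forall>j\<in>{1..m}. 0 \<le> a j" using pr by (auto simp: a_def intro: less_imp_le)
  note spec = tp[unfolded three_point_property_def Let_def, THEN spec, THEN mp, OF a, unfolded A, folded \<Gamma>_def]
  have tp: "A (adjoint (dK x - dK xh) yh) \<bullet> (x' - xh)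
      \<ge> (A o\<^sub>L \<Gamma>) (x' - xh) \<bullet> (x' - xh) + \<theta> A * norm (K xh - K x - dK x (xh - x)) powr p
        - L3 / 2 * (A (x' - x) \<bullet> (x' - x))"
    using spec[THEN conjunct2, THEN bspec, OF XK(1), THEN bspec, OF XK(2)] .
  have A_inner: "A u \<bullet> v = (\<Sum>j\<in>S. 1 / pr j * (u \<bullet> P j v))" for u v
    unfolding A_def blinfun.sum_left inner_sum_left blinfun.scaleR_left inner_scaleR_left
    by (intro sum.cong refl) (use S block_decompositionD(3)[OF P] in auto)
  have sq: "u \<bullet> P j u = (norm (P j u))\<^sup>2" if "j \<in> S" for j u
    using block_inner_block[OF P, of j u u] that S by (auto simp: power2_norm_eq_inner inner_commute)
  have Gam: "\<Gamma> u \<bullet> P j u = gamK j * (norm (P j u))\<^sup>2" if "j \<in> S" for j u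
  proof -
    have j: "j \<in> {1..m}" using that S by blast
    have "\<Gamma> u = (\<Sum>j\<in>{1..m}. gamK j *\<^sub>R P j u)"
      by (simp add: \<Gamma>_def blinfun.sum_left blinfun.scaleR_left)
    then have "P j (\<Gamma> u) = gamK j *\<^sub>R P j u"
      using block_apply_sum[OF P order.refl j, of gamK "\<lambda>_. u"] j by simp
    then show ?thesis using block_decompositionD(3)[OF P j, of "\<Gamma> u" u] sq[OF that, of u]
      by (simp add: inner_commute)
  qed
  have "(A o\<^sub>L \<Gamma>) (x' - xh) \<bullet> (x' - xh) = (\<Sum>j\<in>S. gamK j / pr j * (norm (P j (x' - xh)))\<^sup>2)"
    unfolding blinfun_apply_blinfun_compose A_inner by (rule sum.cong) (simp_all add: Gam)
  moreover have "A (x' - x) \<bullet> (x' - x) = (\<Sum>j\<in>S. 1 / pr j * (norm (P j (x' - x)))\<^sup>2)"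
    unfolding A_inner by (rule sum.cong) (simp_all add: sq)
  ultimately show "(\<Sum>j\<in>S. gamK j / pr j * (norm (P j (x' - xh)))\<^sup>2)
        + \<theta> (\<Sum>j\<in>S. (1 / pr j) *\<^sub>R P j) * norm (K xh - K x - dK x (xh - x)) powr p
        - L3 / 2 * (\<Sum>j\<in>S. 1 / pr j * (norm (P j (x' - x)))\<^sup>2)
      \<le> (\<Sum>j\<in>S. 1 / pr j * (adjoint (dK x - dK xh) yh \<bullet> P j (x' - xh)))"
    using tp unfolding A_inner[of "adjoint _ _"] A_def[symmetric] by simp
qed

section \<open>Expected descent and convergence rate\<close>

lemma simple_function_on_subalgebra:
  assumes "subalgebra M F" "simple_function F f"
  shows "simple_function M f"
  using assms unfolding subalgebra_def simple_function_def by auto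

lemma simple_function_finite_range:
  assumes "S \<in> measurable M (count_space A)" "finite A"
  shows "simple_function M S"
  unfolding simple_function_def
proof (intro conjI ballI)
  have "S ` space M \<subseteq> A" using measurable_space[OF assms(1)] by auto
  then show "finite (S ` space M)" using assms(2) by (rule finite_subset)
  fix s assume "s \<in> S ` space M"
  then have "s \<in> A" using measurable_space[OF assms(1)] by auto
  then show "S -` {s} \<inter> space M \<in> sets M" using assms(1) by (intro measurable_sets) auto
qed

lemma (in finite_measure) integrable_simple_function_real:
  fixes f :: "'a \<Rightarrow> real"
  assumes "simple_function M f"
  shows "integrable M f"
proof -
  have "finite (f ` space M)" using assms by (rule simple_functionD)
  then have "\<bar>f x\<bar> \<le> Max ((\<lambda>y. \<bar>y\<bar>) ` f ` space M)" if "x \<in> space M" for x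
    using that by (intro Max_ge) auto
  then show ?thesis
    by (intro integrable_const_bound[where B = "Max ((\<lambda>y. \<bar>y\<bar>) ` f ` space M)"] AE_I2)
      (auto intro: borel_measurable_simple_function assms)
qed

context prob_space
begin

lemma integral_mult_cond_exp:
  fixes f g :: "'a \<Rightarrow> real"
  assumes F: "subalgebra M F" and f: "simple_function F f" and g: "simple_function M g"
  shows "(\<integral>\<omega>. f \<omega> * real_cond_exp M F g \<omega> \<partial>M) = (\<integral>\<omega>. f \<omega> * g \<omega> \<partial>M)"
    and "integrable M (\<lambda>\<omega>. f \<omega> * real_cond_exp M F g \<omega>)"
proof -
  interpret finite_measure_subalgebra M F by unfold_locales (rule F)
  have "integrable M (\<lambda>\<omega>. f \<omega> * g \<omega>)"
    by (intro integrable_simple_function_real simple_function_compose2[OF simple_function_on_subalgebra[OF F f] g])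
  then show "(\<integral>\<omega>. f \<omega> * real_cond_exp M F g \<omega> \<partial>M) = (\<integral>\<omega>. f \<omega> * g \<omega> \<partial>M)"
    "integrable M (\<lambda>\<omega>. f \<omega> * real_cond_exp M F g \<omega>)"
    using f g by (auto intro!: real_cond_exp_intg borel_measurable_simple_function)
qed

lemma integral_mult_cond_prob:
  fixes f :: "'a \<Rightarrow> real"
  assumes F: "subalgebra M F" and f: "simple_function F f" and A: "A \<in> sets M"
    and c: "AE \<omega> in M. real_cond_exp M F (indicator A) \<omega> = c"
  shows "(\<integral>\<omega>. f \<omega> * indicator A \<omega> \<partial>M) = c * (\<integral>\<omega>. f \<omega> \<partial>M)"
proof -
  have ind: "simple_function M (indicator A :: 'a \<Rightarrow> real)" using A by (rule simple_function_indicator)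
  have fM: "f \<in> borel_measurable M"
    by (intro borel_measurable_simple_function simple_function_on_subalgebra[OF F f])
  have "(\<integral>\<omega>. f \<omega> * indicator A \<omega> \<partial>M) = (\<integral>\<omega>. f \<omega> * real_cond_exp M F (indicator A) \<omega> \<partial>M)"
    by (rule integral_mult_cond_exp(1)[OF F f ind, symmetric])
  also have "\<dots> = (\<integral>\<omega>. f \<omega> * c \<partial>M)"
    using fM c by (intro integral_cong_AE) auto
  finally show ?thesis by (simp add: mult.commute)
qed

lemma cond_prob_one_AE:
  assumes F: "subalgebra M F" and A: "A \<in> sets M"
    and c: "AE \<omega> in M. real_cond_exp M F (indicator A) \<omega> = (1::real)"
  shows "AE \<omega> in M. \<omega> \<in> A"
proof -
  have "prob A = 1"
    using integral_mult_cond_prob[OF F simple_function_const[of F "1::real"] A c] A by (simp add: prob_space)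
  then show ?thesis using prob_eq_1[OF A] by simp
qed

lemma integral_mult_cond_exp_ge:
  fixes f g :: "'a \<Rightarrow> real"
  assumes F: "subalgebra M F" and f: "simple_function F f" and g: "simple_function M g"
    and nonneg: "\<And>\<omega>. 0 \<le> f \<omega>" and c: "AE \<omega> in M. c \<le> real_cond_exp M F g \<omega>"
  shows "c * (\<integral>\<omega>. f \<omega> \<partial>M) \<le> (\<integral>\<omega>. g \<omega> * f \<omega> \<partial>M)"
proof -
  have "integrable M f" by (intro integrable_simple_function_real simple_function_on_subalgebra[OF F f])
  then have "(\<integral>\<omega>. f \<omega> * c \<partial>M) \<le> (\<integral>\<omega>. f \<omega> * real_cond_exp M F g \<omega> \<partial>M)"
    by (intro integral_mono_AE integral_mult_cond_exp(2)[OF F f g])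
      (use c nonneg in \<open>auto elim!: eventually_mono intro: mult_left_mono\<close>)
  then show ?thesis unfolding integral_mult_cond_exp(1)[OF F f g] by (simp add: mult.commute)
qed

end

section \<open>Rates and the step length recursion\<close>

lemma rate_inverse_linear:
  fixes a :: "nat \<Rightarrow> real"
  assumes a: "\<And>N. 0 \<le> a N" "\<And>N. a N * (real N * g) \<le> C" and g: "0 < g"
  shows "a \<longlonglongrightarrow> 0" "a \<in> O(\<lambda>N. 1 / real N)"
proof -
  have le: "a N \<le> C / g * (1 / real N)" if "0 < N" for N
    using a(2)[of N] that g by (simp add: field_simps)
  show "a \<in> O(\<lambda>N. 1 / real N)"
  proof (rule bigoI)
    show "eventually (\<lambda>N. norm (a N) \<le> C / g * norm (1 / real N)) at_top"
      using eventually_gt_at_top[of 0] by eventually_elim (use le a(1) in auto)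
  qed
  have "(\<lambda>N. C / g * (1 / real N)) \<longlonglongrightarrow> C / g * 0"
    by (intro tendsto_intros lim_1_over_n)
  then have lim: "(\<lambda>N. C / g * (1 / real N)) \<longlonglongrightarrow> 0" by simp
  show "a \<longlonglongrightarrow> 0"
  proof (rule tendsto_sandwich[OF _ _ tendsto_const lim])
    show "eventually (\<lambda>N. 0 \<le> a N) sequentially" by (intro always_eventually allI a(1))
    show "eventually (\<lambda>N. a N \<le> C / g * (1 / real N)) sequentially"
      using eventually_gt_at_top[of "0::nat"] by eventually_elim (rule le)
  qed
qed

text \<open>Passing to reciprocals turns the recursion into an arithmetic progression with
  difference \<open>2 * g\<close>.\<close>

lemma inverse_step_length:
  fixes t :: "nat \<Rightarrow> real"
  assumes t0: "0 < t 0" and g: "0 \<le> g" and rec: "\<And>i. t (Suc i) = t i / (1 + 2 * t i * g)"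
  shows "0 < t i" "t i \<le> t 0" "1 / t (Suc i) = 1 / t i + 2 * g" "1 / t i = 1 / t 0 + 2 * real i * g"
proof -
  have pos: "0 < t i" for i
    by (induction i) (use t0 g in \<open>auto simp: rec intro!: divide_pos_pos add_pos_nonneg\<close>)
  show "0 < t i" by (rule pos)
  have dec: "t (Suc i) \<le> t i" for i
    unfolding rec using pos[of i] g by (simp add: divide_le_eq_1 pos_divide_le_eq add_pos_nonneg mult_le_cancel_left1)
  show "t i \<le> t 0" by (induction i) (use dec order_trans in auto)
  show inv: "1 / t (Suc i) = 1 / t i + 2 * g" for i
    unfolding rec using pos[of i] g by (simp add: field_simps)
  show "1 / t i = 1 / t 0 + 2 * real i * g"
    by (induction i) (simp_all add: inv algebra_simps)
qed

theorem theorem4p4: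
  fixes K :: "'x::{real_inner, complete_space} \<Rightarrow> 'y::{real_inner, complete_space}"
    and dK :: "'x \<Rightarrow> 'x \<Rightarrow>\<^sub>L 'y"
    and P :: "nat \<Rightarrow> 'x \<Rightarrow>\<^sub>L 'x" and Q :: "nat \<Rightarrow> 'y \<Rightarrow>\<^sub>L 'y"
    and G :: "nat \<Rightarrow> 'x \<Rightarrow> ereal" and F :: "nat \<Rightarrow> 'y \<Rightarrow> ereal"
    and m n :: nat
    and xh x0 :: 'x and yh y0 :: 'y
    and XK XG :: "'x set" and YF :: "'y set"
    and \<theta> :: "('x \<Rightarrow>\<^sub>L 'x) \<Rightarrow> real"
    and gamK gamG gamGt pr c :: "nat \<Rightarrow> real"
    and gamF gamFb \<zeta> \<rho> :: "nat \<Rightarrow> real"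
    and L L3 Lbar p \<alpha> \<delta> \<kappa> \<rho>x :: real
    and w :: "nat \<Rightarrow> nat \<Rightarrow> nat \<Rightarrow> real"
    and \<tau> \<sigma> :: "nat \<Rightarrow> nat \<Rightarrow> real"
    and M :: "'w measure"
    and Fil :: "nat \<Rightarrow> 'w measure"  (* Fil i is the sigma-algebra with index i - 1 *)
    and S :: "nat \<Rightarrow> 'w \<Rightarrow> nat set"
    and x xbar :: "nat \<Rightarrow> 'w \<Rightarrow> 'x" and y :: "nat \<Rightarrow> 'w \<Rightarrow> 'y"
  assumes mn: "1 \<le> m" "1 \<le> n"
    and blocks: "block_decomposition m P" "block_decomposition n Q"
    and K_C1: "\<And>v. (K has_derivative dK v) (at v)" "continuous_on UNIV dK"
    and G: "\<And>j. j \<in> {1..m} \<Longrightarrow> proper_convex_lsc (G j)"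
    and F: "\<And>l. l \<in> {1..n} \<Longrightarrow> proper_convex_lsc (F l)"
    and critical:
      "- adjoint (dK xh) yh \<in> subdiff (block_sum m P G) xh"
      "K xh \<in> subdiff (block_sum n Q (\<lambda>l. fenchel_conj (F l))) yh"
    and neighbourhoods: "xh \<in> interior XK" "xh \<in> interior XG" "yh \<in> interior YF"
    and Lipschitz: "0 \<le> L" "lipschitz_property dK XK L"
    and three_point: "0 \<le> L3" "1 \<le> p" "p \<le> 2"
      "three_point_property m P K dK xh yh XK gamK \<theta> p L3"
    and monotone:
      "\<And>j. j \<in> {1..m} \<Longrightarrow> 0 \<le> gamG j"
      "\<And>l. l \<in> {1..n} \<Longrightarrow> 0 \<le> gamF l"
      "monotonicity_property m P (block_sum m P G) xh XG gamG"
      "monotonicity_property n Q (block_sum n Q (\<lambda>l. fenchel_conj (F l))) yh YF gamF"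
    and gamGK: "\<And>j. j \<in> {1..m} \<Longrightarrow> 0 \<le> gamG j + gamK j"
    and \<alpha>_\<zeta>: "0 < \<alpha>"
      "\<And>l. l \<in> {1..n} \<Longrightarrow> 0 \<le> \<zeta> l"
      "\<And>l. l \<in> {1..n} \<Longrightarrow> 1 < p \<Longrightarrow> 0 < \<zeta> l"
    and gamFb:
      "\<And>l. l \<in> {1..n} \<Longrightarrow>
         gamFb l = (if (\<forall>v. Q l (P_NL K v) = 0) then gamF l
                    else gamF l - (p - 1) * \<zeta> l - \<alpha>)"
      "\<And>l. l \<in> {1..n} \<Longrightarrow> 0 \<le> gamFb l"
    and gamGt:
      "\<And>j. j \<in> {1..m} \<Longrightarrow>
         (0 \<le> gamGt j \<and> gamGt j < pr j * (gamG j + gamK j)) \<or>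
         (gamGt j = gamG j + gamK j \<and> gamG j + gamK j = 0)"
    and prob: "prob_space M"
    and filtration:
      "\<And>i. subalgebra M (Fil i)" "\<And>i. subalgebra (Fil (Suc i)) (Fil i)"
    and S_meas: "\<And>i. S i \<in> measurable (Fil (Suc i)) (count_space (Pow {1..m}))"
    and pr:
      "\<And>j. j \<in> {1..m} \<Longrightarrow> 0 < pr j"
      "\<And>i j. j \<in> {1..m} \<Longrightarrow>
         AE \<omega> in M. real_cond_exp M (Fil i) (indicator {\<omega>\<in>space M. j \<in> S i \<omega>}) \<omega> = pr j"
    and algorithm:
      "\<And>\<omega>. \<omega> \<in> space M \<Longrightarrow>
         block_pdps m n P Q G F K dK pr \<tau> \<sigma> (\<lambda>i. 1) x0 y0
           (\<lambda>i. S i \<omega>) (\<lambda>i. x i \<omega>) (\<lambda>i. xbar i \<omega>) (\<lambda>i. y i \<omega>)"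
    and steps:
      "\<And>j. j \<in> {1..m} \<Longrightarrow> 0 < \<tau> 0 j"
      "\<And>l. l \<in> {1..n} \<Longrightarrow> 0 < \<sigma> 0 l"
      "\<And>i j. j \<in> {1..m} \<Longrightarrow> \<tau> (Suc i) j = \<tau> i j / (1 + 2 * \<tau> i j * gamGt j)"
      "\<And>i l. l \<in> {1..n} \<Longrightarrow> \<sigma> (Suc i) l = \<sigma> i l / (1 + 2 * \<sigma> i l * gamFb l)"
    and local:
      "\<And>i. AE \<omega> in M. iterates_local P xh XK XG YF (S i \<omega>)
              (x i \<omega>) (xbar (Suc i) \<omega>) (x (Suc i) \<omega>) (y (Suc i) \<omega>)"
    and w:
      "\<And>j l k. j \<in> {1..m} \<Longrightarrow> l \<in> {1..n} \<Longrightarrow> k \<in> {1..n} \<Longrightarrow>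
         0 < w j l k \<and> w j l k = 1 / w j k l"
    and constants: "0 < \<delta>" "\<delta> < \<kappa>" "\<kappa> < 1" "0 \<le> \<rho>x" "\<And>l. l \<in> {1..n} \<Longrightarrow> 0 \<le> \<rho> l"
    and c: "\<And>j. j \<in> {1..m} \<Longrightarrow>
         c j = (if gamG j + gamK j > 0
                then 2 * (1 - pr j) * (gamG j + gamK j)
                     * ((gamG j + gamK j - gamGt j) / (pr j * (gamG j + gamK j) - gamGt j))
                else 0)"
    and Lbar: "Lbar = L3 + L * ((MAX j\<in>{1..m}. (1 / pr j + 1)\<^sup>2) * (\<Sum>l=1..n. \<rho> l)
                               + real n * L / (2 * \<alpha>) * \<rho>x\<^sup>2)"
    and step_cond_\<kappa>:
      "\<And>i l. l \<in> {1..n} \<Longrightarrow>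
         AE \<omega> in M. 1 - \<kappa> \<ge>
           (norm (\<Sum>j\<in>S i \<omega>.
              sqrt (block_weight n P Q w (dK (x i \<omega>)) (S i \<omega>) j l * \<sigma> 0 l * \<tau> 0 j / pr j)
                *\<^sub>R (Q l o\<^sub>L dK (x i \<omega>) o\<^sub>L P j)))\<^sup>2"
    and step_cond_\<delta>: "\<And>j. j \<in> {1..m} \<Longrightarrow> \<delta> \<ge> \<tau> 0 j * Lbar + \<tau> 0 j * c j"
    and \<theta>_cond:
      "\<And>i. AE \<omega> in M.
         real_cond_exp M (Fil i) (\<lambda>\<omega>. \<theta> (\<Sum>j\<in>S i \<omega>. (1 / pr j) *\<^sub>R P j)) \<omega>
         \<ge> p powr (- p) * (\<Sum>l=1..n. rpow (\<zeta> l) (1 - p) * rpow (\<rho> l) (2 - p))"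
    and bound_cond:
      "\<And>i. AE \<omega> in M.
         real_cond_exp M (Fil i)
           (indicator {\<omega>\<in>space M. norm (x (Suc i) \<omega> - xh) \<le> \<rho>x \<and>
              (\<forall>l\<in>{1..n}. psd_norm (P_NL K) (Q l (y (Suc i) \<omega> - yh)) \<le> \<rho> l)}) \<omega> = 1"
  shows
    "(\<forall>j\<in>{1..m}. gamGt j > 0 \<longrightarrow>
        (\<lambda>N. \<integral>\<omega>. (norm (P j (x N \<omega> - xh)))\<^sup>2 \<partial>M) \<longlonglongrightarrow> 0 \<and>
        (\<lambda>N. \<integral>\<omega>. (norm (P j (x N \<omega> - xh)))\<^sup>2 \<partial>M) \<in> O(\<lambda>N. 1 / real N)) \<and>
     (\<forall>l\<in>{1..n}. gamFb l > 0 \<longrightarrow>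
        (\<lambda>N. \<integral>\<omega>. (norm (Q l (y N \<omega> - yh)))\<^sup>2 \<partial>M) \<longlonglongrightarrow> 0 \<and>
        (\<lambda>N. \<integral>\<omega>. (norm (Q l (y N \<omega> - yh)))\<^sup>2 \<partial>M) \<in> O(\<lambda>N. 1 / real N))"
proof -
  interpret prob_space M by (rule prob)
  have spaceF: "space (Fil i) = space M" for i using filtration(1) by (simp add: subalgebra_def)

  \<comment> \<open>Splitting the dual criticality condition into blocks requires conjugates that
    are never -\<infinity>. In return it yields a point of finiteness for each conjugate, hence
    properness.\<close>
  have Fc_MInf: "fenchel_conj (F l) z \<noteq> -\<infinity>" if "l \<in> {1..n}" for l z
    by (rule fenchel_conj_not_MInf[OF F[OF that]])
  have "\<forall>l\<in>{1..n}. block_subgradient (Q l) (fenchel_conj (F l)) (K xh) yh"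
    using critical(2) subdiff_block_sum_iff[where g = "\<lambda>l. fenchel_conj (F l)", OF blocks(2) Fc_MInf] by blast
  then have Fc: "proper_convex_lsc (fenchel_conj (F l))" if "l \<in> {1..n}" for l
    using fenchel_conj_proper_convex_lsc[OF F[OF that]] that unfolding block_subgradient_def by blast

  have gamGt0: "0 \<le> gamGt j" if "j \<in> {1..m}" for j using gamGt[OF that] by auto
  have \<tau>_step: "0 < \<tau> i j" "\<tau> i j \<le> \<tau> 0 j" "1 / \<tau> (Suc i) j = 1 / \<tau> i j + 2 * gamGt j"
    "1 / \<tau> i j = 1 / \<tau> 0 j + 2 * real i * gamGt j" if "j \<in> {1..m}" for i j
    by (fact inverse_step_length[of "\<lambda>i. \<tau> i j" "gamGt j", OF steps(1)[OF that] gamGt0[OF that] steps(3)[OF that]])+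
  have \<sigma>_step: "0 < \<sigma> i l" "\<sigma> i l \<le> \<sigma> 0 l" "1 / \<sigma> (Suc i) l = 1 / \<sigma> i l + 2 * gamFb l"
    "1 / \<sigma> i l = 1 / \<sigma> 0 l + 2 * real i * gamFb l" if "l \<in> {1..n}" for i l
    by (fact inverse_step_length[of "\<lambda>i. \<sigma> i l" "gamFb l", OF steps(2)[OF that] gamFb(2)[OF that] steps(4)[OF that]])+

  have S_sub: "S i \<omega> \<subseteq> {1..m}" if "\<omega> \<in> space M" for i \<omega>
    using measurable_space[OF S_meas[of i], of \<omega>] that by (simp add: spaceF)

  have xbar_eq: "xbar (Suc i) \<omega> = x (Suc i) \<omega> + (\<Sum>j\<in>S i \<omega>. (1 / pr j) *\<^sub>R P j (x (Suc i) \<omega> - x i \<omega>))"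
    if \<omega>: "\<omega> \<in> space M" for i \<omega>
  proof (rule block_eqI[OF blocks(1)])
    fix j assume j: "j \<in> {1..m}"
    note upd = algorithm[OF \<omega>, unfolded block_pdps_def]
    show "P j (xbar (Suc i) \<omega>) = P j (x (Suc i) \<omega> + (\<Sum>j\<in>S i \<omega>. (1 / pr j) *\<^sub>R P j (x (Suc i) \<omega> - x i \<omega>)))"
    proof (cases "j \<in> S i \<omega>")
      case True
      then have "P j (xbar (Suc i) \<omega>) = P j (x (Suc i) \<omega>) + (1 / pr j) *\<^sub>R (P j (x (Suc i) \<omega>) - P j (x i \<omega>))"
        using upd j by metis
      then show ?thesis
        unfolding blinfun.add_right block_apply_sum[OF blocks(1) S_sub[OF \<omega>] j, of "\<lambda>j. 1 / pr j" "\<lambda>_. x (Suc i) \<omega> - x i \<omega>"]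
        using True by (simp add: blinfun.diff_right)
    next
      case False
      then have "P j (xbar (Suc i) \<omega>) = P j (x (Suc i) \<omega>)" using upd j by metis
      then show ?thesis
        unfolding blinfun.add_right block_apply_sum[OF blocks(1) S_sub[OF \<omega>] j, of "\<lambda>j. 1 / pr j" "\<lambda>_. x (Suc i) \<omega> - x i \<omega>"]
        using False by simp
    qed
  qed
  have x_upd: "P j (x (Suc i) \<omega>) = prox (range (P j)) (G j) (\<tau> i j) (P j (x i \<omega>) - \<tau> i j *\<^sub>R P j (adjoint (dK (x i \<omega>)) (y i \<omega>)))"
    if "\<omega> \<in> space M" "j \<in> {1..m}" "j \<in> S i \<omega>" for i j \<omega>
    using algorithm[OF that(1), unfolded block_pdps_def] that(2,3) by metis
  have x_keep: "P j (x (Suc i) \<omega>) = P j (x i \<omega>)"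
    if "\<omega> \<in> space M" "j \<in> {1..m}" "j \<notin> S i \<omega>" for i j \<omega>
    using algorithm[OF that(1), unfolded block_pdps_def] that(2,3) by metis
  have y_upd: "Q l (y (Suc i) \<omega>) = prox (range (Q l)) (fenchel_conj (F l)) (\<sigma> (Suc i) l)
      (Q l (y i \<omega>) + \<sigma> (Suc i) l *\<^sub>R Q l (K (xbar (Suc i) \<omega>)))"
    if "\<omega> \<in> space M" "l \<in> {1..n}" for i l \<omega>
    using algorithm[OF that(1), unfolded block_pdps_def] that(2) by blast

  have S_simple: "simple_function (Fil (Suc i)) (S i)" for i
    by (rule simple_function_finite_range[OF S_meas]) simp

  text \<open>The iterates are determined by the finitely many possible histories of selected blocks.\<close>
  have update: "\<exists>\<Phi>. \<forall>\<omega>\<in>space M. (x (Suc i) \<omega>, y (Suc i) \<omega>) = \<Phi> (x i \<omega>, y i \<omega>, S i \<omega>)" for i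
  proof -
    define X where "X u v s = (\<Sum>j=1..m. if j \<in> s
      then prox (range (P j)) (G j) (\<tau> i j) (P j u - \<tau> i j *\<^sub>R P j (adjoint (dK u) v)) else P j u)" for u v s
    define Y where "Y u v u' s = (\<Sum>l=1..n. prox (range (Q l)) (fenchel_conj (F l)) (\<sigma> (Suc i) l)
      (Q l v + \<sigma> (Suc i) l *\<^sub>R Q l (K (u' + (\<Sum>j\<in>s. (1 / pr j) *\<^sub>R P j (u' - u))))))" for u v u' s
    have "(\<Sum>j=1..m. P j (x (Suc i) \<omega>)) = X (x i \<omega>) (y i \<omega>) (S i \<omega>)" if "\<omega> \<in> space M" for \<omega>
      unfolding X_def using that x_upd x_keep by (intro sum.cong refl) auto
    then have "x (Suc i) \<omega> = X (x i \<omega>) (y i \<omega>) (S i \<omega>)" if "\<omega> \<in> space M" for \<omega>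
      using that by (simp only: block_decompositionD(4)[OF blocks(1)])
    moreover have "(\<Sum>l=1..n. Q l (y (Suc i) \<omega>)) = Y (x i \<omega>) (y i \<omega>) (x (Suc i) \<omega>) (S i \<omega>)" if "\<omega> \<in> space M" for \<omega>
      unfolding Y_def xbar_eq[OF that, symmetric] using that y_upd by (intro sum.cong refl) auto
    then have "y (Suc i) \<omega> = Y (x i \<omega>) (y i \<omega>) (x (Suc i) \<omega>) (S i \<omega>)" if "\<omega> \<in> space M" for \<omega>
      using that by (simp only: block_decompositionD(4)[OF blocks(2)])
    ultimately show ?thesis
      by (intro exI[of _ "\<lambda>(u, v, s). (X u v s, Y u v (X u v s) s)"]) auto
  qed
  \<comment> \<open>\<open>S i\<close> is known only at \<open>Fil (Suc i)\<close>, so iterate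
    \<open>i\<close> is already known at \<open>Fil i\<close>, on which the selection probabilities
    are conditioned. Simplicity makes every real quantity built from iterates and selections
    measurable and integrable, whatever the regularity of the proximal maps, of \<open>dK\<close>
    and of \<theta>.\<close>
  have sf: "simple_function (Fil i) (\<lambda>\<omega>. (x i \<omega>, y i \<omega>))" for i
  proof (induction i)
    case 0
    have "simple_function (Fil 0) (\<lambda>\<omega>. (x 0 \<omega>, y 0 \<omega>)) \<longleftrightarrow> simple_function (Fil 0) (\<lambda>_. (x0, y0))"
      by (rule simple_function_cong) (use algorithm in \<open>simp add: spaceF block_pdps_def\<close>)
    then show ?case by simp
  next
    case (Suc i)
    obtain \<Phi> where \<Phi>: "\<forall>\<omega>\<in>space M. (x (Suc i) \<omega>, y (Suc i) \<omega>) = \<Phi> (x i \<omega>, y i \<omega>, S i \<omega>)"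
      using update by blast
    have "simple_function (Fil (Suc i)) (\<lambda>\<omega>. ((x i \<omega>, y i \<omega>), S i \<omega>))"
      by (intro simple_function_Pair S_simple simple_function_on_subalgebra[OF filtration(2) Suc])
    then have "simple_function (Fil (Suc i)) (\<lambda>\<omega>. \<Phi> (x i \<omega>, y i \<omega>, S i \<omega>))"
      using simple_function_compose1[of "Fil (Suc i)" "\<lambda>\<omega>. ((x i \<omega>, y i \<omega>), S i \<omega>)" "\<lambda>((u, v), s). \<Phi> (u, v, s)"] by simp
    moreover have "simple_function (Fil (Suc i)) (\<lambda>\<omega>. (x (Suc i) \<omega>, y (Suc i) \<omega>))
        \<longleftrightarrow> simple_function (Fil (Suc i)) (\<lambda>\<omega>. \<Phi> (x i \<omega>, y i \<omega>, S i \<omega>))"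
      by (rule simple_function_cong) (use \<Phi> in \<open>simp add: spaceF\<close>)
    ultimately show ?case by blast
  qed
  have sfF: "simple_function (Fil i) (\<lambda>\<omega>. h (x i \<omega>) (y i \<omega>))" for i and h :: "'x \<Rightarrow> 'y \<Rightarrow> real"
    using simple_function_compose1[OF sf[of i], of "\<lambda>(u, v). h u v"] by simp
  have sfS: "simple_function M (\<lambda>\<omega>. h (x i \<omega>) (y i \<omega>) (S i \<omega>))" for i and h :: "'x \<Rightarrow> 'y \<Rightarrow> nat set \<Rightarrow> real"
    using simple_function_compose2[of M "\<lambda>\<omega>. (x i \<omega>, y i \<omega>)" "S i" "\<lambda>(u, v) s. h u v s"]
      simple_function_on_subalgebra[OF filtration(1) sf] simple_function_on_subalgebra[OF filtration(1) S_simple] by simp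
  note integ = integrable_simple_function_real[OF sfS]
  have integ2: "integrable M (\<lambda>\<omega>. h (x i \<omega>) (y i \<omega>))" for i and h :: "'x \<Rightarrow> 'y \<Rightarrow> real"
    using integ[of "\<lambda>u v s. h u v" i] by simp

  have sets_S: "{\<omega>\<in>space M. j \<in> S i \<omega>} \<in> sets M" for i j
  proof -
    have "S i -` {s. j \<in> s} \<inter> space M \<in> sets M"
      by (rule simple_functionD(2)[OF simple_function_on_subalgebra[OF filtration(1) S_simple]])
    moreover have "S i -` {s. j \<in> s} \<inter> space M = {\<omega>\<in>space M. j \<in> S i \<omega>}" by auto
    ultimately show ?thesis by simp
  qed
  have E_ind: "(\<integral>\<omega>. h (x i \<omega>) (y i \<omega>) * indicator (S i \<omega>) j \<partial>M) = pr j * (\<integral>\<omega>. h (x i \<omega>) (y i \<omega>) \<partial>M)"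
    if j: "j \<in> {1..m}" for i j and h :: "'x \<Rightarrow> 'y \<Rightarrow> real"
  proof -
    have "(\<integral>\<omega>. h (x i \<omega>) (y i \<omega>) * indicator (S i \<omega>) j \<partial>M)
      = (\<integral>\<omega>. h (x i \<omega>) (y i \<omega>) * indicator {\<omega>\<in>space M. j \<in> S i \<omega>} \<omega> \<partial>M)"
      by (rule Bochner_Integration.integral_cong) (auto simp: indicator_def)
    also have "\<dots> = pr j * (\<integral>\<omega>. h (x i \<omega>) (y i \<omega>) \<partial>M)"
      by (rule integral_mult_cond_prob[OF filtration(1) sfF sets_S pr(2)[OF j]])
    finally show ?thesis .
  qed
  \<comment> \<open>\<open>pr j\<close> is the expectation of an indicator.\<close>
  have pr1: "pr j \<le> 1" if "j \<in> {1..m}" for j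
  proof -
    have "pr j = (\<integral>\<omega>. indicator (S 0 \<omega>) j \<partial>M)" using E_ind[OF that, of "\<lambda>_ _. 1" 0] by (simp add: prob_space)
    also have "\<dots> \<le> (\<integral>\<omega>. 1 \<partial>M)"
      using integ[of "\<lambda>u v s. indicator s j" 0] by (intro integral_mono) (auto simp: indicator_def)
    finally show ?thesis by (simp add: prob_space)
  qed

  have near: "AE \<omega> in M. norm (x (Suc i) \<omega> - xh) \<le> \<rho>x \<and> (\<forall>l\<in>{1..n}. norm (P_NL K (Q l (y (Suc i) \<omega> - yh))) \<le> \<rho> l)" for i
  proof -
    let ?A = "{(u, v). norm (u - xh) \<le> \<rho>x \<and> (\<forall>l\<in>{1..n}. psd_norm (P_NL K) (Q l (v - yh)) \<le> \<rho> l)}"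
    let ?B = "{\<omega>\<in>space M. norm (x (Suc i) \<omega> - xh) \<le> \<rho>x \<and> (\<forall>l\<in>{1..n}. psd_norm (P_NL K) (Q l (y (Suc i) \<omega> - yh)) \<le> \<rho> l)}"
    have "(\<lambda>\<omega>. (x (Suc i) \<omega>, y (Suc i) \<omega>)) -` ?A \<inter> space M \<in> sets M"
      by (rule simple_functionD(2)[OF simple_function_on_subalgebra[OF filtration(1) sf]])
    moreover have "(\<lambda>\<omega>. (x (Suc i) \<omega>, y (Suc i) \<omega>)) -` ?A \<inter> space M = ?B" by auto
    ultimately have "?B \<in> sets M" by simp
    from cond_prob_one_AE[OF filtration(1) this bound_cond] show ?thesis
      by eventually_elim (simp add: psd_norm_P_NL)
  qed
  have coupling: "AE \<omega> in M. \<forall>v. (\<Sum>j\<in>S i \<omega>. \<tau> 0 j / pr j * (norm (P j (adjoint (dK (x i \<omega>)) v)))\<^sup>2)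
      \<le> (1 - \<kappa>) * (\<Sum>l=1..n. (norm (Q l v))\<^sup>2 / \<sigma> 0 l)" for i
  proof -
    \<comment> \<open>Only the finite quantifier over \<open>l\<close> is exchanged with the almost
      sure statement; the one over \<open>v\<close> comes from the pathwise lemma, on the same
      event.\<close>
    have "AE \<omega> in M. \<forall>l\<in>{1..n}. 1 - \<kappa> \<ge>
           (norm (\<Sum>j\<in>S i \<omega>.
              sqrt (block_weight n P Q w (dK (x i \<omega>)) (S i \<omega>) j l * \<sigma> 0 l * \<tau> 0 j / pr j)
                *\<^sub>R (Q l o\<^sub>L dK (x i \<omega>) o\<^sub>L P j)))\<^sup>2"
      by (rule AE_finite_allI) (use step_cond_\<kappa> in auto)
    then show ?thesis using AE_space
    proof eventually_elim
      case (elim \<omega>)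
      show ?case
        by (intro allI dual_coupling_bound[where w = w, OF blocks S_sub[OF elim(2)] w pr(1) steps(1,2)]) (use elim(1) in auto)
    qed
  qed

  \<comment> \<open>The dual update with index \<open>i\<close> uses
    \<open>\<sigma> (Suc i)\<close>, whose reciprocal \<open>gamFb\<close> raises to that of
    \<open>\<sigma> (Suc (Suc i))\<close>; this fixes the shifted index of the dual weights.\<close>
  define pot where "pot i u v = (\<Sum>j=1..m. 1 / (2 * pr j) * (1 / \<tau> i j) * (norm (P j (u - xh)))\<^sup>2)
    + (\<Sum>l=1..n. 1 / 2 * (1 / \<sigma> (Suc i) l) * (norm (Q l (v - yh)))\<^sup>2)" for i u v
  define B where "B u v = dK u (u - xh) \<bullet> (v - yh)" for u v
  define C where "C = p powr (- p) * (\<Sum>l=1..n. rpow (\<zeta> l) (1 - p) * rpow (\<rho> l) (2 - p))"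
  define \<theta>S where "\<theta>S s = \<theta> (\<Sum>j\<in>s. (1 / pr j) *\<^sub>R P j)" for s
  define err where "err u = norm (K xh - K u - dK u (xh - u)) powr p" for u
  define accel where "accel u s = (\<Sum>j=1..m. gamGt j / (pr j)\<^sup>2 * (indicator s j - pr j) * (norm (P j (u - xh)))\<^sup>2)" for u s
  define Bs where "Bs u v s = (\<Sum>j=1..m. 1 / pr j * (indicator s j * (dK u (P j (u - xh)) \<bullet> (v - yh))))" for u v s

  have descent: "AE \<omega> in M. pot (Suc i) (x (Suc i) \<omega>) (y (Suc i) \<omega>) - B (x (Suc i) \<omega>) (y (Suc i) \<omega>)
      + (\<theta>S (S i \<omega>) - C) * err (x i \<omega>) + accel (x i \<omega>) (S i \<omega>) + Bs (x i \<omega>) (y i \<omega>) (S i \<omega>)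
    \<le> pot i (x i \<omega>) (y i \<omega>)" for i
    using AE_space local[of i] local[of "Suc i"] near[of i] coupling[of i]
  proof eventually_elim
    case (elim \<omega>)
    note \<omega> = elim(1) and S\<omega> = S_sub[OF elim(1), of i]
    \<comment> \<open>The new iterate need not lie on the segment to the extrapolated point, since
      blocks are extrapolated by different factors; locality at index \<open>Suc i\<close> puts it
      into \<open>XK\<close> as the start of the next segment.\<close>
    have XK: "x i \<omega> \<in> XK" "x (Suc i) \<omega> \<in> XK" "closed_segment (x i \<omega>) (xbar (Suc i) \<omega>) \<subseteq> XK"
      using elim(2,3) unfolding iterates_local_def by auto
    interpret pdps_step m n P Q K dK XK "S i \<omega>" xh "x i \<omega>" "x (Suc i) \<omega>" "xbar (Suc i) \<omega>"
      yh "y i \<omega>" "y (Suc i) \<omega>" pr "\<tau> 0" "\<tau> i" gamG gamK gamGt c "\<sigma> 0" "\<sigma> (Suc i)" gamF gamFb \<zeta> \<rho>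
      L L3 Lbar p \<alpha> \<delta> \<kappa> \<rho>x "\<theta>S (S i \<omega>)"
    proof (rule pdps_step.intro)
      show "gamG j * (norm (P j (x (Suc i) \<omega> - xh)))\<^sup>2
        \<le> 1 / \<tau> i j * ((x i \<omega> - x (Suc i) \<omega>) \<bullet> P j (x (Suc i) \<omega> - xh))
          - (adjoint (dK (x i \<omega>)) (y i \<omega>) - adjoint (dK xh) yh) \<bullet> P j (x (Suc i) \<omega> - xh)"
        if "j \<in> S i \<omega>" for j
      proof -
        have j: "j \<in> {1..m}" using that S\<omega> by blast
        show ?thesis
          by (rule primal_step_monotone[OF blocks(1) G critical(1) j \<tau>_step(1)[OF j] x_upd[OF \<omega> j that] monotone(3)])
            (use elim(2) that j in \<open>auto simp: iterates_local_def\<close>)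
      qed
      show "(\<Sum>l=1..n. gamF l * (norm (Q l (y (Suc i) \<omega> - yh)))\<^sup>2)
        \<le> (\<Sum>l=1..n. 1 / \<sigma> (Suc i) l * ((y i \<omega> - y (Suc i) \<omega>) \<bullet> Q l (y (Suc i) \<omega> - yh)))
          + (K (xbar (Suc i) \<omega>) - K xh) \<bullet> (y (Suc i) \<omega> - yh)"
        by (rule dual_step_monotone[OF blocks(2) Fc critical(2) \<sigma>_step(1) y_upd[OF \<omega>] monotone(4)])
          (use elim(2) in \<open>auto simp: iterates_local_def\<close>)
      show "(\<Sum>j\<in>S i \<omega>. gamK j / pr j * (norm (P j (x (Suc i) \<omega> - xh)))\<^sup>2)
          + \<theta>S (S i \<omega>) * norm (K xh - K (x i \<omega>) - dK (x i \<omega>) (xh - x i \<omega>)) powr p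
          - L3 / 2 * (\<Sum>j\<in>S i \<omega>. 1 / pr j * (norm (P j (x (Suc i) \<omega> - x i \<omega>)))\<^sup>2)
        \<le> (\<Sum>j\<in>S i \<omega>. 1 / pr j * (adjoint (dK (x i \<omega>) - dK xh) yh \<bullet> P j (x (Suc i) \<omega> - xh)))"
        unfolding \<theta>S_def by (rule three_point_blocks[OF blocks(1) S\<omega> pr(1) three_point(4) XK(1,2)])
      show "0 < \<tau> i j \<and> \<tau> i j \<le> \<tau> 0 j" if "j \<in> {1..m}" for j using \<tau>_step(1,2)[OF that] by blast
      show "0 < \<sigma> (Suc i) l \<and> \<sigma> (Suc i) l \<le> \<sigma> 0 l" if "l \<in> {1..n}" for l using \<sigma>_step(1,2)[OF that] by blast
      show "norm (x (Suc i) \<omega> - xh) \<le> \<rho>x" using elim(4) by blast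
      show "norm (P_NL K (Q l (y (Suc i) \<omega> - yh))) \<le> \<rho> l" if "l \<in> {1..n}" for l using elim(4) that by blast
      show "(\<Sum>j\<in>S i \<omega>. \<tau> 0 j / pr j * (norm (P j (adjoint (dK (x i \<omega>)) v)))\<^sup>2)
        \<le> (1 - \<kappa>) * (\<Sum>l=1..n. (norm (Q l v))\<^sup>2 / \<sigma> 0 l)" for v using elim(5) by blast
    qed (fact blocks K_C1(1) Lipschitz three_point(2,3) S\<omega> pr(1) pr1 x_keep[OF \<omega>] xbar_eq[OF \<omega>] XK
        \<alpha>_\<zeta> gamFb(1) gamGt c constants(1-3) Lbar step_cond_\<delta>)+
    have inv: "1 / \<tau> i j + 2 * gamGt j = 1 / \<tau> (Suc i) j" if "j \<in> {1..m}" for j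
      using \<tau>_step(3)[OF that, of i] by simp
    have inv': "1 / \<sigma> (Suc i) l + 2 * gamFb l = 1 / \<sigma> (Suc (Suc i)) l" if "l \<in> {1..n}" for l
      using \<sigma>_step(3)[OF that, of "Suc i"] by simp
    have sums: "(\<Sum>j=1..m. 1 / (2 * pr j) * (1 / \<tau> i j + 2 * gamGt j) * (norm (P j (x (Suc i) \<omega> - xh)))\<^sup>2)
        = (\<Sum>j=1..m. 1 / (2 * pr j) * (1 / \<tau> (Suc i) j) * (norm (P j (x (Suc i) \<omega> - xh)))\<^sup>2)"
      "(\<Sum>l=1..n. 1 / 2 * (1 / \<sigma> (Suc i) l + 2 * gamFb l) * (norm (Q l (y (Suc i) \<omega> - yh)))\<^sup>2)
        = (\<Sum>l=1..n. 1 / 2 * (1 / \<sigma> (Suc (Suc i)) l) * (norm (Q l (y (Suc i) \<omega> - yh)))\<^sup>2)"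
      by (rule sum.cong[OF refl], simp only: inv, rule sum.cong[OF refl], simp only: inv')
    show ?case
      using descent unfolding sums young_const_def C_def[symmetric] pot_def B_def err_def accel_def Bs_def .
  qed

  \<comment> \<open>The weight 1 / \<open>pr j\<close> cancels the conditional selection
    probability, after which the blocks add up to the identity.\<close>
  have Bs_mean: "(\<integral>\<omega>. Bs (x i \<omega>) (y i \<omega>) (S i \<omega>) \<partial>M) = (\<integral>\<omega>. B (x i \<omega>) (y i \<omega>) \<partial>M)" for i
  proof -
    define b where "b j u v = dK u (P j (u - xh)) \<bullet> (v - yh)" for j u v
    have "(\<integral>\<omega>. Bs (x i \<omega>) (y i \<omega>) (S i \<omega>) \<partial>M)
      = (\<Sum>j=1..m. \<integral>\<omega>. 1 / pr j * (indicator (S i \<omega>) j * b j (x i \<omega>) (y i \<omega>)) \<partial>M)"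
      unfolding Bs_def b_def[symmetric]
      by (intro Bochner_Integration.integral_sum integ[of "\<lambda>u v s. 1 / pr j * (indicator s j * b j u v)" for j])
    also have "\<dots> = (\<Sum>j=1..m. \<integral>\<omega>. b j (x i \<omega>) (y i \<omega>) \<partial>M)"
    proof (rule sum.cong[OF refl])
      fix j assume j: "j \<in> {1..m}"
      show "(\<integral>\<omega>. 1 / pr j * (indicator (S i \<omega>) j * b j (x i \<omega>) (y i \<omega>)) \<partial>M) = (\<integral>\<omega>. b j (x i \<omega>) (y i \<omega>) \<partial>M)"
        using E_ind[OF j, of "b j" i] pr(1)[OF j] by (simp add: mult.commute)
    qed
    also have "\<dots> = (\<integral>\<omega>. (\<Sum>j=1..m. b j (x i \<omega>) (y i \<omega>)) \<partial>M)"
      by (intro Bochner_Integration.integral_sum[symmetric] integ2)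
    also have "\<dots> = (\<integral>\<omega>. B (x i \<omega>) (y i \<omega>) \<partial>M)"
      unfolding b_def B_def inner_sum_left[symmetric] blinfun.sum_right[symmetric]
      by (simp only: block_decompositionD(4)[OF blocks(1)])
    finally show ?thesis .
  qed
  have accel_mean: "(\<integral>\<omega>. accel (x i \<omega>) (S i \<omega>) \<partial>M) = 0" for i
  proof -
    define b where "b j u = (norm (P j (u - xh)))\<^sup>2" for j u
    have "(\<integral>\<omega>. accel (x i \<omega>) (S i \<omega>) \<partial>M)
      = (\<Sum>j=1..m. \<integral>\<omega>. gamGt j / (pr j)\<^sup>2 * (indicator (S i \<omega>) j - pr j) * b j (x i \<omega>) \<partial>M)"
      unfolding accel_def b_def[symmetric]
      by (intro Bochner_Integration.integral_sum integ[of "\<lambda>u v s. gamGt j / (pr j)\<^sup>2 * (indicator s j - pr j) * b j u" for j])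
    also have "\<dots> = (\<Sum>j=1..m. 0)"
    proof (rule sum.cong[OF refl])
      fix j assume j: "j \<in> {1..m}"
      have expand: "k * (c - q) * d = k * (d * c - q * d)" for k c q d :: real by (simp add: algebra_simps)
      have "(\<integral>\<omega>. gamGt j / (pr j)\<^sup>2 * (indicator (S i \<omega>) j - pr j) * b j (x i \<omega>) \<partial>M)
        = (\<integral>\<omega>. gamGt j / (pr j)\<^sup>2 * (b j (x i \<omega>) * indicator (S i \<omega>) j - pr j * b j (x i \<omega>)) \<partial>M)"
        by (rule Bochner_Integration.integral_cong[OF refl]) (rule expand)
      also have "\<dots> = gamGt j / (pr j)\<^sup>2 * ((\<integral>\<omega>. b j (x i \<omega>) * indicator (S i \<omega>) j \<partial>M) - pr j * (\<integral>\<omega>. b j (x i \<omega>) \<partial>M))"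
        using integ[of "\<lambda>u v s. b j u * indicator s j" i] integ2[of "\<lambda>u v. b j u" i] by simp
      also have "\<dots> = 0" using E_ind[OF j, of "\<lambda>u v. b j u" i] by simp
      finally show "(\<integral>\<omega>. gamGt j / (pr j)\<^sup>2 * (indicator (S i \<omega>) j - pr j) * b j (x i \<omega>) \<partial>M) = 0" .
    qed
    finally show ?thesis by simp
  qed
  \<comment> \<open>\<open>err\<close> is nonnegative and depends on the current iterate only, so it
    may multiply the bound on the conditional mean of \<theta>, even though
    \<open>\<theta>S - C\<close> can be negative on single paths.\<close>
  have err_mean: "C * (\<integral>\<omega>. err (x i \<omega>) \<partial>M) \<le> (\<integral>\<omega>. \<theta>S (S i \<omega>) * err (x i \<omega>) \<partial>M)" for i
    by (rule integral_mult_cond_exp_ge[OF filtration(1) sfF[of i "\<lambda>u v. err u"] sfS[of "\<lambda>u v s. \<theta>S s" i]])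
      (use \<theta>_cond[of i] in \<open>simp_all add: err_def \<theta>S_def C_def\<close>)

  define V where "V i = (\<integral>\<omega>. pot i (x i \<omega>) (y i \<omega>) \<partial>M) - (\<integral>\<omega>. B (x i \<omega>) (y i \<omega>) \<partial>M)" for i
  have V_step: "V (Suc i) \<le> V i" for i
  proof -
    have i1: "integrable M (\<lambda>\<omega>. pot (Suc i) (x (Suc i) \<omega>) (y (Suc i) \<omega>))" "integrable M (\<lambda>\<omega>. B (x (Suc i) \<omega>) (y (Suc i) \<omega>))"
      by (rule integ2)+
    have i2: "integrable M (\<lambda>\<omega>. err (x i \<omega>))" "integrable M (\<lambda>\<omega>. pot i (x i \<omega>) (y i \<omega>))"
      using integ2[of "\<lambda>u v. err u" i] integ2[of "pot i" i] by simp_all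
    have i3: "integrable M (\<lambda>\<omega>. \<theta>S (S i \<omega>) * err (x i \<omega>))" "integrable M (\<lambda>\<omega>. accel (x i \<omega>) (S i \<omega>))"
      "integrable M (\<lambda>\<omega>. Bs (x i \<omega>) (y i \<omega>) (S i \<omega>))"
      using integ[of "\<lambda>u v s. \<theta>S s * err u" i] integ[of "\<lambda>u v s. accel u s" i] integ[of Bs i] by simp_all
    have "(\<integral>\<omega>. pot (Suc i) (x (Suc i) \<omega>) (y (Suc i) \<omega>) - B (x (Suc i) \<omega>) (y (Suc i) \<omega>)
      + (\<theta>S (S i \<omega>) * err (x i \<omega>) - C * err (x i \<omega>)) + accel (x i \<omega>) (S i \<omega>) + Bs (x i \<omega>) (y i \<omega>) (S i \<omega>) \<partial>M)
      \<le> (\<integral>\<omega>. pot i (x i \<omega>) (y i \<omega>) \<partial>M)"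
      by (intro integral_mono_AE Bochner_Integration.integrable_add Bochner_Integration.integrable_diff
          integrable_mult_right i1 i2 i3) (use descent[of i] in \<open>simp add: left_diff_distrib\<close>)
    also have "(\<integral>\<omega>. pot (Suc i) (x (Suc i) \<omega>) (y (Suc i) \<omega>) - B (x (Suc i) \<omega>) (y (Suc i) \<omega>)
      + (\<theta>S (S i \<omega>) * err (x i \<omega>) - C * err (x i \<omega>)) + accel (x i \<omega>) (S i \<omega>) + Bs (x i \<omega>) (y i \<omega>) (S i \<omega>) \<partial>M)
      = V (Suc i) + ((\<integral>\<omega>. \<theta>S (S i \<omega>) * err (x i \<omega>) \<partial>M) - C * (\<integral>\<omega>. err (x i \<omega>) \<partial>M))
        + (\<integral>\<omega>. accel (x i \<omega>) (S i \<omega>) \<partial>M) + (\<integral>\<omega>. Bs (x i \<omega>) (y i \<omega>) (S i \<omega>) \<partial>M)"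
      using i1 i2 i3 by (simp add: V_def)
    finally show ?thesis using err_mean[of i] unfolding accel_mean Bs_mean by (simp add: V_def)
  qed
  have V_le: "V i \<le> V 0" for i by (induction i) (use V_step order_trans in auto)

  \<comment> \<open>This value balances the factors \<open>s / 2\<close> and
    \<open>(1 - \<kappa>) / (2 * s)\<close> of the coupling bound.\<close>
  define s where "s = sqrt (1 - \<kappa>)"
  have s: "0 < s" "s < 1" "(1 - \<kappa>) / (2 * s) = s / 2"
  proof -
    show "0 < s" "s < 1" using constants by (auto simp: s_def)
    then show "(1 - \<kappa>) / (2 * s) = s / 2" using real_sqrt_pow2[of "1 - \<kappa>"] constants
      by (simp add: s_def[symmetric] field_simps power2_eq_square)
  qed
  \<comment> \<open>\<open>B\<close> contains all blocks of the derivative, while the coupling bound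
    speaks of selected ones. So \<open>B\<close> is exchanged for \<open>Bs\<close>, which has the
    same mean; after the pathwise bound, the expectation turns the selected blocks of
    \<open>as\<close>, weighted by 1 / \<open>pr j\<close>, into all blocks of \<open>a\<close> with
    weight 1.\<close>
  have B_mean: "(\<integral>\<omega>. B (x i \<omega>) (y i \<omega>) \<partial>M) \<le> s * (\<integral>\<omega>. pot i (x i \<omega>) (y i \<omega>) \<partial>M)" for i
  proof -
    define b where "b j u = (norm (P j (u - xh)))\<^sup>2" for j u
    define e where "e v = (\<Sum>l=1..n. (norm (Q l (v - yh)))\<^sup>2 / \<sigma> (Suc i) l)" for v
    define a where "a u = (\<Sum>j=1..m. b j u / \<tau> i j)" for u
    define as where "as u s = (\<Sum>j=1..m. 1 / (pr j * \<tau> i j) * (b j u * indicator s j))" for u s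
    have "AE \<omega> in M. Bs (x i \<omega>) (y i \<omega>) (S i \<omega>) \<le> s / 2 * as (x i \<omega>) (S i \<omega>) + s / 2 * e (y i \<omega>)"
      using AE_space coupling[of i]
    proof eventually_elim
      case (elim \<omega>)
      note S\<omega> = S_sub[OF elim(1), of i]
      have "(\<Sum>j\<in>S i \<omega>. 1 / pr j * (dK (x i \<omega>) (P j (x i \<omega> - xh)) \<bullet> (y i \<omega> - yh)))
        \<le> s / 2 * (\<Sum>j\<in>S i \<omega>. (norm (P j (x i \<omega> - xh)))\<^sup>2 / (pr j * \<tau> i j))
          + (1 - \<kappa>) / (2 * s) * (\<Sum>l=1..n. (norm (Q l (y i \<omega> - yh)))\<^sup>2 / \<sigma> (Suc i) l)"
        using constants(3) by (intro coupling_bound[OF blocks(1) S\<omega> s(1) _ pr(1)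
          conjI[OF \<tau>_step(1,2)] conjI[OF \<sigma>_step(1,2)] spec[OF elim(2)]]) auto
      moreover have "(\<Sum>j\<in>S i \<omega>. 1 / pr j * (dK (x i \<omega>) (P j (x i \<omega> - xh)) \<bullet> (y i \<omega> - yh))) = Bs (x i \<omega>) (y i \<omega>) (S i \<omega>)"
        unfolding Bs_def using S\<omega> by (intro sum.mono_neutral_cong_left) (auto simp: indicator_def)
      moreover have "(\<Sum>j\<in>S i \<omega>. (norm (P j (x i \<omega> - xh)))\<^sup>2 / (pr j * \<tau> i j)) = as (x i \<omega>) (S i \<omega>)"
        unfolding as_def b_def using S\<omega> by (intro sum.mono_neutral_cong_left) (auto simp: indicator_def)
      ultimately show ?case unfolding s(3) e_def by simp
    qed
    moreover have i1: "integrable M (\<lambda>\<omega>. as (x i \<omega>) (S i \<omega>))" "integrable M (\<lambda>\<omega>. e (y i \<omega>))"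
      "integrable M (\<lambda>\<omega>. Bs (x i \<omega>) (y i \<omega>) (S i \<omega>))" "integrable M (\<lambda>\<omega>. a (x i \<omega>))"
      using integ[of "\<lambda>u v s. as u s" i] integ2[of "\<lambda>u v. e v" i] integ[of Bs i] integ2[of "\<lambda>u v. a u" i] by simp_all
    ultimately have "(\<integral>\<omega>. Bs (x i \<omega>) (y i \<omega>) (S i \<omega>) \<partial>M) \<le> (\<integral>\<omega>. s / 2 * as (x i \<omega>) (S i \<omega>) + s / 2 * e (y i \<omega>) \<partial>M)"
      by (intro integral_mono_AE) auto
    also have "\<dots> = s / 2 * (\<integral>\<omega>. as (x i \<omega>) (S i \<omega>) \<partial>M) + s / 2 * (\<integral>\<omega>. e (y i \<omega>) \<partial>M)"
      using i1 by simp
    also have "(\<integral>\<omega>. as (x i \<omega>) (S i \<omega>) \<partial>M) = (\<integral>\<omega>. a (x i \<omega>) \<partial>M)"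
    proof -
      have "(\<integral>\<omega>. as (x i \<omega>) (S i \<omega>) \<partial>M) = (\<Sum>j=1..m. \<integral>\<omega>. 1 / (pr j * \<tau> i j) * (b j (x i \<omega>) * indicator (S i \<omega>) j) \<partial>M)"
        unfolding as_def
        by (intro Bochner_Integration.integral_sum integ[of "\<lambda>u v s. 1 / (pr j * \<tau> i j) * (b j u * indicator s j)" for j])
      also have "\<dots> = (\<Sum>j=1..m. \<integral>\<omega>. b j (x i \<omega>) / \<tau> i j \<partial>M)"
      proof (rule sum.cong[OF refl])
        fix j assume j: "j \<in> {1..m}"
        show "(\<integral>\<omega>. 1 / (pr j * \<tau> i j) * (b j (x i \<omega>) * indicator (S i \<omega>) j) \<partial>M) = (\<integral>\<omega>. b j (x i \<omega>) / \<tau> i j \<partial>M)"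
          using E_ind[OF j, of "\<lambda>u v. b j u" i] pr(1)[OF j] by simp
      qed
      also have "\<dots> = (\<integral>\<omega>. a (x i \<omega>) \<partial>M)"
        unfolding a_def by (intro Bochner_Integration.integral_sum[symmetric] integ2[of "\<lambda>u v. b j u / \<tau> i j" for j])
      finally show ?thesis .
    qed
    also have "s / 2 * (\<integral>\<omega>. a (x i \<omega>) \<partial>M) + s / 2 * (\<integral>\<omega>. e (y i \<omega>) \<partial>M) = (\<integral>\<omega>. s / 2 * a (x i \<omega>) + s / 2 * e (y i \<omega>) \<partial>M)"
      using i1 by simp
    also have "\<dots> \<le> (\<integral>\<omega>. s * pot i (x i \<omega>) (y i \<omega>) \<partial>M)"
    proof (rule integral_mono)
      show "integrable M (\<lambda>\<omega>. s / 2 * a (x i \<omega>) + s / 2 * e (y i \<omega>))" using i1 by simp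
      show "integrable M (\<lambda>\<omega>. s * pot i (x i \<omega>) (y i \<omega>))" by (rule integ2)
      fix \<omega>
      \<comment> \<open>\<open>pot\<close> weighs the primal blocks by 1 / \<open>pr j\<close>,
        which is at least 1.\<close>
      have "a u / 2 \<le> (\<Sum>j=1..m. 1 / (2 * pr j) * (1 / \<tau> i j) * (norm (P j (u - xh)))\<^sup>2)" for u
        unfolding a_def b_def sum_divide_distrib
      proof (rule sum_mono)
        fix j assume j: "j \<in> {1..m}"
        have "1 * ((norm (P j (u - xh)))\<^sup>2 / \<tau> i j / 2) \<le> 1 / pr j * ((norm (P j (u - xh)))\<^sup>2 / \<tau> i j / 2)"
          using pr(1)[OF j] pr1[OF j] \<tau>_step(1)[OF j, of i] by (intro mult_right_mono) auto
        then show "(norm (P j (u - xh)))\<^sup>2 / \<tau> i j / 2 \<le> 1 / (2 * pr j) * (1 / \<tau> i j) * (norm (P j (u - xh)))\<^sup>2"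
          by (simp add: mult_ac)
      qed
      moreover have "e v / 2 = (\<Sum>l=1..n. 1 / 2 * (1 / \<sigma> (Suc i) l) * (norm (Q l (v - yh)))\<^sup>2)" for v
        unfolding e_def sum_divide_distrib by (rule sum.cong) simp_all
      ultimately have "a u / 2 + e v / 2 \<le> pot i u v" for u v unfolding pot_def by (simp add: add_mono)
      then have "s * (a (x i \<omega>) / 2 + e (y i \<omega>) / 2) \<le> s * pot i (x i \<omega>) (y i \<omega>)"
        using s(1) by (intro mult_left_mono) auto
      then show "s / 2 * a (x i \<omega>) + s / 2 * e (y i \<omega>) \<le> s * pot i (x i \<omega>) (y i \<omega>)" by (simp add: distrib_left)
    qed
    finally show ?thesis unfolding Bs_mean by simp
  qed
  \<comment> \<open>As \<open>s < 1\<close>, a positive fraction of the potential survives the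
    subtraction of the coupling.\<close>
  have pot_bound: "(\<integral>\<omega>. pot i (x i \<omega>) (y i \<omega>) \<partial>M) \<le> V 0 / (1 - s)" for i
  proof -
    have "(1 - s) * (\<integral>\<omega>. pot i (x i \<omega>) (y i \<omega>) \<partial>M) \<le> V 0"
      using V_le[of i] B_mean[of i] by (simp add: V_def left_diff_distrib)
    then show ?thesis using s(2) by (simp add: pos_le_divide_eq mult.commute)
  qed
  have primal_nonneg: "0 \<le> 1 / (2 * pr j) * (1 / \<tau> i j) * (norm (P j (u - xh)))\<^sup>2" if "j \<in> {1..m}" for i j u
    using pr(1)[OF that] \<tau>_step(1)[OF that, of i] by simp
  have dual_nonneg: "0 \<le> 1 / 2 * (1 / \<sigma> i l) * (norm (Q l (v - yh)))\<^sup>2" if "l \<in> {1..n}" for i l v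
    using \<sigma>_step(1)[OF that, of i] by simp

  show ?thesis
  proof (intro conjI ballI impI)
    fix j assume j: "j \<in> {1..m}" and pos: "0 < gamGt j"
    define a where "a N = (\<integral>\<omega>. (norm (P j (x N \<omega> - xh)))\<^sup>2 \<partial>M)" for N
    have a0: "0 \<le> a N" for N unfolding a_def by simp
    have "a N * (real N * (gamGt j / pr j)) \<le> V 0 / (1 - s)" for N
    proof -
      have "real N * (gamGt j / pr j) \<le> 1 / (2 * pr j) * (1 / \<tau> N j)"
        unfolding \<tau>_step(4)[OF j, of N] using steps(1)[OF j] pr(1)[OF j] by (simp add: field_simps)
      then have "a N * (real N * (gamGt j / pr j)) \<le> a N * (1 / (2 * pr j) * (1 / \<tau> N j))"
        using a0 by (intro mult_left_mono)
      also have "\<dots> = (\<integral>\<omega>. 1 / (2 * pr j) * (1 / \<tau> N j) * (norm (P j (x N \<omega> - xh)))\<^sup>2 \<partial>M)"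
        unfolding a_def by (simp add: mult.commute)
      also have "\<dots> \<le> (\<integral>\<omega>. pot N (x N \<omega>) (y N \<omega>) \<partial>M)"
      proof (rule integral_mono)
        show "integrable M (\<lambda>\<omega>. 1 / (2 * pr j) * (1 / \<tau> N j) * (norm (P j (x N \<omega> - xh)))\<^sup>2)"
          by (rule integ2[of "\<lambda>u v. 1 / (2 * pr j) * (1 / \<tau> N j) * (norm (P j (u - xh)))\<^sup>2"])
        show "integrable M (\<lambda>\<omega>. pot N (x N \<omega>) (y N \<omega>))" by (rule integ2)
        show "1 / (2 * pr j) * (1 / \<tau> N j) * (norm (P j (x N \<omega> - xh)))\<^sup>2 \<le> pot N (x N \<omega>) (y N \<omega>)" for \<omega>
          unfolding pot_def
          by (intro add_increasing2 sum_nonneg dual_nonneg member_le_sum[OF j primal_nonneg]) auto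
      qed
      also have "\<dots> \<le> V 0 / (1 - s)" by (rule pot_bound)
      finally show ?thesis .
    qed
    from rate_inverse_linear[of a, OF a0 this] pos pr(1)[OF j]
    show "(\<lambda>N. \<integral>\<omega>. (norm (P j (x N \<omega> - xh)))\<^sup>2 \<partial>M) \<longlonglongrightarrow> 0"
      "(\<lambda>N. \<integral>\<omega>. (norm (P j (x N \<omega> - xh)))\<^sup>2 \<partial>M) \<in> O(\<lambda>N. 1 / real N)"
      unfolding a_def[abs_def] by auto
  next
    fix l assume l: "l \<in> {1..n}" and pos: "0 < gamFb l"
    define a where "a N = (\<integral>\<omega>. (norm (Q l (y N \<omega> - yh)))\<^sup>2 \<partial>M)" for N
    have a0: "0 \<le> a N" for N unfolding a_def by simp
    have "a N * (real N * gamFb l) \<le> V 0 / (1 - s)" for N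
    proof -
      \<comment> \<open>The dual weight at time \<open>N\<close> has index \<open>Suc N\<close> and
        so contains N + 1 increments, of which \<open>N\<close> are used.\<close>
      have "real N * gamFb l \<le> 1 / 2 * (1 / \<sigma> (Suc N) l)"
        unfolding \<sigma>_step(4)[OF l, of "Suc N"] using steps(2)[OF l] pos by (simp add: field_simps)
      then have "a N * (real N * gamFb l) \<le> a N * (1 / 2 * (1 / \<sigma> (Suc N) l))"
        using a0 by (intro mult_left_mono)
      also have "\<dots> = (\<integral>\<omega>. 1 / 2 * (1 / \<sigma> (Suc N) l) * (norm (Q l (y N \<omega> - yh)))\<^sup>2 \<partial>M)"
        unfolding a_def by (simp add: mult.commute)
      also have "\<dots> \<le> (\<integral>\<omega>. pot N (x N \<omega>) (y N \<omega>) \<partial>M)"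
      proof (rule integral_mono)
        show "integrable M (\<lambda>\<omega>. 1 / 2 * (1 / \<sigma> (Suc N) l) * (norm (Q l (y N \<omega> - yh)))\<^sup>2)"
          by (rule integ2[of "\<lambda>u v. 1 / 2 * (1 / \<sigma> (Suc N) l) * (norm (Q l (v - yh)))\<^sup>2"])
        show "integrable M (\<lambda>\<omega>. pot N (x N \<omega>) (y N \<omega>))" by (rule integ2)
        show "1 / 2 * (1 / \<sigma> (Suc N) l) * (norm (Q l (y N \<omega> - yh)))\<^sup>2 \<le> pot N (x N \<omega>) (y N \<omega>)" for \<omega>
          unfolding pot_def
          by (intro add_increasing sum_nonneg primal_nonneg member_le_sum[OF l dual_nonneg]) auto
      qed
      also have "\<dots> \<le> V 0 / (1 - s)" by (rule pot_bound)
      finally show ?thesis .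
    qed
    from rate_inverse_linear[of a, OF a0 this] pos
    show "(\<lambda>N. \<integral>\<omega>. (norm (Q l (y N \<omega> - yh)))\<^sup>2 \<partial>M) \<longlonglongrightarrow> 0"
      "(\<lambda>N. \<integral>\<omega>. (norm (Q l (y N \<omega> - yh)))\<^sup>2 \<partial>M) \<in> O(\<lambda>N. 1 / real N)"
      unfolding a_def[abs_def] by auto
  qed
qed

end
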